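(* There exists an absolute constant $c\in\mathbb N$ such that \[ \Pr_{G\sim\mathbb G(n,\frac12)}\left\{\mathsf{sdpval}(G)\ge \frac{\sqrt n}{\log^c n}\right\}\ \ge\ 1-O(n^{-4}). \]
   Context: $\mathbb G(n,\tfrac12)$ is the Erdős–Rényi random graph on vertex set $[n]$, each edge present independently with probability $1/2$. For a graph $G$ on $[n]$, call a set $S\subseteq[n]$ a clique if every two distinct vertices of $S$ are adjacent in $G$; in particular $\emptyset$ and singletons are cliques. Let $\binom{n}{\le 2}$ denote the family of subsets of $[n]$ of size at most $2$. $\mathsf{sdpval}(G)$ is the optimum value of the degree-4 Sum-of-Squares relaxation of maximum clique: maximize $\sum_{i\in[n]}X_{\{i\},\{i\}}$ over real matrices $X$ with rows and columns indexed by $\binom{n}{\le2}$, subject to: $X_{S_1,S_2}\in[0,1]$ for all $S_1,S_2$; $X_{S_1,S_2}=X_{S_3,S_4}$ whenever $S_1\cup S_2=S_3\cup S_4$; $X_{S_1,S_2}=0$ whenever $S_1\cup S_2$ is not a clique in $G$; $X_{\emptyset,\emptyset}=1$; and $X$ positive semidefinite. *)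

theory Defs
  imports "HOL-Probability.Probability"
begin

text \<open>A simple graph on the vertex set \<open>[n] = {1..n}\<close> is represented by its set of edges, a subset
  of \<open>vertex_pairs n\<close>.\<close>

definition vertex_pairs :: "nat \<Rightarrow> nat set set" where
  "vertex_pairs n = {e. e \<subseteq> {1..n} \<and> card e = 2}"

definition erdos_renyi :: "nat \<Rightarrow> real \<Rightarrow> nat set set pmf" where
  "erdos_renyi n p =
     map_pmf (\<lambda>f. {e \<in> vertex_pairs n. f e})
       (Pi_pmf (vertex_pairs n) False (\<lambda>_. bernoulli_pmf p))"

definition clique :: "nat set set \<Rightarrow> nat set \<Rightarrow> bool" where
  "clique E S \<longleftrightarrow> (\<forall>u\<in>S. \<forall>v\<in>S. u \<noteq> v \<longrightarrow> {u, v} \<in> E)"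

definition subsets_le2 :: "nat \<Rightarrow> nat set set" where
  "subsets_le2 n = {S. S \<subseteq> {1..n} \<and> card S \<le> 2}"

text \<open>A real matrix with rows and columns indexed by a finite set \<open>I\<close> is a function of two arguments;
  its values outside \<open>I\<close> are irrelevant.\<close>

definition pos_semidef_on :: "'i set \<Rightarrow> ('i \<Rightarrow> 'i \<Rightarrow> real) \<Rightarrow> bool" where
  "pos_semidef_on I X \<longleftrightarrow>
     (\<forall>i\<in>I. \<forall>j\<in>I. X i j = X j i) \<and>
     (\<forall>x :: 'i \<Rightarrow> real. (\<Sum>i\<in>I. \<Sum>j\<in>I. x i * X i j * x j) \<ge> 0)"

definition sos4_feasible :: "nat \<Rightarrow> nat set set \<Rightarrow> (nat set \<Rightarrow> nat set \<Rightarrow> real) \<Rightarrow> bool" where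
  "sos4_feasible n E X \<longleftrightarrow>
     (\<forall>S1\<in>subsets_le2 n. \<forall>S2\<in>subsets_le2 n. X S1 S2 \<in> {0..1}) \<and>
     (\<forall>S1\<in>subsets_le2 n. \<forall>S2\<in>subsets_le2 n. \<forall>S3\<in>subsets_le2 n. \<forall>S4\<in>subsets_le2 n.
        S1 \<union> S2 = S3 \<union> S4 \<longrightarrow> X S1 S2 = X S3 S4) \<and>
     (\<forall>S1\<in>subsets_le2 n. \<forall>S2\<in>subsets_le2 n. \<not> clique E (S1 \<union> S2) \<longrightarrow> X S1 S2 = 0) \<and>
     X {} {} = 1 \<and>
     pos_semidef_on (subsets_le2 n) X"

definition sdpval :: "nat \<Rightarrow> nat set set \<Rightarrow> real" where
  "sdpval n E = Sup ((\<lambda>X. \<Sum>i\<in>{1..n}. X {i} {i}) ` {X. sos4_feasible n E X})"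

text \<open>The supremum defining \<^const>\<open>sdpval\<close> is over a nonempty set of reals that is bounded above.\<close>

lemma sos4_feasible_nonempty: "\<exists>X. sos4_feasible n E X"
proof -
  define X :: "nat set \<Rightarrow> nat set \<Rightarrow> real" where
    "X = (\<lambda>S T. of_bool (S = {}) * of_bool (T = {}))"
  have "(\<Sum>i\<in>subsets_le2 n. \<Sum>j\<in>subsets_le2 n. x i * X i j * x j) \<ge> 0" for x
  proof -
    have "(\<Sum>i\<in>subsets_le2 n. \<Sum>j\<in>subsets_le2 n. x i * X i j * x j)
        = (\<Sum>i\<in>subsets_le2 n. x i * of_bool (i = {})) * (\<Sum>j\<in>subsets_le2 n. x j * of_bool (j = {}))"
      unfolding sum_product X_def by (intro sum.cong refl) simp
    thus ?thesis by simp
  qed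
  hence "pos_semidef_on (subsets_le2 n) X"
    by (auto simp: pos_semidef_on_def X_def)
  hence "sos4_feasible n E X"
    by (auto simp: sos4_feasible_def X_def clique_def)
  thus ?thesis by blast
qed

lemma sos4_objective_bdd_above:
  "bdd_above ((\<lambda>X. \<Sum>i\<in>{1..n}. X {i} {i}) ` {X. sos4_feasible n E X})"
proof (rule bdd_aboveI2)
  fix X assume "X \<in> {X. sos4_feasible n E X}"
  hence "X {i} {i} \<le> 1" if "i \<in> {1..n}" for i
    using that by (auto simp: sos4_feasible_def subsets_le2_def)
  thus "(\<Sum>i\<in>{1..n}. X {i} {i}) \<le> real n"
    using sum_bounded_above[of "{1..n}" "\<lambda>i. X {i} {i}" 1] by simp
qed

end

theory Submission
  imports Defs
begin

text \<open>
  Write \<open>A i j\<close> for the \<open>\<plusminus>1\<close> adjacency signs. The pseudo-moments are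
  \<open>E[x\<^sub>U] = [U clique] \<cdot> K\<^bsup>s(s-1)/2\<^esup> \<kappa>\<^sup>s\<close> for \<open>s = |U|\<close>, with \<open>\<kappa> \<approx> 1 / (\<surd>n polylog n)\<close>; on 4-sets one adds
  \<open>K\<^bsup>10\<^esup> \<kappa>\<^sup>5 \<Sum>\<^sub>u \<Prod>\<^bsub>v\<in>U\<^esub> A u v\<close>. Since the objective has no constraint fixing \<open>\<Sum> x\<^sub>i\<close>, the factors
  \<open>K\<^bsup>s(s-1)/2\<^esup>\<close> may make the moments strictly log-convex, which absorbs all low-rank cross terms.
  In the quadratic form of \<open>p = p\<^sub>0 + \<Sum> p\<^sub>i x\<^sub>i + \<Sum> P\<^bsub>ij\<^esub> x\<^sub>i x\<^sub>j\<close> the only term of the uncorrected moments that is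
  too large is \<open>\<Sum>\<^sub>i r\<^sub>i q\<^sub>i\<close> with \<open>r\<^sub>i = \<Sum>\<^sub>j P\<^bsub>ij\<^esub>\<close>, \<open>q\<^sub>i = \<Sum>\<^bsub>kl\<^esub> A i k A i l P\<^bsub>kl\<^esub>\<close>; the correction contributes
  \<open>\<Sum>\<^sub>u q\<^sub>u\<^sup>2\<close>, which dominates it together with \<open>\<Sum>\<^sub>i r\<^sub>i\<^sup>2\<close>. All remaining terms are bounded by four random
  quantities: the norm of \<open>A\<close>, the norms of a 4-vertex and of a 5-vertex graph matrix, and the entries
  \<open>\<Sum>\<^sub>u \<Prod>\<^bsub>v\<in>U\<^esub> A u v\<close>.

  These are controlled by the trace method. Averaging over colourings of the vertices separates the edge slots
  of the graph matrix, so that along a closed walk with nonzero expectation the two vertex-disjoint paths from rows to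
  columns each trace out a closed walk in which every edge is used an even number of times; such a walk with
  \<open>2m\<close> steps visits at most \<open>m + 1\<close> vertices.
\<close>

section \<open>Quadratic forms and traces of powers\<close>

text \<open>Why the uncorrected moments stop short: \<open>\<Sum> r\<^sub>i q\<^sub>i\<close> enters
  at scale \<kappa>^4 and \<open>\<Sum> r\<^sub>i\<^sup>2\<close> at \<kappa>^3, so
  \<open>\<Sum> q\<^sub>i\<^sup>2\<close> at scale \<kappa>^5 must pay for it. The vector
  \<open>q\<close> is the image of \<open>P\<close> under an n by n^2 sign matrix of norm about n;
  paying out of the squares of \<open>P\<close>, which have scale \<kappa>^2, would force \<kappa>^3
  n^2 to be small and yield only a value near n^(1/3). The correction supplies the missing squares
  directly, and its factor K^10 \<kappa>^5 is the term s = 5 of the same sequence. Why log-convexity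
  suffices: with c_s = K^(s(s-1)/2) one has c_(2a) c_(2b) / c_(a+b)^2 = K^((a-b)^2), so a cross term
  loses a power of K against the geometric mean of its two squares. This serves the scalars
  \<open>p\<^sub>0\<close>, \<open>\<Sum> p\<^sub>i\<close>, \<open>\<Sum> r\<^sub>i\<close> at a =
  0, 1, 2 and equally the vectors \<open>p\<close>, \<open>r\<close>, \<open>q\<close> at a = 1/2,
  3/2, 5/2. K = 100 leaves room for the powers of 2 lost to edge densities.\<close>

definition qform :: "'i set \<Rightarrow> ('i \<Rightarrow> 'i \<Rightarrow> real) \<Rightarrow> ('i \<Rightarrow> real) \<Rightarrow> real" where
  "qform I H x = (\<Sum>a\<in>I. \<Sum>b\<in>I. x a * H a b * x b)"

fun mpow :: "'i set \<Rightarrow> ('i \<Rightarrow> 'i \<Rightarrow> real) \<Rightarrow> nat \<Rightarrow> 'i \<Rightarrow> 'i \<Rightarrow> real" where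
  "mpow I H 0 a b = of_bool (a = b)"
| "mpow I H (Suc k) a b = (\<Sum>c\<in>I. H a c * mpow I H k c b)"

lemma mpow_1: "finite I \<Longrightarrow> b \<in> I \<Longrightarrow> mpow I H (Suc 0) a b = H a b"
  by (simp add: sum.If_cases of_bool_def if_distrib cong: if_cong)

lemma mpow_add:
  assumes "finite I" "a \<in> I"
  shows "mpow I H (j + k) a b = (\<Sum>c\<in>I. mpow I H j a c * mpow I H k c b)"
  using assms(2)
proof (induction j arbitrary: a)
  case 0
  then show ?case using assms(1)
    by (simp add: of_bool_def if_distrib[of "\<lambda>x. x * _"] cong: if_cong)
next
  case (Suc j)
  have "mpow I H (Suc j + k) a b = (\<Sum>d\<in>I. \<Sum>c\<in>I. H a d * mpow I H j d c * mpow I H k c b)"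
    by (simp add: Suc.IH sum_distrib_left mult.assoc)
  also have "\<dots> = (\<Sum>c\<in>I. \<Sum>d\<in>I. H a d * mpow I H j d c * mpow I H k c b)"
    by (rule sum.swap)
  finally show ?case by (simp add: sum_distrib_right)
qed

lemma mpow_sym:
  assumes "finite I" "\<forall>a\<in>I. \<forall>b\<in>I. H a b = H b a" "a \<in> I" "b \<in> I"
  shows "mpow I H k a b = mpow I H k b a"
  using assms(3,4)
proof (induction k arbitrary: a b)
  case (Suc k)
  have "H a c * mpow I H k c b = mpow I H k b c * mpow I H (Suc 0) c a" if "c \<in> I" for c
    unfolding mpow_1[OF assms(1) \<open>a \<in> I\<close>]
    using Suc.IH[OF that Suc.prems(2)] assms(2) that Suc.prems(1) by simp
  then have "mpow I H (Suc k) a b = (\<Sum>c\<in>I. mpow I H k b c * mpow I H (Suc 0) c a)"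
    unfolding mpow.simps(2)[of I H k] by (intro sum.cong refl) simp
  also have "\<dots> = mpow I H (k + Suc 0) b a"
    using Suc assms(1) by (subst mpow_add) auto
  finally show ?case by simp
qed auto

text \<open>Cauchy-Schwarz for x and M x; by symmetry the squared length of M x is the form of
  M^2.\<close>

lemma qform_sq_le:
  assumes "finite I" and sym: "\<forall>a\<in>I. \<forall>b\<in>I. M a b = M b a"
  shows "(qform I M x)\<^sup>2 \<le> (\<Sum>a\<in>I. (x a)\<^sup>2) * qform I (\<lambda>a b. \<Sum>c\<in>I. M a c * M c b) x"
proof -
  have 1: "qform I M x = (\<Sum>a\<in>I. x a * (\<Sum>b\<in>I. M a b * x b))"
    by (simp add: qform_def sum_distrib_left mult.assoc)
  have "(\<Sum>c\<in>I. (\<Sum>b\<in>I. M c b * x b)\<^sup>2) = (\<Sum>c\<in>I. \<Sum>a\<in>I. \<Sum>b\<in>I. x a * M a c * M c b * x b)"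
    unfolding power2_eq_square sum_product
    using sym by (intro sum.cong refl) simp
  also have "\<dots> = (\<Sum>a\<in>I. \<Sum>c\<in>I. \<Sum>b\<in>I. x a * M a c * M c b * x b)"
    by (rule sum.swap)
  also have "\<dots> = (\<Sum>a\<in>I. \<Sum>b\<in>I. \<Sum>c\<in>I. x a * M a c * M c b * x b)"
    by (rule sum.cong[OF refl]) (rule sum.swap)
  also have "\<dots> = qform I (\<lambda>a b. \<Sum>c\<in>I. M a c * M c b) x"
    by (simp add: qform_def sum_distrib_left sum_distrib_right mult.assoc)
  finally show ?thesis
    unfolding 1 using Cauchy_Schwarz_ineq_sum[of x "\<lambda>a. \<Sum>b\<in>I. M a b * x b" I] by simp
qed

lemma qform_mpow_sq_le:
  assumes "finite I" and sym: "\<forall>a\<in>I. \<forall>b\<in>I. H a b = H b a"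
  shows "(qform I (mpow I H k) x)\<^sup>2 \<le> (\<Sum>a\<in>I. (x a)\<^sup>2) * qform I (mpow I H (2 * k)) x"
proof -
  have "qform I (\<lambda>a b. \<Sum>c\<in>I. mpow I H k a c * mpow I H k c b) x = qform I (mpow I H (2 * k)) x"
    unfolding qform_def mult_2 using assms(1) by (intro sum.cong refl) (simp add: mpow_add)
  then show ?thesis
    using qform_sq_le[OF assms(1), of "mpow I H k" x] mpow_sym[OF assms] by simp
qed

lemma trace_mpow_even:
  assumes "finite I" and sym: "\<forall>a\<in>I. \<forall>b\<in>I. H a b = H b a"
  shows "(\<Sum>a\<in>I. mpow I H (2 * k) a a) = (\<Sum>a\<in>I. \<Sum>b\<in>I. (mpow I H k a b)\<^sup>2)"
  unfolding mult_2 power2_eq_square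
  using assms(1) mpow_sym[OF assms] by (intro sum.cong refl) (simp add: mpow_add)

text \<open>By symmetry H^(2k) is a Gram matrix: its form at x is the squared length of H^k x, at
  most |x|^2 times the sum of the squared entries of H^k, and that sum is the trace of
  H^(2k).\<close>

lemma qform_mpow_le_trace:
  assumes "finite I" and sym: "\<forall>a\<in>I. \<forall>b\<in>I. H a b = H b a"
  shows "qform I (mpow I H (2 * k)) x \<le> (\<Sum>a\<in>I. (x a)\<^sup>2) * (\<Sum>a\<in>I. mpow I H (2 * k) a a)"
proof -
  have "qform I (mpow I H (2 * k)) x
      = (\<Sum>a\<in>I. \<Sum>b\<in>I. \<Sum>c\<in>I. (x a * mpow I H k c a) * (x b * mpow I H k c b))"
    unfolding qform_def mult_2 using assms(1) mpow_sym[OF assms, where k = k]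
    by (intro sum.cong refl) (simp add: mpow_add sum_distrib_left sum_distrib_right mult_ac)
  also have "\<dots> = (\<Sum>a\<in>I. \<Sum>c\<in>I. \<Sum>b\<in>I. (x a * mpow I H k c a) * (x b * mpow I H k c b))"
    by (rule sum.cong[OF refl]) (rule sum.swap)
  also have "\<dots> = (\<Sum>c\<in>I. \<Sum>a\<in>I. \<Sum>b\<in>I. (x a * mpow I H k c a) * (x b * mpow I H k c b))"
    by (rule sum.swap)
  also have "\<dots> = (\<Sum>c\<in>I. (\<Sum>a\<in>I. x a * mpow I H k c a)\<^sup>2)"
    by (simp add: power2_eq_square sum_product)
  also have "\<dots> \<le> (\<Sum>c\<in>I. (\<Sum>a\<in>I. (x a)\<^sup>2) * (\<Sum>a\<in>I. (mpow I H k c a)\<^sup>2))"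
    by (intro sum_mono Cauchy_Schwarz_ineq_sum)
  also have "\<dots> = (\<Sum>a\<in>I. (x a)\<^sup>2) * (\<Sum>a\<in>I. mpow I H (2 * k) a a)"
    by (simp add: trace_mpow_even[OF assms] sum_distrib_left)
  finally show ?thesis .
qed

text \<open>Each application of Cauchy-Schwarz doubles the exponent and squares the matrix.
  Iteration reaches exactly the powers of two, which is why all walk lengths have the form
  \<open>2 ^ Suc m\<close>.\<close>

lemma qform_power_le:
  assumes "finite I" and sym: "\<forall>a\<in>I. \<forall>b\<in>I. H a b = H b a"
  shows "(qform I H x) ^ (2 ^ Suc m) \<le> (\<Sum>a\<in>I. (x a)\<^sup>2) ^ (2 ^ Suc m - 1) * qform I (mpow I H (2 ^ Suc m)) x"
proof (induction m)
  case 0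
  have "qform I (mpow I H 1) x = qform I H x"
    unfolding qform_def One_nat_def using assms(1) by (intro sum.cong refl) (simp add: mpow_1 del: mpow.simps)
  then show ?case using qform_mpow_sq_le[OF assms, where k = 1 and x = x] by (simp del: mpow.simps)
next
  case (Suc m)
  let ?X = "\<Sum>a\<in>I. (x a)\<^sup>2" and ?L = "2 ^ Suc m :: nat"
  have "(qform I H x) ^ (2 ^ Suc (Suc m)) = ((qform I H x) ^ ?L)\<^sup>2"
    by (simp add: power_mult [symmetric] mult.commute)
  also have "\<dots> \<le> (?X ^ (?L - 1) * qform I (mpow I H ?L) x)\<^sup>2"
    using Suc by (intro power_mono) (auto simp: power_mult)
  also have "\<dots> = ?X ^ (2 * (?L - 1)) * (qform I (mpow I H ?L) x)\<^sup>2"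
    by (simp add: power_mult_distrib power_mult[symmetric] mult.commute)
  also have "\<dots> \<le> ?X ^ (2 * (?L - 1)) * (?X * qform I (mpow I H (2 * ?L)) x)"
    by (intro mult_left_mono qform_mpow_sq_le assms zero_le_power[of ?X] sum_nonneg) simp
  also have "\<dots> = ?X ^ Suc (2 * (?L - 1)) * qform I (mpow I H (2 * ?L)) x"
    by simp
  also have "Suc (2 * (?L - 1)) = 2 ^ Suc (Suc m) - 1"
    using one_le_power[of "2 :: nat" m] unfolding power_Suc by arith
  finally show ?case by simp
qed

text \<open>Plays the part of "the L-th power of the norm is at most the trace of H^L", phrased
  through quadratic forms alone.\<close>

lemma qform_power_le_trace:
  assumes "finite I" and sym: "\<forall>a\<in>I. \<forall>b\<in>I. H a b = H b a" and L: "L = 2 ^ Suc m"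
  shows "(qform I H x) ^ L \<le> (\<Sum>a\<in>I. (x a)\<^sup>2) ^ L * (\<Sum>a\<in>I. mpow I H L a a)"
proof -
  let ?X = "\<Sum>a\<in>I. (x a)\<^sup>2"
  have "L > 0" by (simp add: L)
  have "(qform I H x) ^ L \<le> ?X ^ (L - 1) * qform I (mpow I H (2 * 2 ^ m)) x"
    using qform_power_le[OF assms(1,2), of x m] by (simp add: L)
  also have "\<dots> \<le> ?X ^ (L - 1) * (?X * (\<Sum>a\<in>I. mpow I H (2 * 2 ^ m) a a))"
    by (intro mult_left_mono qform_mpow_le_trace assms(1,2) zero_le_power[of ?X] sum_nonneg) simp
  also have "\<dots> = ?X ^ Suc (L - 1) * (\<Sum>a\<in>I. mpow I H L a a)"
    unfolding L power_Suc by (simp only: mult_ac)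
  finally show ?thesis using \<open>L > 0\<close> by simp
qed

lemma trace_mpow_nonneg:
  assumes "finite I" and sym: "\<forall>a\<in>I. \<forall>b\<in>I. H a b = H b a" and L: "L = 2 ^ Suc m"
  shows "(\<Sum>a\<in>I. mpow I H L a a) \<ge> 0"
  using trace_mpow_even[OF assms(1,2), where k = "2 ^ m"] by (simp add: L sum_nonneg)

section \<open>The trace method for functions of random edge sets\<close>

text \<open>A step \<open>(u, b)\<close> of a walk moves to the index \<open>b\<close>; the label \<open>u\<close> is the summation variable
  of the matrix entry \<open>\<Sum>u. h a u b\<close>.\<close>

fun wprod :: "('i \<Rightarrow> 'u \<Rightarrow> 'i \<Rightarrow> real) \<Rightarrow> 'i \<Rightarrow> ('u \<times> 'i) list \<Rightarrow> real" where
  "wprod h a [] = 1"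
| "wprod h a ((u, b) # xs) = h a u b * wprod h b xs"

fun wend :: "'i \<Rightarrow> ('u \<times> 'i) list \<Rightarrow> 'i" where
  "wend a [] = a"
| "wend a ((u, b) # xs) = wend b xs"

definition walks :: "'u set \<Rightarrow> 'i set \<Rightarrow> nat \<Rightarrow> ('u \<times> 'i) list set" where
  "walks U I L = {xs. set xs \<subseteq> U \<times> I \<and> length xs = L}"

lemma finite_walks: "finite U \<Longrightarrow> finite I \<Longrightarrow> finite (walks U I L)"
  unfolding walks_def by (intro finite_lists_length_eq) auto

lemma walks_0: "walks U I 0 = {[]}"
  by (auto simp: walks_def)

lemma sum_walks_Suc:
  "(\<Sum>xs\<in>walks U I (Suc L). f xs) = (\<Sum>b\<in>I. \<Sum>u\<in>U. \<Sum>xs\<in>walks U I L. f ((u, b) # xs))"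
proof -
  have "walks U I (Suc L) = (\<lambda>(b, u, xs). (u, b) # xs) ` (I \<times> U \<times> walks U I L)"
    unfolding walks_def by (auto simp: length_Suc_conv image_iff)
  moreover have "inj_on (\<lambda>(b, u, xs). (u, b) # xs) (I \<times> U \<times> walks U I L)"
    by (auto simp: inj_on_def)
  ultimately show ?thesis
    by (simp add: sum.reindex sum.cartesian_product case_prod_unfold)
qed

lemma mpow_eq_sum_walks:
  assumes "finite I" "finite U"
  shows "mpow I (\<lambda>a b. \<Sum>u\<in>U. h a u b) L a b
    = (\<Sum>xs\<in>walks U I L. wprod h a xs * of_bool (wend a xs = b))"
proof (induction L arbitrary: a)
  case (Suc L)
  then show ?case
    by (simp add: sum_walks_Suc sum_distrib_left sum_distrib_right mult.assoc)
       (intro sum.cong refl sum.swap)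
qed (simp add: walks_0)

text \<open>\<open>ed a u b\<close> lists the edge slots of one step whose signs are tracked. These
  are lists because the parity of multiplicities is what matters.\<close>

fun wedges :: "('i \<Rightarrow> 'u \<Rightarrow> 'i \<Rightarrow> 'e list) \<Rightarrow> 'i \<Rightarrow> ('u \<times> 'i) list \<Rightarrow> 'e list" where
  "wedges ed a [] = []"
| "wedges ed a ((u, b) # xs) = ed a u b @ wedges ed b xs"

definition flip :: "'e \<Rightarrow> 'e set \<Rightarrow> 'e set" where
  "flip e G = (if e \<in> G then G - {e} else insert e G)"

lemma flip_flip [simp]: "flip e (flip e G) = G"
  by (auto simp: flip_def)

lemma sum_Pow_flip:
  assumes "e \<in> E"
  shows "(\<Sum>G\<in>Pow E. f (flip e G)) = (\<Sum>G\<in>Pow E. f G)"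
  by (rule sum.reindex_bij_witness[of _ "flip e" "flip e"]) (use assms in \<open>auto simp: flip_def\<close>)

text \<open>Flipping e is a sign-reversing bijection of the summands. As G(n,1/2) is uniform over
  edge sets, unnormalised sums over \<open>Pow E\<close> serve as expectations throughout.\<close>

lemma sum_Pow_odd_eq_0:
  fixes f :: "'e set \<Rightarrow> real"
  assumes "e \<in> E" "\<And>G. G \<subseteq> E \<Longrightarrow> f (flip e G) = - f G"
  shows "(\<Sum>G\<in>Pow E. f G) = 0"
proof -
  have "(\<Sum>G\<in>Pow E. f G) = (\<Sum>G\<in>Pow E. - f G)"
    unfolding sum_Pow_flip[OF assms(1), of f, symmetric] using assms(2) by (intro sum.cong) auto
  then show ?thesis by (simp add: sum_negf)
qed

lemma wprod_flip:
  assumes "\<And>a u b. h' a u b = (-1) ^ count_list (ed a u b) e * h a u b"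
  shows "wprod h' a xs = (-1) ^ count_list (wedges ed a xs) e * wprod h a xs"
  by (induction a xs rule: wend.induct) (simp_all add: assms power_add mult_ac)

lemma abs_wprod_le:
  fixes K :: real
  assumes "\<And>a u b. \<bar>h a u b\<bar> \<le> K"
  shows "\<bar>wprod h a xs\<bar> \<le> K ^ length xs"
proof (induction a xs rule: wend.induct)
  case (2 a u b xs)
  have "0 \<le> K" using assms[of a u b] by linarith
  then show ?case using 2 assms by (simp add: abs_mult mult_mono)
qed simp

text \<open>Jensen's inequality for an even power, by iterated Cauchy-Schwarz. It moves the average
  over colourings outside the L-th power, where each colouring is treated by its own trace.\<close>

lemma power_sum_le_card_mult_sum_power:
  fixes f :: "'c \<Rightarrow> real"
  shows "(\<Sum>c\<in>C. f c) ^ (2 ^ Suc m) \<le> real (card C) ^ (2 ^ Suc m - 1) * (\<Sum>c\<in>C. f c ^ (2 ^ Suc m))"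
proof (induction m)
  case 0
  then show ?case using sum_squared_le_sum_of_squares[of f C] by (simp add: mult.commute)
next
  case (Suc m)
  let ?L = "2 ^ Suc m :: nat"
  have "(\<Sum>c\<in>C. f c) ^ (2 ^ Suc (Suc m)) = ((\<Sum>c\<in>C. f c) ^ ?L)\<^sup>2"
    by (simp add: power_mult [symmetric] mult.commute)
  also have "\<dots> \<le> (real (card C) ^ (?L - 1) * (\<Sum>c\<in>C. f c ^ ?L))\<^sup>2"
    using Suc by (intro power_mono) (auto simp: power_mult)
  also have "\<dots> = real (card C) ^ (2 * (?L - 1)) * (\<Sum>c\<in>C. f c ^ ?L)\<^sup>2"
    by (simp add: power_mult_distrib power_mult[symmetric] mult.commute)
  also have "\<dots> \<le> real (card C) ^ (2 * (?L - 1)) * (real (card C) * (\<Sum>c\<in>C. (f c ^ ?L)\<^sup>2))"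
    using sum_squared_le_sum_of_squares[of "\<lambda>c. f c ^ ?L" C]
    by (intro mult_left_mono) (auto simp: mult.commute)
  also have "\<dots> = real (card C) ^ Suc (2 * (?L - 1)) * (\<Sum>c\<in>C. f c ^ (2 * ?L))"
    by (simp add: power_mult [symmetric] mult.commute)
  also have "Suc (2 * (?L - 1)) = 2 ^ Suc (Suc m) - 1"
    using one_le_power[of "2 :: nat" m] unfolding power_Suc by arith
  finally show ?case by simp
qed

text \<open>\<open>C\<close> is a set of colourings and \<open>Prot c\<close> a set of edges whose sign enters \<open>h c G a u b\<close> exactly through the
  slots \<open>ed a u b\<close>; flipping such an edge kills the expectation of every walk that uses it an odd number of times.\<close>

theorem trace_method:
  fixes h :: "'c \<Rightarrow> 'e set \<Rightarrow> 'i \<Rightarrow> 'u \<Rightarrow> 'i \<Rightarrow> real" and K N \<tau> :: real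
  assumes fin: "finite E" "finite C" "C \<noteq> {}" "finite I" "finite U"
    and L: "L = 2 ^ Suc m" and pos: "K > 0" "N > 0" "\<tau> > 0"
    and sym: "\<And>c G a b. c \<in> C \<Longrightarrow> a \<in> I \<Longrightarrow> b \<in> I \<Longrightarrow> (\<Sum>u\<in>U. h c G a u b) = (\<Sum>u\<in>U. h c G b u a)"
    and bound: "\<And>c G a u b. \<bar>h c G a u b\<bar> \<le> K"
    and prot: "\<And>c. Prot c \<subseteq> E"
    and flip: "\<And>c e G a u b. e \<in> Prot c \<Longrightarrow>
       h c (flip e G) a u b = (-1) ^ count_list (ed a u b) e * h c G a u b"
    and count: "\<And>c. c \<in> C \<Longrightarrow> real (card {(a, xs). a \<in> I \<and> xs \<in> walks U I L \<and> wend a xs = a \<and>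
       (\<exists>G. wprod (h c G) a xs \<noteq> 0) \<and> (\<forall>e\<in>Prot c. even (count_list (wedges ed a xs) e))}) \<le> N"
  shows "real (card {G\<in>Pow E. \<exists>x. \<tau> * (K ^ L * N) * (\<Sum>a\<in>I. (x a)\<^sup>2) ^ L
      < (\<bar>\<Sum>c\<in>C. qform I (\<lambda>a b. \<Sum>u\<in>U. h c G a u b) x\<bar> / card C) ^ L}) \<le> 2 ^ card E / \<tau>"
proof -
  define H where "H c G = (\<lambda>a b. \<Sum>u\<in>U. h c G a u b)" for c G
  define T where "T c G = (\<Sum>a\<in>I. mpow I (H c G) L a a)" for c G
  define B where "B = {G\<in>Pow E. \<exists>x. \<tau> * (K ^ L * N) * (\<Sum>a\<in>I. (x a)\<^sup>2) ^ L
      < (\<bar>\<Sum>c\<in>C. qform I (H c G) x\<bar> / card C) ^ L}"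
  have C: "real (card C) > 0" using fin by (simp add: card_gt_0_iff)
  have symH: "\<forall>a\<in>I. \<forall>b\<in>I. H c G a b = H c G b a" if "c \<in> C" for c G
    using sym[OF that] unfolding H_def by blast
  have T_nonneg: "T c G \<ge> 0" if "c \<in> C" for c G
    unfolding T_def by (rule trace_mpow_nonneg[OF fin(4) symH[OF that] L])
  define Gd where "Gd c = {(a, xs). a \<in> I \<and> xs \<in> walks U I L \<and> wend a xs = a \<and>
       (\<exists>G. wprod (h c G) a xs \<noteq> 0) \<and> (\<forall>e\<in>Prot c. even (count_list (wedges ed a xs) e))}" for c
  \<comment> \<open>First moment of the trace: walks outside \<open>Gd c\<close> contribute 0 in
    total, and each of the others at most \<open>K ^ L\<close> for every edge set.\<close>
  have sumT: "(\<Sum>G\<in>Pow E. T c G) \<le> 2 ^ card E * (K ^ L * N)" if c: "c \<in> C" for c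
  proof -
    have "(\<Sum>G\<in>Pow E. T c G)
        = (\<Sum>G\<in>Pow E. \<Sum>(a, xs)\<in>I \<times> walks U I L. wprod (h c G) a xs * of_bool (wend a xs = a))"
      by (simp add: T_def H_def mpow_eq_sum_walks fin sum.cartesian_product)
    also have "\<dots> = (\<Sum>(a, xs)\<in>I \<times> walks U I L. \<Sum>G\<in>Pow E. wprod (h c G) a xs * of_bool (wend a xs = a))"
      by (subst sum.swap) (simp add: case_prod_unfold)
    also have "\<dots> \<le> (\<Sum>z\<in>I \<times> walks U I L. 2 ^ card E * K ^ L * of_bool (z \<in> Gd c))"
    proof (intro sum_mono, clarify)
      fix a xs assume a: "a \<in> I" "xs \<in> walks U I L"
      show "(\<Sum>G\<in>Pow E. wprod (h c G) a xs * of_bool (wend a xs = a))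
        \<le> 2 ^ card E * K ^ L * of_bool ((a, xs) \<in> Gd c)"
      proof (cases "(a, xs) \<in> Gd c")
        case True
        have "(\<Sum>G\<in>Pow E. wprod (h c G) a xs * of_bool (wend a xs = a)) \<le> (\<Sum>G\<in>Pow E. K ^ L)"
        proof (rule sum_mono)
          fix G
          have "\<bar>wprod (h c G) a xs\<bar> \<le> K ^ L"
            using abs_wprod_le[of "h c G" K a xs] bound a by (simp add: walks_def)
          then show "wprod (h c G) a xs * of_bool (wend a xs = a) \<le> K ^ L"
            using pos by (auto simp: of_bool_def)
        qed
        with True show ?thesis using fin by (simp add: card_Pow)
      next
        case False
        then consider "wend a xs \<noteq> a" | "\<forall>G. wprod (h c G) a xs = 0"
          | e where "e \<in> Prot c" "odd (count_list (wedges ed a xs) e)"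
          using a by (auto simp: Gd_def)
        then have "(\<Sum>G\<in>Pow E. wprod (h c G) a xs * of_bool (wend a xs = a)) = 0"
        proof cases
          case 3
          have "(\<Sum>G\<in>Pow E. wprod (h c G) a xs) = 0"
          proof (rule sum_Pow_odd_eq_0)
            show "e \<in> E" using 3 prot by auto
            show "wprod (h c (flip e G)) a xs = - wprod (h c G) a xs" for G
              using wprod_flip[of "h c (flip e G)" ed e "h c G" a xs] flip[OF 3(1)] 3(2) by simp
          qed
          then show ?thesis by (simp add: sum_distrib_right[symmetric])
        qed auto
        with False show ?thesis by simp
      qed
    qed
    also have "\<dots> = 2 ^ card E * K ^ L * real (card (Gd c \<inter> (I \<times> walks U I L)))"
      using fin by (simp add: sum_distrib_left[symmetric] finite_walks Int_def conj_commute
          flip: sum.inter_filter of_nat_sum add: of_bool_def sum.If_cases)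
    also have "Gd c \<inter> (I \<times> walks U I L) = Gd c"
      by (auto simp: Gd_def)
    also have "2 ^ card E * K ^ L * real (card (Gd c)) \<le> 2 ^ card E * K ^ L * N"
      using count[OF c] pos by (intro mult_left_mono) (auto simp: Gd_def)
    finally show ?thesis by simp
  qed
  \<comment> \<open>A bad G has a large averaged form at some x. Jensen over the colourings and the
    trace bound turn this into a large sum of traces, and the power of \<Sum> x^2 drops out on both
    sides.\<close>
  have bad: "\<tau> * (K ^ L * N) * card C \<le> (\<Sum>c\<in>C. T c G)" if "G \<in> B" for G
  proof -
    obtain x where x: "\<tau> * (K ^ L * N) * (\<Sum>a\<in>I. (x a)\<^sup>2) ^ L
      < (\<bar>\<Sum>c\<in>C. qform I (H c G) x\<bar> / card C) ^ L"
      using \<open>G \<in> B\<close> unfolding B_def by blast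
    let ?X = "\<Sum>a\<in>I. (x a)\<^sup>2"
    have "(\<bar>\<Sum>c\<in>C. qform I (H c G) x\<bar> / card C) ^ L = (\<Sum>c\<in>C. qform I (H c G) x) ^ L / card C ^ L"
      using power_even_abs[of L "\<Sum>c\<in>C. qform I (H c G) x"] by (simp add: power_divide L)
    also have "\<dots> \<le> (real (card C) ^ (L - 1) * (\<Sum>c\<in>C. qform I (H c G) x ^ L)) / card C ^ L"
      using power_sum_le_card_mult_sum_power[of "\<lambda>c. qform I (H c G) x" C m]
      by (intro divide_right_mono) (auto simp: L)
    also have "\<dots> = (\<Sum>c\<in>C. qform I (H c G) x ^ L) / card C"
      using C power_add[of "real (card C)" "L - 1" 1] by (simp add: L field_simps)
    also have "\<dots> \<le> (\<Sum>c\<in>C. ?X ^ L * T c G) / card C"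
      unfolding T_def
      by (intro divide_right_mono sum_mono qform_power_le_trace[OF fin(4) symH L]) auto
    also have "\<dots> = ((\<Sum>c\<in>C. T c G) * ?X ^ L) / card C"
      by (simp add: sum_distrib_right mult.commute)
    finally have "\<tau> * (K ^ L * N) * ?X ^ L < ((\<Sum>c\<in>C. T c G) * ?X ^ L) / card C"
      using x by linarith
    then have "\<tau> * (K ^ L * N) * card C * ?X ^ L < (\<Sum>c\<in>C. T c G) * ?X ^ L"
      using C by (simp only: pos_less_divide_eq mult_ac)
    moreover have "?X ^ L \<ge> 0" by (intro zero_le_power[of ?X] sum_nonneg) simp
    ultimately show ?thesis
      by (meson less_eq_real_def mult_right_less_imp_less)
  qed
  \<comment> \<open>Markov's inequality in counting form; since the traces are non-negative, the sum
    over bad G may be extended to all G.\<close>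
  have "real (card B) * (\<tau> * (K ^ L * N) * card C) = (\<Sum>G\<in>B. \<tau> * (K ^ L * N) * card C)"
    by simp
  also have "\<dots> \<le> (\<Sum>G\<in>B. \<Sum>c\<in>C. T c G)"
    by (intro sum_mono bad)
  also have "\<dots> \<le> (\<Sum>G\<in>Pow E. \<Sum>c\<in>C. T c G)"
    using fin T_nonneg by (intro sum_mono2) (auto simp: B_def sum_nonneg)
  also have "\<dots> = (\<Sum>c\<in>C. \<Sum>G\<in>Pow E. T c G)"
    by (rule sum.swap)
  also have "\<dots> \<le> (\<Sum>c\<in>C. 2 ^ card E * (K ^ L * N))"
    by (intro sum_mono sumT)
  finally have "(real (card B) * \<tau>) * (K ^ L * N * card C) \<le> 2 ^ card E * (K ^ L * N * card C)"
    by (simp add: mult_ac)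
  moreover have "K ^ L * N * card C > 0" using pos C by simp
  ultimately have "real (card B) * \<tau> \<le> 2 ^ card E"
    by (rule mult_right_le_imp_le)
  then show ?thesis using pos by (simp add: B_def H_def field_simps)
qed

section \<open>Counting walks that use every edge an even number of times\<close>

fun vedges :: "'a \<Rightarrow> 'a list \<Rightarrow> 'a set list" where
  "vedges a [] = []"
| "vedges a (b # xs) = {a, b} # vedges b xs"

lemma length_vedges [simp]: "length (vedges a xs) = length xs"
  by (induction a xs rule: vedges.induct) auto

lemma vedges_subset: "e \<in> set (vedges a xs) \<Longrightarrow> e \<subseteq> set (a # xs)"
  by (induction a xs rule: vedges.induct) auto

text \<open>A walk is connected: read from its end, a vertex that does not occur later comes with an
  edge containing it, and this edge is new.\<close>

lemma card_vertices_le_card_edges: "card (set (a # xs)) \<le> card (set (vedges a xs)) + 1"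
proof (induction a xs rule: vedges.induct)
  case (2 a b xs)
  show ?case
  proof (cases "a \<in> set (b # xs)")
    case True
    then have "set (a # b # xs) = set (b # xs)" by auto
    then show ?thesis using 2 by (simp add: card_insert_if del: set_simps) (auto simp: card_insert_if)
  next
    case False
    then have "{a, b} \<notin> set (vedges b xs)"
      using vedges_subset[of "{a, b}" b xs] by auto
    moreover have "card (set (a # b # xs)) = Suc (card (set (b # xs)))"
      using False by simp
    ultimately show ?thesis using 2 by simp
  qed
qed simp

text \<open>A positive even multiplicity is at least 2.\<close>

lemma card_set_le_half_length:
  assumes "\<And>e. e \<in> set es \<Longrightarrow> even (count_list es e)"
  shows "2 * card (set es) \<le> length es"
proof -
  have "(\<Sum>e\<in>set es. 2) \<le> (\<Sum>e\<in>set es. count_list es e)"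
  proof (rule sum_mono)
    fix e assume "e \<in> set es"
    then have "count_list es e \<noteq> 0" "even (count_list es e)"
      using assms by (auto simp: count_list_0_iff)
    then show "2 \<le> count_list es e" by presburger
  qed
  then show ?thesis by (simp add: sum_count_set)
qed

text \<open>A list with at most d values is determined by a table of d values and a word of indices
  into that table.\<close>

lemma card_lists_few_values:
  assumes "finite V" "V \<noteq> {}"
  shows "card {xs. set xs \<subseteq> V \<and> length xs = m \<and> card (set xs) \<le> d} \<le> card V ^ d * d ^ m"
proof -
  let ?F = "({..<d} \<rightarrow>\<^sub>E V) \<times> {ks. set ks \<subseteq> {..<d} \<and> length ks = m}"
  have "{xs. set xs \<subseteq> V \<and> length xs = m \<and> card (set xs) \<le> d} \<subseteq> (\<lambda>(f, ks). map f ks) ` ?F"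
  proof clarify
    fix xs assume xs: "set xs \<subseteq> V" "m = length xs" "card (set xs) \<le> d"
    obtain f where f: "bij_betw f {..<card (set xs)} (set xs)"
      using ex_bij_betw_nat_finite[of "set xs"] by (auto simp: atLeast0LessThan)
    obtain v where v: "v \<in> V" using assms(2) by auto
    define g where "g = inv_into {..<card (set xs)} f"
    \<comment> \<open>Table entries beyond the values in use are filled with an arbitrary element;
      this is where \<open>V\<close> has to be non-empty.\<close>
    define f' where "f' = (\<lambda>k\<in>{..<d}. if k < card (set xs) then f k else v)"
    have g: "g x < card (set xs)" "f (g x) = x" if "x \<in> set xs" for x
      using bij_betw_inv_into_right[OF f that] bij_betw_apply[OF bij_betw_inv_into[OF f] that]
      by (auto simp: g_def)
    have "f' \<in> {..<d} \<rightarrow>\<^sub>E V"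
      using bij_betw_apply[OF f] subsetD[OF xs(1)] v by (auto simp: f'_def)
    moreover have "set (map g xs) \<subseteq> {..<d}"
      using g xs(3) by (force)
    moreover have "map f' (map g xs) = xs"
      using g less_le_trans[OF g(1) xs(3)] by (auto simp: f'_def intro!: map_idI)
    ultimately show "xs \<in> (\<lambda>(f, ks). map f ks) ` (({..<d} \<rightarrow>\<^sub>E V) \<times> {ks. set ks \<subseteq> {..<d} \<and> length ks = length xs})"
      by (intro image_eqI[of _ _ "(f', map g xs)"]) auto
  qed
  moreover have "finite ?F"
    using assms by (intro finite_cartesian_product finite_PiE finite_lists_length_eq) auto
  ultimately have "card {xs. set xs \<subseteq> V \<and> length xs = m \<and> card (set xs) \<le> d} \<le> card ?F"
    by (meson card_image_le card_mono finite_imageI le_trans)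
  also have "\<dots> = card V ^ d * d ^ m"
    by (simp add: card_cartesian_product card_PiE card_lists_length_eq)
  finally show ?thesis .
qed

definition even_walks :: "'a set \<Rightarrow> nat \<Rightarrow> 'a list set" where
  "even_walks V q = {ys. set ys \<subseteq> V \<and> length ys = Suc (2 * q) \<and>
      (\<forall>e\<in>set (vedges (hd ys) (tl ys)). even (count_list (vedges (hd ys) (tl ys)) e))}"

text \<open>The exponent of \<open>card V\<close> is about half of what unrestricted lists would
  give, the source of the square-root savings in the norms. The other factor becomes polylogarithmic
  after taking a 2q-th root, as q will be of order log n.\<close>

lemma card_even_walks:
  assumes "finite V" "V \<noteq> {}"
  shows "finite (even_walks V q)" "card (even_walks V q) \<le> card V ^ Suc q * Suc q ^ Suc (2 * q)"
proof -
  have "even_walks V q \<subseteq> {xs. set xs \<subseteq> V \<and> length xs = Suc (2 * q) \<and> card (set xs) \<le> Suc q}"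
    unfolding even_walks_def
  proof clarify
    fix ys assume ys: "length ys = Suc (2 * q)"
      "\<forall>e\<in>set (vedges (hd ys) (tl ys)). even (count_list (vedges (hd ys) (tl ys)) e)"
    have "2 * card (set (vedges (hd ys) (tl ys))) \<le> 2 * q"
      using card_set_le_half_length[of "vedges (hd ys) (tl ys)"] ys by auto
    moreover have "hd ys # tl ys = ys" using ys by (cases ys) auto
    ultimately show "card (set ys) \<le> Suc q"
      using card_vertices_le_card_edges[of "hd ys" "tl ys"] by simp
  qed
  moreover have "finite {xs. set xs \<subseteq> V \<and> length xs = Suc (2 * q) \<and> card (set xs) \<le> Suc q}"
    by (rule finite_subset[OF _ finite_lists_length_eq[OF assms(1), of "Suc (2 * q)"]]) auto
  ultimately show "finite (even_walks V q)" "card (even_walks V q) \<le> card V ^ Suc q * Suc q ^ Suc (2 * q)"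
    using card_lists_few_values[OF assms, of "Suc (2 * q)" "Suc q"]
    by (meson finite_subset, meson card_mono le_trans)
qed

fun wsteps :: "'i \<Rightarrow> ('u \<times> 'i) list \<Rightarrow> ('i \<times> 'u \<times> 'i) list" where
  "wsteps a [] = []"
| "wsteps a ((u, b) # xs) = (a, u, b) # wsteps b xs"

lemma wprod_nonzero_steps:
  "wprod h a xs \<noteq> 0 \<Longrightarrow> (b, u, c) \<in> set (wsteps a xs) \<Longrightarrow> h b u c \<noteq> 0"
  by (induction a xs rule: wsteps.induct) auto

lemma wsteps_in_carrier:
  "(b, u, c) \<in> set (wsteps a xs) \<Longrightarrow> a \<in> I \<Longrightarrow> set xs \<subseteq> U \<times> I \<Longrightarrow> b \<in> I \<and> u \<in> U \<and> c \<in> I"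
  by (induction a xs rule: wsteps.induct) auto

lemma wedges_eq_concat_wsteps:
  "wedges ed a xs = concat (map (\<lambda>(a, u, b). ed a u b) (wsteps a xs))"
  by (induction a xs rule: wsteps.induct) auto

lemma vedges_map_snd:
  "vedges (f a) (map (\<lambda>z. f (snd z)) xs) = map (\<lambda>(a, u, b). {f a, f b}) (wsteps a xs)"
  by (induction a xs rule: wsteps.induct) auto

text \<open>In the five-vertex matrix the second path runs through the label, from j to u to l, so
  each step contributes two edges.\<close>

lemma vedges_concat_pairs:
  "vedges (f a) (concat (map (\<lambda>z. [fst z, f (snd z)]) xs))
    = concat (map (\<lambda>(a, u, b). [{f a, u}, {u, f b}]) (wsteps a xs))"
  by (induction a xs rule: wsteps.induct) auto

lemma count_list_concat_Cons:
  "count_list (concat (map (\<lambda>s. f s # g s) ss)) e = count_list (map f ss) e + count_list (concat (map g ss)) e"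
  by (induction ss) auto

section \<open>The random matrices of the moment form\<close>

definition sgn_adj :: "nat set set \<Rightarrow> nat \<Rightarrow> nat \<Rightarrow> real" where
  "sgn_adj G i j = (if i = j then 0 else if {i, j} \<in> G then 1 else -1)"

lemma sgn_adj_self [simp]: "sgn_adj G i i = 0"
  by (simp add: sgn_adj_def)

lemma sgn_adj_commute: "sgn_adj G i j = sgn_adj G j i"
  by (simp add: sgn_adj_def insert_commute)

lemma sgn_adj_cases: "sgn_adj G i j \<in> {-1, 0, 1}"
  by (simp add: sgn_adj_def)

lemma abs_sgn_adj_le [simp]: "\<bar>sgn_adj G i j\<bar> \<le> 1"
  by (simp add: sgn_adj_def)

lemma sgn_adj_flip: "sgn_adj (flip e G) i j = (if e = {i, j} then - sgn_adj G i j else sgn_adj G i j)"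
  by (auto simp: sgn_adj_def flip_def)

lemma finite_vertex_pairs [simp]: "finite (vertex_pairs n)"
  unfolding vertex_pairs_def by (rule finite_subset[of _ "Pow {1..n}"]) auto

lemma pair_in_vertex_pairs: "i \<in> {1..n} \<Longrightarrow> j \<in> {1..n} \<Longrightarrow> i \<noteq> j \<Longrightarrow> {i, j} \<in> vertex_pairs n"
  by (simp add: vertex_pairs_def)

lemma abs_mult_le_1: "\<bar>a\<bar> \<le> 1 \<Longrightarrow> \<bar>b\<bar> \<le> 1 \<Longrightarrow> \<bar>a * b\<bar> \<le> (1::real)"
  by (simp add: abs_mult mult_le_one)

text \<open>The Wigner case, with trivial colours and labels: every step is one edge, all edges are
  protected, and the surviving walks are even walks. The resulting norm is of order sqrt n up to
  logarithms.\<close>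

lemma adjacency_norm_bad:
  fixes \<tau> :: real
  assumes "n \<ge> 1" "\<tau> > 0" "2 * q = 2 ^ Suc m"
  shows "real (card {G\<in>Pow (vertex_pairs n). \<exists>x.
      \<tau> * (real n ^ Suc q * real (Suc q) ^ Suc (2 * q)) * (\<Sum>a\<in>{1..n}. (x a)\<^sup>2) ^ (2 * q)
      < \<bar>qform {1..n} (sgn_adj G) x\<bar> ^ (2 * q)}) \<le> 2 ^ card (vertex_pairs n) / \<tau>"
proof -
  let ?V = "{1..n}" and ?E = "vertex_pairs n"
  let ?h = "\<lambda>(c::unit) G i (u::unit) k. sgn_adj G i k"
  let ?ed = "\<lambda>i (u::unit) k. [{i, k}]"
  have "real (card {G\<in>Pow ?E. \<exists>x. \<tau> * (1 ^ (2 * q) * (real n ^ Suc q * real (Suc q) ^ Suc (2 * q))) *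
       (\<Sum>a\<in>?V. (x a)\<^sup>2) ^ (2 * q)
      < (\<bar>\<Sum>c\<in>{()}. qform ?V (\<lambda>a b. \<Sum>u\<in>{()}. ?h c G a u b) x\<bar> / card {()}) ^ (2 * q)}) \<le> 2 ^ card ?E / \<tau>"
  proof (rule trace_method[where m = m and ed = ?ed and Prot = "\<lambda>_. ?E"])
    fix c :: unit and e G a b and u :: unit
    show "?h c (flip e G) a u b = (-1) ^ count_list (?ed a u b) e * ?h c G a u b"
      by (auto simp: sgn_adj_flip)
  next
    fix c :: unit
    let ?S = "{(a, xs). a \<in> ?V \<and> xs \<in> walks {()} ?V (2 * q) \<and> wend a xs = a \<and>
       (\<exists>G. wprod (?h c G) a xs \<noteq> 0) \<and> (\<forall>e\<in>?E. even (count_list (wedges ?ed a xs) e))}"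
    have "inj_on (\<lambda>(a, xs). a # map snd xs) ?S"
      by (auto simp: inj_on_def intro: map_injective[of snd] simp: inj_def)
    moreover have "(\<lambda>(a, xs). a # map snd xs) ` ?S \<subseteq> even_walks ?V q"
    proof clarify
      fix a xs G assume a: "a \<in> ?V" "xs \<in> walks {()} ?V (2 * q)" "wprod (?h c G) a xs \<noteq> 0"
        "\<forall>e\<in>?E. even (count_list (wedges ?ed a xs) e)"
      have eq: "wedges ?ed a xs = vedges a (map snd xs)"
        using vedges_map_snd[of "\<lambda>x. x" a xs]
        by (simp add: wedges_eq_concat_wsteps case_prod_unfold concat_map_singleton)
      \<comment> \<open>Diagonal signs are 0, so a walk of nonzero weight has no loops and all its
        edges are genuine vertex pairs.\<close>
      have "e \<in> ?E" if e: "e \<in> set (vedges a (map snd xs))" for e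
      proof -
        obtain b u d where s: "(b, u, d) \<in> set (wsteps a xs)" "e = {b, d}"
          using e vedges_map_snd[of "\<lambda>x. x" a xs] by auto
        then have "b \<noteq> d"
          using wprod_nonzero_steps[OF a(3) s(1)] by auto
        then show ?thesis
          using wsteps_in_carrier[OF s(1), of ?V "{()}"] a s(2) pair_in_vertex_pairs[of b n d]
          by (auto simp: walks_def)
      qed
      then show "a # map snd xs \<in> even_walks ?V q"
        using a by (auto simp: even_walks_def walks_def eq)
    qed
    ultimately have "card ?S \<le> card (even_walks ?V q)"
      using card_inj_on_le[of _ ?S "even_walks ?V q"] card_even_walks[of ?V q] assms by auto
    also have "\<dots> \<le> n ^ Suc q * Suc q ^ Suc (2 * q)"
      using card_even_walks[of ?V q] assms by auto
    finally have "real (card ?S) \<le> real (n ^ Suc q * Suc q ^ Suc (2 * q))"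
      by (rule of_nat_mono)
    then show "real (card ?S) \<le> real n ^ Suc q * real (Suc q) ^ Suc (2 * q)"
      by (simp only: of_nat_mult of_nat_power)
  next
    show "0 < real n ^ Suc q * real (Suc q) ^ Suc (2 * q)"
      using assms(1) by (intro mult_pos_pos zero_less_power) auto
  qed (use assms in \<open>auto simp: sgn_adj_commute\<close>)
  then show ?thesis by simp
qed

section \<open>Averaging over colourings\<close>

definition colourings :: "nat \<Rightarrow> (nat \<Rightarrow> nat) set" where
  "colourings n = ({1..n} \<rightarrow>\<^sub>E {..<3})"

lemma finite_colourings [simp]: "finite (colourings n)"
  by (simp add: colourings_def finite_PiE)

lemma card_colourings: "card (colourings n) = 3 ^ n"
  by (simp add: colourings_def card_PiE)

lemma colourings_nonempty [simp]: "colourings n \<noteq> {}"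
  using card_colourings[of n] by (metis card.empty power_not_zero zero_neq_numeral)

text \<open>The fraction of admissible colourings depends on \<open>card S\<close> alone; hence
  averaging a colour-restricted matrix entry returns the unrestricted entry times a
  constant.\<close>

lemma card_colourings_prescribed:
  assumes "S \<subseteq> {1..n}" "\<And>v. v \<in> S \<Longrightarrow> \<phi> v < 3"
  shows "3 ^ card S * card {c \<in> colourings n. \<forall>v\<in>S. c v = \<phi> v} = 3 ^ n"
proof -
  have fS: "finite S" using assms(1) finite_subset by auto
  have eq: "{c \<in> colourings n. \<forall>v\<in>S. c v = \<phi> v} = (\<Pi>\<^sub>E v\<in>{1..n}. if v \<in> S then {\<phi> v} else {..<3})"
  proof (intro equalityI subsetI)
    fix c assume "c \<in> {c \<in> colourings n. \<forall>v\<in>S. c v = \<phi> v}"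
    then show "c \<in> (\<Pi>\<^sub>E v\<in>{1..n}. if v \<in> S then {\<phi> v} else {..<3})"
      by (auto simp: colourings_def PiE_iff)
  next
    fix c assume c: "c \<in> (\<Pi>\<^sub>E v\<in>{1..n}. if v \<in> S then {\<phi> v} else {..<3})"
    have eq: "c v = \<phi> v" if "v \<in> S" for v
      using PiE_mem[OF c, of v] that assms(1) by auto
    have "c v < 3" if "v \<in> {1..n}" for v
      using PiE_mem[OF c that] assms(2)[of v] by (auto split: if_splits)
    then show "c \<in> {c \<in> colourings n. \<forall>v\<in>S. c v = \<phi> v}"
      using c eq by (auto simp: colourings_def PiE_iff)
  qed
  have "card {c \<in> colourings n. \<forall>v\<in>S. c v = \<phi> v} = (\<Prod>v\<in>{1..n}. if v \<in> S then 1 else 3)"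
    unfolding eq by (subst card_PiE) (auto intro!: prod.cong)
  also have "\<dots> = 3 ^ card ({1..n} - S)"
    by (simp add: prod.If_cases Diff_eq)
  also have "3 ^ card S * \<dots> = 3 ^ n"
    using assms(1) fS card_mono[OF _ assms(1)] by (simp add: card_Diff_subset flip: power_add)
  finally show ?thesis by simp
qed

text \<open>The weights \<open>g4\<close> and \<open>g5\<close> collect those terms of the expansion of
  \<open>(1 + A i k) (1 + A j l) (1 + A i l) (1 + A j k)\<close> that contain a perfect matching, respectively at least one
  factor \<open>A\<close>, after relabelling \<open>i\<leftrightarrow>j\<close>, \<open>k\<leftrightarrow>l\<close> so that the distinguished factor is \<open>A i k * A j l\<close>, respectively
  \<open>A i k\<close>.\<close>

definition g4 :: "nat set set \<Rightarrow> nat \<Rightarrow> nat \<Rightarrow> nat \<Rightarrow> nat \<Rightarrow> real" where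
  "g4 G i j k l = 2 + 2 * sgn_adj G i l + 2 * sgn_adj G j k + sgn_adj G i l * sgn_adj G j k"

definition g5 :: "nat set set \<Rightarrow> nat \<Rightarrow> nat \<Rightarrow> nat \<Rightarrow> nat \<Rightarrow> real" where
  "g5 G i j k l = (1 + sgn_adj G j l) * (1 + sgn_adj G i l) * (1 + sgn_adj G j k)
     + (1 + sgn_adj G i l) * (1 + sgn_adj G j k) + (1 + sgn_adj G j l) + 1"

lemma abs_g4_le: "\<bar>g4 G i j k l\<bar> \<le> 7"
  using sgn_adj_cases[of G i l] sgn_adj_cases[of G j k] by (auto simp: g4_def)

lemma abs_g5_le: "\<bar>g5 G i j k l\<bar> \<le> 15"
  using sgn_adj_cases[of G i l] sgn_adj_cases[of G j k] sgn_adj_cases[of G j l] by (auto simp: g5_def)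

lemma g4_transpose: "g4 G k l i j = g4 G i j k l"
  by (simp add: g4_def sgn_adj_commute[of G k j] sgn_adj_commute[of G l i])

lemma g5_transpose: "g5 G k l i j = g5 G i j k l"
  by (simp add: g5_def sgn_adj_commute[of G k j] sgn_adj_commute[of G l i] sgn_adj_commute[of G l j])

lemma of_bool_mult_abs_le: "\<bar>x\<bar> \<le> K \<Longrightarrow> \<bar>of_bool P * x\<bar> \<le> (K :: real)"
  by (auto simp: of_bool_def)

text \<open>Colours: \<open>i, k\<close> get 0, \<open>j, l\<close> get 1 and \<open>u\<close> gets 2. Then the edges \<open>{i, k}\<close> and \<open>{j, l}\<close> (respectively \<open>{j, u}\<close>,
  \<open>{u, l}\<close>) cannot coincide with an edge in any other slot.\<close>

definition h4 :: "(nat \<Rightarrow> nat) \<Rightarrow> nat set set \<Rightarrow> nat \<times> nat \<Rightarrow> unit \<Rightarrow> nat \<times> nat \<Rightarrow> real" where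
  "h4 c G = (\<lambda>(i, j) u (k, l). of_bool (c i = 0 \<and> c k = 0 \<and> c j = 1 \<and> c l = 1) *
      (sgn_adj G i k * sgn_adj G j l * g4 G i j k l))"

definition h5 :: "(nat \<Rightarrow> nat) \<Rightarrow> nat set set \<Rightarrow> nat \<times> nat \<Rightarrow> nat \<Rightarrow> nat \<times> nat \<Rightarrow> real" where
  "h5 c G = (\<lambda>(i, j) u (k, l). of_bool (c i = 0 \<and> c k = 0 \<and> c j = 1 \<and> c l = 1 \<and> c u = 2 \<and> j \<noteq> l) *
      (sgn_adj G i k * sgn_adj G u j * sgn_adj G u l * sgn_adj G u i * sgn_adj G u k * g5 G i j k l))"

lemma abs_mult_le_K: "\<bar>a\<bar> \<le> 1 \<Longrightarrow> \<bar>b\<bar> \<le> K \<Longrightarrow> \<bar>a * b\<bar> \<le> (K::real)"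
  using mult_mono[of "\<bar>a\<bar>" 1 "\<bar>b\<bar>" K] by (simp add: abs_mult)

lemma abs_h4_le: "\<bar>h4 c G a u b\<bar> \<le> 7"
  unfolding h4_def case_prod_unfold
  by (intro of_bool_mult_abs_le abs_mult_le_K abs_mult_le_1 abs_g4_le abs_sgn_adj_le)

lemma abs_h5_le: "\<bar>h5 c G a u b\<bar> \<le> 15"
  unfolding h5_def case_prod_unfold
  by (intro of_bool_mult_abs_le abs_mult_le_K abs_mult_le_1 abs_g5_le abs_sgn_adj_le)

lemma unit_pair_list_eqI:
  fixes xs ys :: "(unit \<times> 'a \<times> 'b) list"
  assumes "map (\<lambda>z. fst (snd z)) xs = map (\<lambda>z. fst (snd z)) ys"
    "map (\<lambda>z. snd (snd z)) xs = map (\<lambda>z. snd (snd z)) ys"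
  shows "xs = ys"
  using assms by (induction xs arbitrary: ys) (auto simp: Cons_eq_map_conv prod_eq_iff)

text \<open>A surviving walk splits into the path of first coordinates in colour 0 and the path of
  second coordinates in colour 1, each an even walk. The count is the square of the one for a single
  path, and the norm is of order n up to logarithms.\<close>

lemma coloured_four_norm_bad:
  fixes \<tau> :: real
  assumes "n \<ge> 1" "\<tau> > 0" "2 * q = 2 ^ Suc m"
  shows "real (card {G\<in>Pow (vertex_pairs n). \<exists>x.
      \<tau> * (7 ^ (2 * q) * (real n ^ Suc q * real (Suc q) ^ Suc (2 * q))\<^sup>2) * (\<Sum>a\<in>{1..n} \<times> {1..n}. (x a)\<^sup>2) ^ (2 * q)
      < (\<bar>\<Sum>c\<in>colourings n. qform ({1..n} \<times> {1..n}) (\<lambda>a b. \<Sum>u\<in>{()}. h4 c G a u b) x\<bar> / card (colourings n)) ^ (2 * q)})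
    \<le> 2 ^ card (vertex_pairs n) / \<tau>"
proof -
  let ?V = "{1..n}" and ?E = "vertex_pairs n"
  let ?ed = "\<lambda>a (u::unit) b. [{fst a, fst b}, {snd a, snd b}] :: nat set list"
  \<comment> \<open>Protected are the edges inside colour 0 or inside colour 1. The signs of {i, l}
    and {j, k} in \<open>g4\<close> join the two colours; they are unaffected by the flips and
    merely bounded.\<close>
  let ?Prot = "\<lambda>c. {e\<in>?E. (\<forall>v\<in>e. c v = (0::nat)) \<or> (\<forall>v\<in>e. c v = 1)}"
  show ?thesis
  proof (rule trace_method[where m = m and ed = ?ed and Prot = ?Prot])
    fix c and e :: "nat set" and G a b and u :: unit
    assume e: "e \<in> ?Prot c"
    show "h4 c (flip e G) a u b = (-1) ^ count_list (?ed a u b) e * h4 c G a u b"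
    proof (cases "c (fst a) = 0 \<and> c (fst b) = 0 \<and> c (snd a) = 1 \<and> c (snd b) = 1")
      case True
      then have "e \<noteq> {fst a, snd b}" "e \<noteq> {snd a, fst b}" "{fst a, fst b} \<noteq> {snd a, snd b}"
        using e by (auto simp: doubleton_eq_iff)
      then show ?thesis
        using True by (auto simp: h4_def g4_def case_prod_unfold sgn_adj_flip)
    qed (simp add: h4_def case_prod_unfold)
  next
    fix c :: "nat \<Rightarrow> nat"
    let ?S = "{(a, xs). a \<in> ?V \<times> ?V \<and> xs \<in> walks {()} (?V \<times> ?V) (2 * q) \<and> wend a xs = a \<and>
       (\<exists>G. wprod (h4 c G) a xs \<noteq> 0) \<and> (\<forall>e\<in>?Prot c. even (count_list (wedges ?ed a xs) e))}"
    let ?y1 = "\<lambda>(a, xs). fst a # map (\<lambda>z. fst (snd z)) xs"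
    let ?y2 = "\<lambda>(a, xs). snd a # map (\<lambda>z. snd (snd z)) xs"
    have fw: "finite (even_walks ?V q)"
      by (rule card_even_walks) (use assms(1) in auto)
    have "inj_on (\<lambda>z. (?y1 z, ?y2 z)) ?S"
      by (rule inj_onI) (auto intro: unit_pair_list_eqI)
    moreover have "(\<lambda>z. (?y1 z, ?y2 z)) ` ?S \<subseteq> even_walks ?V q \<times> even_walks ?V q"
    proof (rule image_subsetI)
      fix z assume "z \<in> ?S"
      then obtain i j xs G where z: "z = ((i, j), xs)"
        and a: "i \<in> ?V" "j \<in> ?V" "xs \<in> walks {()} (?V \<times> ?V) (2 * q)" "wprod (h4 c G) (i, j) xs \<noteq> 0"
        "\<forall>e\<in>?Prot c. even (count_list (wedges ?ed (i, j) xs) e)"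
        by blast
      define w1 where "w1 = vedges i (map (\<lambda>z. fst (snd z)) xs)"
      define w2 where "w2 = vedges j (map (\<lambda>z. snd (snd z)) xs)"
      have w1: "w1 = map (\<lambda>(a, u, b). {fst a, fst b}) (wsteps (i, j) xs)"
        using vedges_map_snd[of fst "(i, j)" xs] by (simp add: w1_def)
      have w2: "w2 = map (\<lambda>(a, u, b). {snd a, snd b}) (wsteps (i, j) xs)"
        using vedges_map_snd[of snd "(i, j)" xs] by (simp add: w2_def)
      have cnt: "count_list (wedges ?ed (i, j) xs) e = count_list w1 e + count_list w2 e" for e
        using count_list_concat_Cons[of "\<lambda>(a, u, b). {fst a, fst b}" "\<lambda>(a, u, b). [{snd a, snd b}]" "wsteps (i, j) xs" e]
        by (simp add: wedges_eq_concat_wsteps w1 w2 case_prod_unfold concat_map_singleton)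
      have step: "b \<in> ?V \<times> ?V \<and> d \<in> ?V \<times> ?V \<and> h4 c G b u d \<noteq> 0" if "(b, u, d) \<in> set (wsteps (i, j) xs)" for b u d
        using wprod_nonzero_steps[OF a(4) that] wsteps_in_carrier[OF that, of "?V \<times> ?V" "{()}"] a(1-3)
        by (auto simp: walks_def)
      have p1: "e \<in> ?E \<and> (\<forall>v\<in>e. c v = 0)" if e: "e \<in> set w1" for e
      proof -
        obtain b u d where s: "(b, u, d) \<in> set (wsteps (i, j) xs)" "e = {fst b, fst d}"
          using e by (auto simp: w1)
        show ?thesis using step[OF s(1)] s(2) pair_in_vertex_pairs[of "fst b" n "fst d"]
          by (auto simp: h4_def case_prod_unfold sgn_adj_def split: if_splits)
      qed
      have p2: "e \<in> ?E \<and> (\<forall>v\<in>e. c v = 1)" if e: "e \<in> set w2" for e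
      proof -
        obtain b u d where s: "(b, u, d) \<in> set (wsteps (i, j) xs)" "e = {snd b, snd d}"
          using e by (auto simp: w2)
        show ?thesis using step[OF s(1)] s(2) pair_in_vertex_pairs[of "snd b" n "snd d"]
          by (auto simp: h4_def case_prod_unfold sgn_adj_def split: if_splits)
      qed
      \<comment> \<open>The empty set would satisfy both colour conditions vacuously and has to be
        ruled out before disjointness.\<close>
      have ne: "e \<noteq> {}" if "e \<in> ?E" for e using that by (auto simp: vertex_pairs_def)
      have disj: "e \<notin> set w2" if "e \<in> set w1" for e
        using p1[OF that] p2[of e] ne[of e] by fastforce
      have "even (count_list w1 e)" if "e \<in> set w1" for e
      proof -
        have "count_list w2 e = 0" using disj[OF that] by (rule count_notin)
        then show ?thesis using bspec[OF a(5), of e] p1[OF that] cnt[of e] by simp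
      qed
      moreover have "even (count_list w2 e)" if "e \<in> set w2" for e
      proof -
        have "count_list w1 e = 0" using disj[of e] that by (intro count_notin) auto
        then show ?thesis using bspec[OF a(5), of e] p2[OF that] cnt[of e] by simp
      qed
      moreover have "set xs \<subseteq> {()} \<times> ?V \<times> ?V" "length xs = 2 * q"
        using a(3) by (auto simp: walks_def)
      ultimately show "(?y1 z, ?y2 z) \<in> even_walks ?V q \<times> even_walks ?V q"
        using a(1,2) unfolding z by (force simp: even_walks_def w1_def w2_def)
    qed
    ultimately have "card ?S \<le> card (even_walks ?V q \<times> even_walks ?V q)"
      by (rule card_inj_on_le) (intro finite_cartesian_product fw)
    also have "\<dots> = (card (even_walks ?V q))\<^sup>2"
      by (simp add: card_cartesian_product power2_eq_square)
    also have "\<dots> \<le> (n ^ Suc q * Suc q ^ Suc (2 * q))\<^sup>2"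
      using card_even_walks(2)[of ?V q] assms by (intro power_mono) auto
    finally have "real (card ?S) \<le> real ((n ^ Suc q * Suc q ^ Suc (2 * q))\<^sup>2)"
      by (rule of_nat_mono)
    then show "real (card ?S) \<le> (real n ^ Suc q * real (Suc q) ^ Suc (2 * q))\<^sup>2"
      by (simp only: of_nat_mult of_nat_power)
  next
    show "(\<Sum>u\<in>{()}. h4 c G a u b) = (\<Sum>u\<in>{()}. h4 c G b u a)" for c G a b
      unfolding h4_def case_prod_unfold
      using sgn_adj_commute[of G "fst a" "fst b"] sgn_adj_commute[of G "snd a" "snd b"]
        g4_transpose[of G "fst a" "snd a" "fst b" "snd b"] by auto
  next
    show "0 < (real n ^ Suc q * real (Suc q) ^ Suc (2 * q))\<^sup>2"
      using assms(1) by (intro mult_pos_pos zero_less_power) auto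
  qed (use assms abs_h4_le in \<open>simp_all add: Collect_restrict\<close>)
qed

text \<open>Makes the counting map injective: the two vertex paths determine the labelled
  walk.\<close>

lemma triple_list_eqI:
  fixes xs ys :: "('a \<times> 'b \<times> 'a) list"
  assumes "map (\<lambda>z. fst (snd z)) xs = map (\<lambda>z. fst (snd z)) ys"
    "concat (map (\<lambda>z. [fst z, snd (snd z)]) xs) = concat (map (\<lambda>z. [fst z, snd (snd z)]) ys)"
  shows "xs = ys"
  using assms by (induction xs arbitrary: ys) (auto simp: Cons_eq_map_conv prod_eq_iff)

lemma length_concat_pairs: "length (concat (map (\<lambda>z. [f z, g z]) xs)) = 2 * length xs"
  by (induction xs) auto

text \<open>First coordinates trace a path with 2q edges, second coordinates together with the
  labels one with 4q edges, and the colours keep the two edge-disjoint. The counts n^(q+1) and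
  n^(2q+1) give a norm of order n^(3/2) up to logarithms.\<close>

lemma coloured_five_norm_bad:
  fixes \<tau> :: real
  assumes "n \<ge> 1" "\<tau> > 0" "2 * q = 2 ^ Suc m"
  shows "real (card {G\<in>Pow (vertex_pairs n). \<exists>x.
      \<tau> * (15 ^ (2 * q) * ((real n ^ Suc q * real (Suc q) ^ Suc (2 * q)) * (real n ^ Suc (2 * q) * real (Suc (2 * q)) ^ Suc (4 * q)))) * (\<Sum>a\<in>{1..n} \<times> {1..n}. (x a)\<^sup>2) ^ (2 * q)
      < (\<bar>\<Sum>c\<in>colourings n. qform ({1..n} \<times> {1..n}) (\<lambda>a b. \<Sum>u\<in>{1..n}. h5 c G a u b) x\<bar> / card (colourings n)) ^ (2 * q)})
    \<le> 2 ^ card (vertex_pairs n) / \<tau>"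
proof -
  let ?V = "{1..n}" and ?E = "vertex_pairs n"
  let ?ed = "\<lambda>a u b. [{fst a, fst b}, {snd a, u}, {u, snd b}] :: nat set list"
  \<comment> \<open>Edges inside colour 0 protect the slot {i, k}; edges between colours 1 and 2
    protect {j, u} and {u, l}. The signs at {u, i} and {u, k} join colours 0 and 2 and are merely
    bounded.\<close>
  let ?Prot = "\<lambda>c. {e\<in>?E. c ` e = {0::nat} \<or> c ` e = {1, 2}}"
  show ?thesis
  proof (rule trace_method[where m = m and ed = ?ed and Prot = ?Prot])
    fix c and e :: "nat set" and G a b and u
    assume e: "e \<in> ?Prot c"
    show "h5 c (flip e G) a u b = (-1) ^ count_list (?ed a u b) e * h5 c G a u b"
    proof (cases "c (fst a) = 0 \<and> c (fst b) = 0 \<and> c (snd a) = 1 \<and> c (snd b) = 1 \<and> c u = 2 \<and> snd a \<noteq> snd b")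
      case True
      have ne: "e \<noteq> {x, y}" if "{c x, c y} \<noteq> {0}" "{c x, c y} \<noteq> {1, 2}" for x y
      proof
        assume "e = {x, y}"
        then have "c ` e = {c x, c y}" by simp
        with e that show False by simp
      qed
      have nes: "e \<noteq> {fst a, snd b}" "e \<noteq> {snd a, fst b}" "e \<noteq> {snd a, snd b}" "e \<noteq> {u, fst a}" "e \<noteq> {u, fst b}"
        by (rule ne, simp_all add: True doubleton_eq_iff)+
      have "h5 c (flip e G) a u b = (if e = {fst a, fst b} then -1 else 1) * (if e = {u, snd a} then -1 else 1)
         * (if e = {u, snd b} then -1 else 1) * h5 c G a u b"
        unfolding h5_def g5_def case_prod_unfold sgn_adj_flip if_not_P[OF nes(1)] if_not_P[OF nes(2)]
          if_not_P[OF nes(3)] if_not_P[OF nes(4)] if_not_P[OF nes(5)]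
        by simp
      also have "(if e = {fst a, fst b} then -1 else 1) * (if e = {u, snd a} then -1 else 1)
         * (if e = {u, snd b} then -1 else 1) = (-1 :: real) ^ count_list (?ed a u b) e"
        by (auto simp: insert_commute)
      finally show ?thesis .
    qed (simp add: h5_def case_prod_unfold)
  next
    fix c :: "nat \<Rightarrow> nat"
    let ?S = "{(a, xs). a \<in> ?V \<times> ?V \<and> xs \<in> walks ?V (?V \<times> ?V) (2 * q) \<and> wend a xs = a \<and>
       (\<exists>G. wprod (h5 c G) a xs \<noteq> 0) \<and> (\<forall>e\<in>?Prot c. even (count_list (wedges ?ed a xs) e))}"
    let ?y1 = "\<lambda>(a, xs). fst a # map (\<lambda>z. fst (snd z)) xs"
    let ?y2 = "\<lambda>(a, xs). snd a # concat (map (\<lambda>z. [fst z, snd (snd z)]) xs)"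
    have fw: "finite (even_walks ?V q)" "finite (even_walks ?V (2 * q))"
      by (rule card_even_walks; use assms(1) in auto)+
    have "inj_on (\<lambda>z. (?y1 z, ?y2 z)) ?S"
      by (rule inj_onI) (auto intro: triple_list_eqI)
    moreover have "(\<lambda>z. (?y1 z, ?y2 z)) ` ?S \<subseteq> even_walks ?V q \<times> even_walks ?V (2 * q)"
    proof (rule image_subsetI)
      fix z assume zS: "z \<in> ?S"
      obtain i j xs where z: "z = ((i, j), xs)" by (metis prod.exhaust)
      obtain G where a: "i \<in> ?V" "j \<in> ?V" "xs \<in> walks ?V (?V \<times> ?V) (2 * q)" "wprod (h5 c G) (i, j) xs \<noteq> 0"
        "\<forall>e\<in>?Prot c. even (count_list (wedges ?ed (i, j) xs) e)"
        using zS unfolding z mem_Collect_eq prod.case mem_Sigma_iff by blast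
      define w1 where "w1 = vedges i (map (\<lambda>z. fst (snd z)) xs)"
      define w2 where "w2 = vedges j (concat (map (\<lambda>z. [fst z, snd (snd z)]) xs))"
      have w1: "w1 = map (\<lambda>(a, u, b). {fst a, fst b}) (wsteps (i, j) xs)"
        using vedges_map_snd[of fst "(i, j)" xs] by (simp add: w1_def)
      have w2: "w2 = concat (map (\<lambda>(a, u, b). [{snd a, u}, {u, snd b}]) (wsteps (i, j) xs))"
        using vedges_concat_pairs[of snd "(i, j)" xs] by (simp add: w2_def)
      have cnt: "count_list (wedges ?ed (i, j) xs) e = count_list w1 e + count_list w2 e" for e
        using count_list_concat_Cons[of "\<lambda>(a, u, b). {fst a, fst b}" "\<lambda>(a, u, b). [{snd a, u}, {u, snd b}]" "wsteps (i, j) xs" e]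
        by (simp add: wedges_eq_concat_wsteps w1 w2 case_prod_unfold concat_map_singleton)
      have step: "b \<in> ?V \<times> ?V \<and> u \<in> ?V \<and> d \<in> ?V \<times> ?V \<and> h5 c G b u d \<noteq> 0" if "(b, u, d) \<in> set (wsteps (i, j) xs)" for b u d
        using wprod_nonzero_steps[OF a(4) that] wsteps_in_carrier[OF that, of "?V \<times> ?V" ?V] a(1-3)
        by (auto simp: walks_def)
      have col: "c (fst b) = 0 \<and> c (fst d) = 0 \<and> c (snd b) = 1 \<and> c (snd d) = 1 \<and> c u = 2 \<and> fst b \<noteq> fst d"
        if "h5 c G b u d \<noteq> 0" for b u d
        using that unfolding h5_def case_prod_unfold by (simp add: of_bool_def split: if_splits) auto
      have p1: "e \<in> ?E \<and> c ` e = {0}" if e: "e \<in> set w1" for e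
      proof -
        obtain b u d where s: "(b, u, d) \<in> set (wsteps (i, j) xs)" "e = {fst b, fst d}"
          using e by (auto simp: w1)
        note st = step[OF s(1)]
        have "e \<in> ?E"
          unfolding s(2) using st col[of b u d] by (intro pair_in_vertex_pairs) (simp_all add: mem_Times_iff)
        then show ?thesis using col[of b u d] st s(2) by simp
      qed
      have p2: "e \<in> ?E \<and> c ` e = {1, 2}" if e: "e \<in> set w2" for e
      proof -
        obtain b u d where s: "(b, u, d) \<in> set (wsteps (i, j) xs)" "e \<in> {{snd b, u}, {u, snd d}}"
          using e by (auto simp: w2)
        note st = step[OF s(1)]
        have c: "c (snd b) = 1" "c (snd d) = 1" "c u = 2" using col[of b u d] st by simp_all
        have "snd b \<noteq> u" "u \<noteq> snd d" using c by auto
        then have "{snd b, u} \<in> ?E" "{u, snd d} \<in> ?E"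
          using st by (simp_all add: pair_in_vertex_pairs mem_Times_iff)
        moreover have "c ` {snd b, u} = {1, 2}" "c ` {u, snd d} = {1, 2}"
          using c by (simp_all add: insert_commute)
        ultimately show ?thesis using s(2) by blast
      qed
      have disj: "e \<notin> set w2" if "e \<in> set w1" for e
        using p1[OF that] p2[of e] by auto
      have "even (count_list w1 e)" if "e \<in> set w1" for e
      proof -
        have "count_list w2 e = 0" using disj[OF that] by (rule count_notin)
        then show ?thesis using bspec[OF a(5), of e] p1[OF that] cnt[of e] by simp
      qed
      moreover have "even (count_list w2 e)" if "e \<in> set w2" for e
      proof -
        have "count_list w1 e = 0" using disj[of e] that by (intro count_notin) auto
        then show ?thesis using bspec[OF a(5), of e] p2[OF that] cnt[of e] by simp
      qed
      moreover have "set xs \<subseteq> ?V \<times> ?V \<times> ?V" "length xs = 2 * q"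
        using a(3) by (auto simp: walks_def)
      ultimately show "(?y1 z, ?y2 z) \<in> even_walks ?V q \<times> even_walks ?V (2 * q)"
        using a(1,2) unfolding z by (force simp: even_walks_def w1_def w2_def length_concat_pairs)
    qed
    ultimately have "card ?S \<le> card (even_walks ?V q \<times> even_walks ?V (2 * q))"
      by (rule card_inj_on_le) (intro finite_cartesian_product fw)
    also have "\<dots> = card (even_walks ?V q) * card (even_walks ?V (2 * q))"
      by (rule card_cartesian_product)
    also have "\<dots> \<le> (n ^ Suc q * Suc q ^ Suc (2 * q)) * (n ^ Suc (2 * q) * Suc (2 * q) ^ Suc (4 * q))"
      using card_even_walks(2)[of ?V q] card_even_walks(2)[of ?V "2 * q"] assms(1) by (intro mult_mono) auto
    finally have "real (card ?S) \<le> real ((n ^ Suc q * Suc q ^ Suc (2 * q)) * (n ^ Suc (2 * q) * Suc (2 * q) ^ Suc (4 * q)))"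
      by (rule of_nat_mono)
    then show "real (card ?S) \<le> ((real n ^ Suc q * real (Suc q) ^ Suc (2 * q)) * (real n ^ Suc (2 * q) * real (Suc (2 * q)) ^ Suc (4 * q)))"
      by (simp only: of_nat_mult of_nat_power)
  next
    show "(\<Sum>u\<in>{1..n}. h5 c G a u b) = (\<Sum>u\<in>{1..n}. h5 c G b u a)" for c G a b
      unfolding h5_def case_prod_unfold
      using sgn_adj_commute[of G "fst a" "fst b"] g5_transpose[of G "fst a" "snd a" "fst b" "snd b"]
      by (intro sum.cong) auto
  next
    show "0 < ((real n ^ Suc q * real (Suc q) ^ Suc (2 * q)) * (real n ^ Suc (2 * q) * real (Suc (2 * q)) ^ Suc (4 * q)))"
      using assms(1) by (intro mult_pos_pos zero_less_power) auto
  qed (use assms abs_h5_le in \<open>simp_all add: Collect_restrict\<close>)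
qed

section \<open>Common sign sums of four vertices\<close>

definition common_sign :: "nat \<Rightarrow> nat set set \<Rightarrow> nat \<Rightarrow> nat \<Rightarrow> nat \<Rightarrow> nat \<Rightarrow> real" where
  "common_sign n G i j k l = (\<Sum>u\<in>{1..n}. sgn_adj G u i * sgn_adj G u j * sgn_adj G u k * sgn_adj G u l)"

text \<open>A scalar tail bound cast as the norm of a diagonal matrix indexed by quadruples. Walks
  cannot leave their quadruple and every label must occur evenly, so at most q labels are distinct;
  the factor n^4 counts the quadruples.\<close>

lemma common_sign_bad:
  fixes \<tau> :: real
  assumes "n \<ge> 1" "\<tau> > 0" "2 * q = 2 ^ Suc m"
  shows "real (card {G\<in>Pow (vertex_pairs n). \<exists>i\<in>{1..n}. \<exists>j\<in>{1..n}. \<exists>k\<in>{1..n}. \<exists>l\<in>{1..n}. distinct [i, j, k, l] \<and>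
      \<tau> * (real n ^ (q + 4) * real q ^ (2 * q)) < \<bar>common_sign n G i j k l\<bar> ^ (2 * q)})
    \<le> 2 ^ card (vertex_pairs n) / \<tau>" (is "real (card ?B) \<le> _")
proof -
  let ?V = "{1..n}" and ?E = "vertex_pairs n"
  let ?I = "?V \<times> ?V \<times> ?V \<times> ?V"
  let ?h = "\<lambda>(z::unit) G (i, j, k, l) u b. of_bool (b = (i, j, k, l) \<and> distinct [i, j, k, l]) *
     (sgn_adj G u i * sgn_adj G u j * sgn_adj G u k * sgn_adj G u l)"
  let ?ed = "\<lambda>(i, j, k, l) u (b :: nat \<times> nat \<times> nat \<times> nat). [{u, i}, {u, j}, {u, k}, {u, l}] :: nat set list"
  let ?N = "real n ^ (q + 4) * real q ^ (2 * q)"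
  have q: "q > 0" using assms(3) by (cases q) auto
  let ?B' = "{G\<in>Pow ?E. \<exists>x. \<tau> * (1 ^ (2 * q) * ?N) * (\<Sum>a\<in>?I. (x a)\<^sup>2) ^ (2 * q)
      < (\<bar>\<Sum>c\<in>{()}. qform ?I (\<lambda>a b. \<Sum>u\<in>?V. ?h c G a u b) x\<bar> / card {()}) ^ (2 * q)}"
  have "real (card ?B') \<le> 2 ^ card ?E / \<tau>"
  proof (rule trace_method[where m = m and ed = ?ed and Prot = "\<lambda>_. ?E"])
    show "0 < ?N" using assms(1) q by (intro mult_pos_pos zero_less_power) auto
  next
    fix c :: unit and e :: "nat set" and G and a b :: "nat \<times> nat \<times> nat \<times> nat" and u :: nat
    obtain i j k l where a: "a = (i, j, k, l)" by (cases a)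
    have "?h c (flip e G) a u b = ((if e = {u, i} then -1 else 1) * (if e = {u, j} then -1 else 1) *
       (if e = {u, k} then -1 else 1) * (if e = {u, l} then -1 else 1)) * ?h c G a u b"
      unfolding a prod.case sgn_adj_flip by simp
    also have "((if e = {u, i} then -1 else 1) * (if e = {u, j} then -1 else 1) *
       (if e = {u, k} then -1 else 1) * (if e = {u, l} then -1 else 1)) = (-1::real) ^ count_list (?ed a u b) e"
      unfolding a by simp
    finally show "?h c (flip e G) a u b = (-1) ^ count_list (?ed a u b) e * ?h c G a u b" .
  next
    fix c :: unit and G a u b
    show "\<bar>?h c G a u b\<bar> \<le> 1"
      unfolding case_prod_unfold by (intro of_bool_mult_abs_le abs_mult_le_1 abs_sgn_adj_le)
  next
    fix c :: unit and G a b
    show "(\<Sum>u\<in>?V. ?h c G a u b) = (\<Sum>u\<in>?V. ?h c G b u a)"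
      by (cases "a = b") (auto simp: case_prod_unfold intro!: sum.cong)
  next
    fix c :: unit
    let ?S = "{(a, xs). a \<in> ?I \<and> xs \<in> walks ?V ?I (2 * q) \<and> wend a xs = a \<and>
       (\<exists>G. wprod (?h c G) a xs \<noteq> 0) \<and> (\<forall>e\<in>?E. even (count_list (wedges ?ed a xs) e))}"
    let ?W = "{us. set us \<subseteq> ?V \<and> length us = 2 * q \<and> card (set us) \<le> q}"
    have fW: "finite ?W"
      by (rule finite_subset[OF _ finite_lists_length_eq[of ?V "2 * q"]]) auto
    \<comment> \<open>The entry vanishes off the diagonal, so every index along the walk equals
      \<open>a\<close>.\<close>
    have const: "xs = map (\<lambda>u. (u, a)) (map fst xs)" if "wprod (?h c G) a xs \<noteq> 0" for a xs G
      using that by (induction a xs rule: wsteps.induct) (auto simp: case_prod_unfold split: if_splits)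
    have "inj_on (\<lambda>(a, xs). (a, map fst xs)) ?S"
    proof (rule inj_onI)
      fix z z' assume zz: "z \<in> ?S" "z' \<in> ?S" "(\<lambda>(a, xs). (a, map fst xs)) z = (\<lambda>(a, xs). (a, map fst xs)) z'"
      obtain a xs b ys where z: "z = (a, xs)" "z' = (b, ys)" by (metis prod.exhaust)
      have xy: "xs = map (\<lambda>u. (u, a)) (map fst xs)" "ys = map (\<lambda>u. (u, b)) (map fst ys)"
        using zz(1,2) const unfolding z by blast+
      have "a = b" "map fst xs = map fst ys" using zz(3) unfolding z by simp_all
      then have "xs = ys" using xy by metis
      with \<open>a = b\<close> show "z = z'" unfolding z by simp
    qed
    moreover have "(\<lambda>(a, xs). (a, map fst xs)) ` ?S \<subseteq> ?I \<times> ?W"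
    proof (rule image_subsetI)
      fix z assume zS: "z \<in> ?S"
      obtain i j k l xs where z: "z = ((i, j, k, l), xs)" by (metis prod.exhaust)
      let ?a = "(i, j, k, l)"
      obtain G where a: "?a \<in> ?I" "xs \<in> walks ?V ?I (2 * q)" "wprod (?h c G) ?a xs \<noteq> 0"
        "\<forall>e\<in>?E. even (count_list (wedges ?ed ?a xs) e)"
        using zS unfolding z mem_Collect_eq prod.case by blast
      have steps: "wsteps ?a xs = map (\<lambda>u. (?a, u, ?a)) (map fst xs)"
      proof -
        have "wsteps ?a (map (\<lambda>u. (u, ?a)) us) = map (\<lambda>u. (?a, u, ?a)) us" for us :: "nat list"
          by (induction us) auto
        then show ?thesis using const[OF a(3)] by metis
      qed
      have len: "length xs = 2 * q" and sub: "set (map fst xs) \<subseteq> ?V" using a(2) by (auto simp: walks_def)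
      have nz: "distinct [i, j, k, l] \<and> u \<notin> {i, j, k, l}" if "u \<in> set (map fst xs)" for u
      proof -
        have "(?a, u, ?a) \<in> set (wsteps ?a xs)" using that unfolding steps by auto
        from wprod_nonzero_steps[OF a(3) this] show ?thesis by (auto split: if_splits)
      qed
      \<comment> \<open>As labels avoid i, j, k, l, the edge {v, i} arises only from label v and
        only in its first slot; its multiplicity is therefore that of v.\<close>
      have cnt: "count_list (wedges ?ed ?a xs) {v, i} = count_list (map fst xs) v" if v: "v \<in> set (map fst xs)" for v
      proof -
        have "count_list (concat (map (\<lambda>u. [{u, i}, {u, j}, {u, k}, {u, l}]) us)) {v, i} = count_list us v"
          if "set us \<subseteq> set (map fst xs)" for us
          using that
        proof (induction us)
          case (Cons u us)
          have "u \<in> set (map fst xs)" using Cons.prems by simp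
          from nz[OF this] have "{u, j} \<noteq> {v, i}" "{u, k} \<noteq> {v, i}" "{u, l} \<noteq> {v, i}" "{u, i} = {v, i} \<longleftrightarrow> u = v"
            by (auto simp: doubleton_eq_iff)
          then show ?case using Cons by (cases "u = v") auto
        qed simp
        from this[of "map fst xs"] show ?thesis
          unfolding wedges_eq_concat_wsteps steps by (simp add: comp_def case_prod_unfold)
      qed
      have inE: "{v, i} \<in> ?E" if "v \<in> set (map fst xs)" for v
        using that sub a(1) nz[OF that] by (intro pair_in_vertex_pairs) auto
      have "even (count_list (map fst xs) v)" if "v \<in> set (map fst xs)" for v
        using bspec[OF a(4) inE[OF that]] unfolding cnt[OF that] .
      then have "2 * card (set (map fst xs)) \<le> length (map fst xs)"
        by (rule card_set_le_half_length)
      then show "(\<lambda>(a, xs). (a, map fst xs)) z \<in> ?I \<times> ?W"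
        unfolding z using a(1) len sub by simp
    qed
    ultimately have "card ?S \<le> card (?I \<times> ?W)"
      by (rule card_inj_on_le) (use fW in \<open>intro finite_cartesian_product; simp\<close>)
    also have "\<dots> = n ^ 4 * card ?W"
      by (simp add: card_cartesian_product numeral_eq_Suc)
    also have "\<dots> \<le> n ^ 4 * (card ?V ^ q * q ^ (2 * q))"
      using assms(1) by (intro mult_left_mono card_lists_few_values) auto
    also have "\<dots> = n ^ (q + 4) * q ^ (2 * q)"
      by (simp add: power_add)
    finally have "real (card ?S) \<le> real (n ^ (q + 4) * q ^ (2 * q))"
      by (rule of_nat_mono)
    then show "real (card ?S) \<le> ?N"
      by (simp only: of_nat_mult of_nat_power)
  qed (use assms in auto)
  moreover have "?B \<subseteq> ?B'"
  proof (rule subsetI)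
    fix G assume "G \<in> ?B"
    then obtain i j k l where G: "G \<subseteq> ?E" "i \<in> ?V" "j \<in> ?V" "k \<in> ?V" "l \<in> ?V" "distinct [i, j, k, l]"
      "\<tau> * ?N < \<bar>common_sign n G i j k l\<bar> ^ (2 * q)" by blast
    let ?a = "(i, j, k, l)"
    \<comment> \<open>Testing with the indicator of one quadruple reads off the corresponding
      diagonal entry.\<close>
    define x :: "nat \<times> nat \<times> nat \<times> nat \<Rightarrow> real" where "x = (\<lambda>a. of_bool (a = ?a))"
    have aI: "?a \<in> ?I" using G by auto
    have fI: "finite ?I" by simp
    have X: "(\<Sum>a\<in>?I. (x a)\<^sup>2) = 1"
    proof -
      have "(\<Sum>a\<in>?I. (x a)\<^sup>2) = (\<Sum>a\<in>?I. if a = ?a then 1 else 0)"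
        by (intro sum.cong) (auto simp: x_def)
      then show ?thesis using sum.delta[OF fI, of ?a "\<lambda>_. 1"] aI by simp
    qed
    have "qform ?I M x = M ?a ?a" for M
    proof -
      have "qform ?I M x = (\<Sum>a\<in>?I. if a = ?a then (\<Sum>b\<in>?I. if b = ?a then M a b else 0) else 0)"
        unfolding qform_def by (intro sum.cong refl) (auto simp: x_def intro!: sum.cong)
      then show ?thesis using sum.delta[OF fI] aI by simp
    qed
    then have "qform ?I (\<lambda>a b. \<Sum>u\<in>?V. ?h () G a u b) x = common_sign n G i j k l"
      using G(6) by (simp add: common_sign_def)
    then have "\<exists>x. \<tau> * (1 ^ (2 * q) * ?N) * (\<Sum>a\<in>?I. (x a)\<^sup>2) ^ (2 * q)
      < (\<bar>\<Sum>c\<in>{()}. qform ?I (\<lambda>a b. \<Sum>u\<in>?V. ?h c G a u b) x\<bar> / card {()}) ^ (2 * q)"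
      using G(7) X by (intro exI[of _ x]) simp
    then show "G \<in> ?B'" using G(1) by blast
  qed
  then have "card ?B \<le> card ?B'"
    by (intro card_mono) (auto intro: finite_subset[of _ "Pow ?E"])
  ultimately show ?thesis by linarith
qed

section \<open>Removing the colours\<close>

definition M4 :: "nat set set \<Rightarrow> nat \<times> nat \<Rightarrow> nat \<times> nat \<Rightarrow> real" where
  "M4 G = (\<lambda>(i, j) (k, l). of_bool (distinct [i, j, k, l]) * (sgn_adj G i k * sgn_adj G j l * g4 G i j k l))"

definition M5 :: "nat \<Rightarrow> nat set set \<Rightarrow> nat \<times> nat \<Rightarrow> nat \<times> nat \<Rightarrow> real" where
  "M5 n G = (\<lambda>(i, j) (k, l). of_bool (distinct [i, j, k, l]) *
     (common_sign n G i j k l * (sgn_adj G i k * g5 G i j k l)))"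

lemma sum_of_bool_colourings:
  assumes "S \<subseteq> {1..n}" "\<And>v. v \<in> S \<Longrightarrow> \<phi> v < 3"
  shows "(\<Sum>c\<in>colourings n. of_bool (\<forall>v\<in>S. c v = \<phi> v)) = (3 ^ n / 3 ^ card S :: real)"
proof -
  have "(\<Sum>c\<in>colourings n. of_bool (\<forall>v\<in>S. c v = \<phi> v) :: real)
      = real (card {c \<in> colourings n. \<forall>v\<in>S. c v = \<phi> v})"
    by (simp add: Int_def)
  moreover have "3 ^ card S * real (card {c \<in> colourings n. \<forall>v\<in>S. c v = \<phi> v}) = 3 ^ n"
    using arg_cong[OF card_colourings_prescribed[of S n \<phi>, OF assms], of real] by simp
  ultimately show ?thesis by (simp add: field_simps)
qed

text \<open>Four prescribed colours give 81 = 3^4. If i = k or j = l, a diagonal sign kills the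
  entry; any other coincidence asks for two colours at one vertex.\<close>

lemma sum_colourings_h4:
  assumes "a \<in> {1..n} \<times> {1..n}" "b \<in> {1..n} \<times> {1..n}"
  shows "(\<Sum>c\<in>colourings n. h4 c G a u b) = 3 ^ n / 81 * M4 G a b"
proof -
  obtain i j k l where ab: "a = (i, j)" "b = (k, l)" by (cases a; cases b)
  let ?w = "sgn_adj G i k * sgn_adj G j l * g4 G i j k l"
  have "(\<Sum>c\<in>colourings n. h4 c G a u b)
    = (\<Sum>c\<in>colourings n. of_bool (c i = 0 \<and> c k = 0 \<and> c j = 1 \<and> c l = 1)) * ?w"
    by (simp add: ab h4_def sum_distrib_right)
  also have "\<dots> = 3 ^ n / 81 * M4 G a b"
  proof (cases "distinct [i, j, k, l]")
    case True
    define \<phi> :: "nat \<Rightarrow> nat" where "\<phi> v = of_bool (v \<in> {j, l})" for v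
    have "(c i = 0 \<and> c k = 0 \<and> c j = 1 \<and> c l = 1) \<longleftrightarrow> (\<forall>v\<in>{i, j, k, l}. c v = \<phi> v)" for c
      using True by (auto simp: \<phi>_def)
    moreover have "card {i, j, k, l} = 4" using True by simp
    ultimately show ?thesis
      using sum_of_bool_colourings[of "{i, j, k, l}" n \<phi>] assms True by (simp add: ab M4_def \<phi>_def)
  next
    case False
    have z: "(\<Sum>c\<in>colourings n. of_bool (c i = 0 \<and> c k = 0 \<and> c j = 1 \<and> c l = 1)) * ?w = 0"
    proof (cases "i = k \<or> j = l")
      case False
      then have "\<not> (c i = 0 \<and> c k = 0 \<and> c j = 1 \<and> c l = 1)" for c :: "nat \<Rightarrow> nat"
        using \<open>\<not> distinct [i, j, k, l]\<close> by auto
      then show ?thesis by (simp only: of_bool_eq sum.neutral_const mult_zero_left)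
    qed auto
    show ?thesis unfolding z using False by (simp add: ab M4_def)
  qed
  finally show ?thesis .
qed

text \<open>The colour of u makes it 243 = 3^5. Outside \<open>g5\<close> no factor vanishes at j =
  l, so \<open>h5\<close> excludes that case itself; a label u among i, j, k, l is killed by a
  diagonal sign.\<close>

lemma sum_colourings_h5:
  assumes "a \<in> {1..n} \<times> {1..n}" "b \<in> {1..n} \<times> {1..n}"
  shows "(\<Sum>c\<in>colourings n. \<Sum>u\<in>{1..n}. h5 c G a u b) = 3 ^ n / 243 * M5 n G a b"
proof -
  obtain i j k l where ab: "a = (i, j)" "b = (k, l)" by (cases a; cases b)
  let ?w = "\<lambda>u. sgn_adj G u i * sgn_adj G u j * sgn_adj G u k * sgn_adj G u l * (sgn_adj G i k * g5 G i j k l)"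
  let ?C = "\<lambda>c u. c i = 0 \<and> c k = 0 \<and> c j = (1::nat) \<and> c l = 1 \<and> c u = 2 \<and> j \<noteq> l"
  have "(\<Sum>c\<in>colourings n. \<Sum>u\<in>{1..n}. h5 c G a u b) = (\<Sum>u\<in>{1..n}. \<Sum>c\<in>colourings n. h5 c G a u b)"
    by (rule sum.swap)
  also have "\<dots> = (\<Sum>u\<in>{1..n}. 3 ^ n / 243 * (of_bool (distinct [i, j, k, l]) * ?w u))"
  proof (rule sum.cong[OF refl])
    fix u assume u: "u \<in> {1..n}"
    have "(\<Sum>c\<in>colourings n. h5 c G a u b) = (\<Sum>c\<in>colourings n. of_bool (?C c u)) * ?w u"
      unfolding ab h5_def prod.case sum_distrib_right by (intro sum.cong refl) (simp only: mult_ac)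
    also have "\<dots> = 3 ^ n / 243 * (of_bool (distinct [i, j, k, l]) * ?w u)"
    proof (cases "distinct [i, j, k, l, u]")
      case True
      define \<phi> :: "nat \<Rightarrow> nat" where "\<phi> v = (if v = u then 2 else of_bool (v \<in> {j, l}))" for v
      have C: "?C c u \<longleftrightarrow> (\<forall>v\<in>{i, j, k, l, u}. c v = \<phi> v)" for c
        using True by (auto simp: \<phi>_def)
      have c5: "card {i, j, k, l, u} = 5" using True by simp
      have sub: "{i, j, k, l, u} \<subseteq> {1..n}" using assms u by (simp add: ab)
      have \<phi>: "\<phi> v < 3" for v by (simp add: \<phi>_def)
      have sm: "(\<Sum>c\<in>colourings n. of_bool (?C c u)) = (3 ^ n / 3 ^ card {i, j, k, l, u} :: real)"
        unfolding C by (rule sum_of_bool_colourings[OF sub \<phi>])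
      show ?thesis unfolding sm c5 using True by simp
    next
      case False
      show ?thesis
      proof (cases "u \<in> {i, j, k, l}")
        case False
        then have nd: "\<not> distinct [i, j, k, l]" using \<open>\<not> distinct [i, j, k, l, u]\<close> by auto
        have z: "(\<Sum>c\<in>colourings n. of_bool (?C c u)) * ?w u = 0"
        proof (cases "i = k")
          case False
          then have "\<not> ?C c u" for c using nd by auto
          then show ?thesis by (simp only: of_bool_eq sum.neutral_const mult_zero_left)
        qed simp
        show ?thesis unfolding z using nd by simp
      next
        case True
        then have "?w u = 0" by auto
        then show ?thesis by (simp only: mult_zero_right)
      qed
    qed
    finally show "(\<Sum>c\<in>colourings n. h5 c G a u b) = 3 ^ n / 243 * (of_bool (distinct [i, j, k, l]) * ?w u)" .
  qed
  also have "\<dots> = 3 ^ n / 243 * M5 n G a b"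
    unfolding ab M5_def prod.case common_sign_def sum_distrib_left sum_distrib_right
    by (simp only: mult_ac)
  finally show ?thesis .
qed

lemma sum_qform:
  "(\<Sum>c\<in>C. qform I (H c) x) = qform I (\<lambda>a b. \<Sum>c\<in>C. H c a b) x"
proof -
  have "(\<Sum>c\<in>C. qform I (H c) x) = (\<Sum>a\<in>I. \<Sum>c\<in>C. \<Sum>b\<in>I. x a * H c a b * x b)"
    unfolding qform_def by (rule sum.swap)
  also have "\<dots> = (\<Sum>a\<in>I. \<Sum>b\<in>I. \<Sum>c\<in>C. x a * H c a b * x b)"
    by (rule sum.cong[OF refl]) (rule sum.swap)
  finally show ?thesis by (simp add: qform_def sum_distrib_left sum_distrib_right)
qed

lemma qform_cong: "(\<And>a b. a \<in> I \<Longrightarrow> b \<in> I \<Longrightarrow> H a b = H' a b) \<Longrightarrow> qform I H x = qform I H' x"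
  unfolding qform_def by (intro sum.cong refl) auto

lemma qform_scale: "qform I (\<lambda>a b. r * H a b) x = r * qform I H x"
  by (simp add: qform_def sum_distrib_left mult_ac)

lemma average_h4:
  "(\<Sum>c\<in>colourings n. qform ({1..n} \<times> {1..n}) (\<lambda>a b. \<Sum>u\<in>{()}. h4 c G a u b) x)
    = 3 ^ n / 81 * qform ({1..n} \<times> {1..n}) (M4 G) x"
  unfolding sum_qform qform_scale[symmetric] by (rule qform_cong) (simp add: sum_colourings_h4)

lemma average_h5:
  "(\<Sum>c\<in>colourings n. qform ({1..n} \<times> {1..n}) (\<lambda>a b. \<Sum>u\<in>{1..n}. h5 c G a u b) x)
    = 3 ^ n / 243 * qform ({1..n} \<times> {1..n}) (M5 n G) x"
  unfolding sum_qform qform_scale[symmetric] by (rule qform_cong) (rule sum_colourings_h5)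

text \<open>The event on which the construction is deterministic, with \<Lambda> polylogarithmic.
  The three norm bounds serve positive semidefiniteness; the entrywise bound keeps the corrected
  moments in [0,1].\<close>

definition pseudorandom :: "nat \<Rightarrow> real \<Rightarrow> nat set set \<Rightarrow> bool" where
  "pseudorandom n \<Lambda> G \<longleftrightarrow>
     (\<forall>x. \<bar>qform {1..n} (sgn_adj G) x\<bar> \<le> sqrt n * \<Lambda> * (\<Sum>i\<in>{1..n}. (x i)\<^sup>2)) \<and>
     (\<forall>x. \<bar>qform ({1..n} \<times> {1..n}) (M4 G) x\<bar> \<le> n * \<Lambda> * (\<Sum>a\<in>{1..n} \<times> {1..n}. (x a)\<^sup>2)) \<and>
     (\<forall>x. \<bar>qform ({1..n} \<times> {1..n}) (M5 n G) x\<bar> \<le> n * sqrt n * \<Lambda> * (\<Sum>a\<in>{1..n} \<times> {1..n}. (x a)\<^sup>2)) \<and>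
     (\<forall>i\<in>{1..n}. \<forall>j\<in>{1..n}. \<forall>k\<in>{1..n}. \<forall>l\<in>{1..n}. distinct [i, j, k, l] \<longrightarrow>
        \<bar>common_sign n G i j k l\<bar> \<le> sqrt n * \<Lambda>)"

section \<open>Thresholds and failure probability\<close>

lemma root_bound:
  fixes X B y T :: real
  assumes "\<not> T * X ^ L < y ^ L" "T \<le> B ^ L" "0 \<le> X" "0 \<le> B" "0 < L" "0 \<le> y"
  shows "y \<le> B * X"
proof (rule power_le_imp_le_base[of _ "L - 1"])
  have "y ^ L \<le> T * X ^ L" using assms(1) by simp
  also have "\<dots> \<le> B ^ L * X ^ L" using assms by (intro mult_right_mono) auto
  finally show "y ^ Suc (L - 1) \<le> (B * X) ^ Suc (L - 1)"
    using assms(5) by (simp add: power_mult_distrib)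
qed (use assms in auto)

text \<open>Since n \<le> 2^(2q), a spare power n^k costs only a factor 2^k in the base of the 2q-th
  power, and the powers of q, of exponent at most 8q, cost D^4. The factor n^4 on the left is the
  Markov threshold. The third bound dictates the constant: 2^6 times 15 times 243 is 233280, just
  below 2^18.\<close>

lemma trace_thresholds:
  fixes n q :: nat and D \<Lambda> :: real
  assumes n: "n \<ge> 1" "real n \<le> 2 ^ (2 * q)" and q: "q \<ge> 1"
    and D: "D = real (Suc (2 * q))" and \<Lambda>: "\<Lambda> = 2 ^ 18 * D ^ 4"
  shows "real n ^ 4 * (real n ^ Suc q * real (Suc q) ^ Suc (2 * q)) \<le> (sqrt n * \<Lambda>) ^ (2 * q)" (is ?A)
    and "real n ^ 4 * (7 ^ (2 * q) * (real n ^ Suc q * real (Suc q) ^ Suc (2 * q))\<^sup>2) \<le> (n * \<Lambda> / 81) ^ (2 * q)" (is ?B)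
    and "real n ^ 4 * (15 ^ (2 * q) * ((real n ^ Suc q * real (Suc q) ^ Suc (2 * q)) *
        (real n ^ Suc (2 * q) * real (Suc (2 * q)) ^ Suc (4 * q)))) \<le> (n * sqrt n * \<Lambda> / 243) ^ (2 * q)" (is ?C)
    and "real n ^ 4 * (real n ^ (q + 4) * real q ^ (2 * q)) \<le> (sqrt n * \<Lambda>) ^ (2 * q)" (is ?D)
proof -
  have D1: "D \<ge> 1" by (simp add: D)
  have nk: "real n ^ k \<le> (2 ^ k) ^ (2 * q)" for k
    using power_mono[OF n(2), of k] by (simp add: power_mult[symmetric] mult_ac)
  have nq: "real n ^ q = sqrt n ^ (2 * q)"
    by (simp add: power_mult)
  have Dp: "real a ^ k \<le> (D ^ 4) ^ (2 * q)" if "a \<le> Suc (2 * q)" "k \<le> 8 * q" for a k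
  proof -
    have "real a ^ k \<le> D ^ k" using that D by (intro power_mono) auto
    also have "\<dots> \<le> D ^ (8 * q)" using D1 that by (intro power_increasing) auto
    finally show ?thesis by (simp add: power_mult[symmetric])
  qed
  have fin: "x ^ (2 * q) \<le> y ^ (2 * q)" if "0 \<le> x" "x \<le> y" for x y :: real
    using that by (rule power_mono[rotated])
  have D4: "D ^ 4 \<ge> 1" using D1 by simp
  have "real n ^ 4 * (real n ^ Suc q * real (Suc q) ^ Suc (2 * q))
      = real n ^ 5 * (real n ^ q * real (Suc q) ^ Suc (2 * q))"
    by (simp add: power_add[symmetric] numeral_eq_Suc)
  also have "\<dots> \<le> (2 ^ 5) ^ (2 * q) * (sqrt n ^ (2 * q) * (D ^ 4) ^ (2 * q))"
    unfolding nq[symmetric] using q by (intro mult_mono nk Dp) auto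
  also have "\<dots> = (2 ^ 5 * (sqrt n * D ^ 4)) ^ (2 * q)"
    by (simp only: power_mult_distrib)
  also have "\<dots> \<le> (sqrt n * \<Lambda>) ^ (2 * q)"
    using D4 by (intro fin) (auto simp: \<Lambda> mult_ac)
  finally show ?A .
  have "real n ^ 4 * (7 ^ (2 * q) * (real n ^ Suc q * real (Suc q) ^ Suc (2 * q))\<^sup>2)
      = real n ^ 6 * (7 ^ (2 * q) * (real n ^ (2 * q) * real (Suc q) ^ (2 * Suc (2 * q))))"
  proof -
    have s: "(x ^ k)\<^sup>2 = x ^ (2 * k)" for x :: real and k
      by (simp only: power_mult[symmetric] mult.commute)
    have "real n ^ 4 * (7 ^ (2 * q) * (real n ^ Suc q * real (Suc q) ^ Suc (2 * q))\<^sup>2)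
        = (real n ^ 4 * real n ^ (2 * Suc q)) * (7 ^ (2 * q) * real (Suc q) ^ (2 * Suc (2 * q)))"
      unfolding power_mult_distrib s by (simp only: mult_ac)
    also have "real n ^ 4 * real n ^ (2 * Suc q) = real n ^ 6 * real n ^ (2 * q)"
      by (simp only: power_add[symmetric]) simp
    finally show ?thesis by (simp only: mult_ac)
  qed
  also have "\<dots> \<le> (2 ^ 6) ^ (2 * q) * (7 ^ (2 * q) * (real n ^ (2 * q) * (D ^ 4) ^ (2 * q)))"
  proof -
    have "real (Suc q) ^ (2 * Suc (2 * q)) \<le> (D ^ 4) ^ (2 * q)"
      using q by (intro Dp) auto
    then show ?thesis by (intro mult_mono nk order_refl) simp_all
  qed
  also have "\<dots> = (2 ^ 6 * (7 * (real n * D ^ 4))) ^ (2 * q)"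
    by (simp only: power_mult_distrib)
  also have "\<dots> \<le> (n * \<Lambda> / 81) ^ (2 * q)"
    using D4 by (intro fin) (auto simp: \<Lambda> field_simps)
  finally show ?B .
  have "real n ^ 4 * (15 ^ (2 * q) * ((real n ^ Suc q * real (Suc q) ^ Suc (2 * q)) *
        (real n ^ Suc (2 * q) * real (Suc (2 * q)) ^ Suc (4 * q))))
      = real n ^ 6 * (15 ^ (2 * q) * ((real n ^ (2 * q) * real n ^ q) * (real (Suc q) ^ Suc (2 * q) * real (Suc (2 * q)) ^ Suc (4 * q))))"
  proof -
    have "real n ^ 4 * real n ^ Suc q * real n ^ Suc (2 * q) = real n ^ 6 * (real n ^ (2 * q) * real n ^ q)"
      by (simp only: power_add[symmetric]) simp
    then have "real n ^ 4 * real n ^ Suc q * real n ^ Suc (2 * q) * z = real n ^ 6 * (real n ^ (2 * q) * real n ^ q) * z" for z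
      by (simp only:)
    from this[of "15 ^ (2 * q) * (real (Suc q) ^ Suc (2 * q) * real (Suc (2 * q)) ^ Suc (4 * q))"]
    show ?thesis by (simp only: mult_ac)
  qed
  also have "\<dots> \<le> (2 ^ 6) ^ (2 * q) * (15 ^ (2 * q) * ((real n ^ (2 * q) * sqrt n ^ (2 * q)) * (D ^ 4) ^ (2 * q)))"
  proof -
    have "real (Suc q) ^ Suc (2 * q) * real (Suc (2 * q)) ^ Suc (4 * q) \<le> real (Suc (2 * q)) ^ Suc (2 * q) * real (Suc (2 * q)) ^ Suc (4 * q)"
      by (intro mult_right_mono power_mono) auto
    also have "\<dots> = real (Suc (2 * q)) ^ (6 * q + 2)"
      by (simp only: power_add[symmetric]) simp
    also have "\<dots> \<le> (D ^ 4) ^ (2 * q)"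
      using q by (intro Dp) auto
    finally show ?thesis
      unfolding nq[symmetric] using q by (intro mult_mono nk mult_nonneg_nonneg) auto
  qed
  also have "\<dots> = (2 ^ 6 * (15 * ((real n * sqrt n) * D ^ 4))) ^ (2 * q)"
    by (simp only: power_mult_distrib)
  also have "\<dots> \<le> (n * sqrt n * \<Lambda> / 243) ^ (2 * q)"
    using D4 by (intro fin) (auto simp: \<Lambda> field_simps)
  finally show ?C .
  have "real n ^ 4 * (real n ^ (q + 4) * real q ^ (2 * q)) = real n ^ 8 * (real n ^ q * real q ^ (2 * q))"
  proof -
    have "real n ^ 4 * real n ^ (q + 4) = real n ^ 8 * real n ^ q"
      by (simp only: power_add[symmetric]) simp
    then show ?thesis by (simp only: mult.assoc[symmetric])
  qed
  also have "\<dots> \<le> (2 ^ 8) ^ (2 * q) * (sqrt n ^ (2 * q) * (D ^ 4) ^ (2 * q))"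
    unfolding nq[symmetric] using q by (intro mult_mono nk Dp) auto
  also have "\<dots> = (2 ^ 8 * (sqrt n * D ^ 4)) ^ (2 * q)"
    by (simp only: power_mult_distrib)
  also have "\<dots> \<le> (sqrt n * \<Lambda>) ^ (2 * q)"
    using D4 by (intro fin) (auto simp: \<Lambda> mult_ac)
  finally show ?D .
qed

text \<open>Union bound over the four bad events, each with \<tau> = n^4.\<close>

theorem card_not_pseudorandom:
  assumes n: "n \<ge> 1" "real n \<le> 2 ^ (2 * q)" and q: "2 * q = 2 ^ Suc m"
  shows "real (card {G\<in>Pow (vertex_pairs n). \<not> pseudorandom n (2 ^ 18 * real (Suc (2 * q)) ^ 4) G})
    \<le> 4 * (2 ^ card (vertex_pairs n) / real n ^ 4)"
proof -
  define \<Lambda> where "\<Lambda> = 2 ^ 18 * real (Suc (2 * q)) ^ 4"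
  let ?E = "vertex_pairs n" and ?V = "{1..n}" and ?L = "2 * q" and ?\<tau> = "real n ^ 4"
  let ?VV = "?V \<times> ?V"
  have q1: "q \<ge> 1" using q by (cases q) auto
  have L0: "0 < ?L" using q1 by simp
  have \<tau>: "?\<tau> > 0" using n(1) by simp
  have \<Lambda>0: "\<Lambda> \<ge> 0" by (simp add: \<Lambda>_def)
  note th = trace_thresholds[OF n q1 refl \<Lambda>_def]
  define T1 where "T1 = real n ^ Suc q * real (Suc q) ^ Suc (2 * q)"
  define T2 where "T2 = 7 ^ (2 * q) * (real n ^ Suc q * real (Suc q) ^ Suc (2 * q))\<^sup>2"
  define T3 where "T3 = 15 ^ (2 * q) * ((real n ^ Suc q * real (Suc q) ^ Suc (2 * q)) *
        (real n ^ Suc (2 * q) * real (Suc (2 * q)) ^ Suc (4 * q)))"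
  define T4 where "T4 = real n ^ (q + 4) * real q ^ (2 * q)"
  let ?B1 = "{G\<in>Pow ?E. \<exists>x. ?\<tau> * T1 * (\<Sum>a\<in>?V. (x a)\<^sup>2) ^ ?L < \<bar>qform ?V (sgn_adj G) x\<bar> ^ ?L}"
  let ?B2 = "{G\<in>Pow ?E. \<exists>x. ?\<tau> * T2 * (\<Sum>a\<in>?VV. (x a)\<^sup>2) ^ ?L
      < (\<bar>\<Sum>c\<in>colourings n. qform ?VV (\<lambda>a b. \<Sum>u\<in>{()}. h4 c G a u b) x\<bar> / card (colourings n)) ^ ?L}"
  let ?B3 = "{G\<in>Pow ?E. \<exists>x. ?\<tau> * T3 * (\<Sum>a\<in>?VV. (x a)\<^sup>2) ^ ?L
      < (\<bar>\<Sum>c\<in>colourings n. qform ?VV (\<lambda>a b. \<Sum>u\<in>?V. h5 c G a u b) x\<bar> / card (colourings n)) ^ ?L}"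
  let ?B4 = "{G\<in>Pow ?E. \<exists>i\<in>?V. \<exists>j\<in>?V. \<exists>k\<in>?V. \<exists>l\<in>?V. distinct [i, j, k, l] \<and>
      ?\<tau> * T4 < \<bar>common_sign n G i j k l\<bar> ^ ?L}"
  have B: "real (card ?B1) \<le> 2 ^ card ?E / ?\<tau>" "real (card ?B2) \<le> 2 ^ card ?E / ?\<tau>"
    "real (card ?B3) \<le> 2 ^ card ?E / ?\<tau>" "real (card ?B4) \<le> 2 ^ card ?E / ?\<tau>"
    using adjacency_norm_bad[OF n(1) \<tau> q] coloured_four_norm_bad[OF n(1) \<tau> q]
      coloured_five_norm_bad[OF n(1) \<tau> q] common_sign_bad[OF n(1) \<tau> q]
    unfolding T1_def T2_def T3_def T4_def by blast+
  \<comment> \<open>The factor \<open>3 ^ n\<close> of the averaging identities cancels against the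
    number of colourings.\<close>
  have avg: "\<bar>3 ^ n / r * y\<bar> / real (card (colourings n)) = \<bar>y\<bar> / r" if "r > 0" for r y :: real
    using that by (simp add: card_colourings abs_mult)
  have sub: "{G\<in>Pow ?E. \<not> pseudorandom n \<Lambda> G} \<subseteq> ?B1 \<union> ?B2 \<union> ?B3 \<union> ?B4"
  proof (rule subsetI, rule ccontr)
    fix G assume G: "G \<in> {G\<in>Pow ?E. \<not> pseudorandom n \<Lambda> G}" and nb: "G \<notin> ?B1 \<union> ?B2 \<union> ?B3 \<union> ?B4"
    have GE: "G \<in> Pow ?E" using G by blast
    have X0: "0 \<le> (\<Sum>a\<in>I. (x a)\<^sup>2)" for I and x :: "'z \<Rightarrow> real" by (intro sum_nonneg) simp
    have "\<bar>qform ?V (sgn_adj G) x\<bar> \<le> (sqrt n * \<Lambda>) * (\<Sum>a\<in>?V. (x a)\<^sup>2)" for x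
    proof (rule root_bound[OF _ _ X0 _ L0])
      show "\<not> (?\<tau> * T1) * (\<Sum>a\<in>?V. (x a)\<^sup>2) ^ ?L < \<bar>qform ?V (sgn_adj G) x\<bar> ^ ?L"
        using nb GE by blast
    qed (use th(1) \<Lambda>0 in \<open>auto simp: T1_def\<close>)
    moreover have "\<bar>qform ?VV (M4 G) x\<bar> \<le> (n * \<Lambda>) * (\<Sum>a\<in>?VV. (x a)\<^sup>2)" for x
    proof -
      have "\<not> (?\<tau> * T2) * (\<Sum>a\<in>?VV. (x a)\<^sup>2) ^ ?L
         < (\<bar>\<Sum>c\<in>colourings n. qform ?VV (\<lambda>a b. \<Sum>u\<in>{()}. h4 c G a u b) x\<bar> / card (colourings n)) ^ ?L"
        using nb GE by blast
      then have "\<not> (?\<tau> * T2) * (\<Sum>a\<in>?VV. (x a)\<^sup>2) ^ ?L < (\<bar>qform ?VV (M4 G) x\<bar> / 81) ^ ?L"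
        unfolding average_h4 by (simp only: avg zero_less_numeral not_False_eq_True)
      then have "\<bar>qform ?VV (M4 G) x\<bar> / 81 \<le> (n * \<Lambda> / 81) * (\<Sum>a\<in>?VV. (x a)\<^sup>2)"
        by (rule root_bound[OF _ _ X0 _ L0]) (use th(2) \<Lambda>0 in \<open>simp_all only: T2_def\<close>, simp_all)
      then show ?thesis by simp
    qed
    moreover have "\<bar>qform ?VV (M5 n G) x\<bar> \<le> (n * sqrt n * \<Lambda>) * (\<Sum>a\<in>?VV. (x a)\<^sup>2)" for x
    proof -
      have "\<not> (?\<tau> * T3) * (\<Sum>a\<in>?VV. (x a)\<^sup>2) ^ ?L
         < (\<bar>\<Sum>c\<in>colourings n. qform ?VV (\<lambda>a b. \<Sum>u\<in>?V. h5 c G a u b) x\<bar> / card (colourings n)) ^ ?L"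
        using nb GE by blast
      then have "\<not> (?\<tau> * T3) * (\<Sum>a\<in>?VV. (x a)\<^sup>2) ^ ?L < (\<bar>qform ?VV (M5 n G) x\<bar> / 243) ^ ?L"
        unfolding average_h5 by (simp only: avg zero_less_numeral not_False_eq_True)
      then have "\<bar>qform ?VV (M5 n G) x\<bar> / 243 \<le> (n * sqrt n * \<Lambda> / 243) * (\<Sum>a\<in>?VV. (x a)\<^sup>2)"
        by (rule root_bound[OF _ _ X0 _ L0]) (use th(3) \<Lambda>0 in \<open>simp_all only: T3_def\<close>, simp_all)
      then show ?thesis by simp
    qed
    moreover have "\<bar>common_sign n G i j k l\<bar> \<le> sqrt n * \<Lambda>"
      if "i \<in> ?V" "j \<in> ?V" "k \<in> ?V" "l \<in> ?V" "distinct [i, j, k, l]" for i j k l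
    proof -
      have "\<not> ?\<tau> * T4 < \<bar>common_sign n G i j k l\<bar> ^ ?L"
        using nb GE that by blast
      then have "\<not> (?\<tau> * T4) * 1 ^ ?L < \<bar>common_sign n G i j k l\<bar> ^ ?L" by simp
      then have "\<bar>common_sign n G i j k l\<bar> \<le> (sqrt n * \<Lambda>) * 1"
        by (rule root_bound[OF _ _ _ _ L0]) (use th(4) \<Lambda>0 in \<open>simp_all only: T4_def\<close>, simp_all)
      then show ?thesis by simp
    qed
    ultimately have "pseudorandom n \<Lambda> G"
      unfolding pseudorandom_def by blast
    with G show False by blast
  qed
  have fin: "finite (?B1 \<union> ?B2 \<union> ?B3 \<union> ?B4)"
    by (rule finite_subset[of _ "Pow ?E"]) auto
  have "card {G\<in>Pow ?E. \<not> pseudorandom n \<Lambda> G} \<le> card (?B1 \<union> ?B2 \<union> ?B3 \<union> ?B4)"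
    by (rule card_mono[OF fin sub])
  also have "\<dots> \<le> card ?B1 + card ?B2 + card ?B3 + card ?B4"
    using card_Un_le[of "?B1 \<union> ?B2 \<union> ?B3" ?B4] card_Un_le[of "?B1 \<union> ?B2" ?B3] card_Un_le[of ?B1 ?B2]
    by linarith
  finally have "real (card {G\<in>Pow ?E. \<not> pseudorandom n \<Lambda> G})
      \<le> real (card ?B1) + real (card ?B2) + real (card ?B3) + real (card ?B4)"
    unfolding of_nat_add[symmetric] by (rule of_nat_mono)
  then show ?thesis using B unfolding \<Lambda>_def by linarith
qed

section \<open>The quartic part of the moment form\<close>

definition S4 :: "nat \<Rightarrow> (nat \<Rightarrow> nat \<Rightarrow> nat \<Rightarrow> nat \<Rightarrow> real) \<Rightarrow> real" where
  "S4 n f = (\<Sum>i\<in>{1..n}. \<Sum>j\<in>{1..n}. \<Sum>k\<in>{1..n}. \<Sum>l\<in>{1..n}. f i j k l)"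

lemma S4_cong: "(\<And>i j k l. i \<in> {1..n} \<Longrightarrow> j \<in> {1..n} \<Longrightarrow> k \<in> {1..n} \<Longrightarrow> l \<in> {1..n} \<Longrightarrow> f i j k l = g i j k l) \<Longrightarrow> S4 n f = S4 n g"
  unfolding S4_def by (intro sum.cong refl) auto

lemma S4_mono: "(\<And>i j k l. f i j k l \<le> g i j k l) \<Longrightarrow> S4 n f \<le> S4 n g"
  unfolding S4_def by (intro sum_mono) auto

lemma S4_add: "S4 n (\<lambda>i j k l. f i j k l + g i j k l) = S4 n f + S4 n g"
  by (simp add: S4_def sum.distrib)

lemma S4_diff: "S4 n (\<lambda>i j k l. f i j k l - g i j k l) = S4 n f - S4 n g"
  by (simp add: S4_def sum_subtractf)

lemma S4_mult: "S4 n (\<lambda>i j k l. c * f i j k l) = c * S4 n f"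
  by (simp add: S4_def sum_distrib_left)

lemma S4_swap_kl: "S4 n f = S4 n (\<lambda>i j k l. f i j l k)"
  unfolding S4_def by (rule sum.cong[OF refl], rule sum.cong[OF refl], rule sum.swap)

lemma S4_swap_ij: "S4 n f = S4 n (\<lambda>i j k l. f j i k l)"
  unfolding S4_def by (rule sum.swap)

lemma S4_transpose: "S4 n f = S4 n (\<lambda>i j k l. f k l i j)"
proof -
  have "S4 n f = (\<Sum>i\<in>{1..n}. \<Sum>k\<in>{1..n}. \<Sum>j\<in>{1..n}. \<Sum>l\<in>{1..n}. f i j k l)"
    unfolding S4_def by (rule sum.cong[OF refl]) (rule sum.swap)
  also have "\<dots> = (\<Sum>k\<in>{1..n}. \<Sum>i\<in>{1..n}. \<Sum>l\<in>{1..n}. \<Sum>j\<in>{1..n}. f i j k l)"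
    by (subst sum.swap, rule sum.cong[OF refl], rule sum.cong[OF refl], rule sum.swap)
  also have "\<dots> = (\<Sum>k\<in>{1..n}. \<Sum>l\<in>{1..n}. \<Sum>i\<in>{1..n}. \<Sum>j\<in>{1..n}. f i j k l)"
    by (rule sum.cong[OF refl]) (rule sum.swap)
  finally show ?thesis by (simp add: S4_def)
qed

lemma qform_pairs_eq_S4:
  "qform ({1..n} \<times> {1..n}) M (\<lambda>(i, j). P i j) = S4 n (\<lambda>i j k l. P i j * M (i, j) (k, l) * P k l)"
  unfolding qform_def S4_def sum.cartesian_product' by simp

text \<open>\<open>P\<close> holds the coefficients of the degree-2 part. Those at non-edges can be
  set to 0, since the moment matrix vanishes in their rows and columns; on the support of
  \<open>P\<close> the edge indicator of the pair itself is constant.\<close>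

locale edge_weights =
  fixes n :: nat and G :: "nat set set" and P :: "nat \<Rightarrow> nat \<Rightarrow> real"
  assumes P_sym: "P i j = P j i"
    and P_supp: "P i j \<noteq> 0 \<Longrightarrow> sgn_adj G i j = 1"
begin

abbreviation "A \<equiv> sgn_adj G"
abbreviation "Y \<equiv> common_sign n G"

definition "r i = (\<Sum>j\<in>{1..n}. P i j)"
definition "q i = (\<Sum>k\<in>{1..n}. \<Sum>l\<in>{1..n}. A i k * A i l * P k l)"
definition "nP = (\<Sum>i\<in>{1..n}. \<Sum>j\<in>{1..n}. (P i j)\<^sup>2)"
definition "dis i j k l = (of_bool (distinct [i, j, k, l]) :: real)"

lemma P_self [simp]: "P i i = 0"
  using P_supp[of i i] by auto

lemma nP_nonneg: "nP \<ge> 0"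
  unfolding nP_def by (intro sum_nonneg) auto

lemma nP_eq: "(\<Sum>a\<in>{1..n} \<times> {1..n}. ((\<lambda>(i, j). P i j) a)\<^sup>2) = nP"
  unfolding nP_def sum.cartesian_product' by simp

lemma Y_swap_ij: "Y j i k l = Y i j k l" and Y_swap_kl: "Y i j l k = Y i j k l"
  by (simp_all add: common_sign_def mult_ac)

lemma dis_swap: "dis j i k l = dis i j k l" "dis i j l k = dis i j k l"
  by (auto simp: dis_def)

text \<open>As \<open>P\<close> vanishes on the diagonal, a repeated index is shared between {i, j}
  and {k, l}. The four such coincidences are equal by symmetry, and each is bounded by
  Cauchy-Schwarz on the row sums of |P|.\<close>

lemma overlap_abs_le:
  "S4 n (\<lambda>i j k l. of_bool (\<not> distinct [i, j, k, l]) * (\<bar>P i j\<bar> * \<bar>P k l\<bar>)) \<le> 4 * (real n * nP)"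
proof -
  let ?f = "\<lambda>i j k l. of_bool (j = l) * (\<bar>P i j\<bar> * \<bar>P k l\<bar>)"
  have 1: "S4 n ?f \<le> real n * nP"
  proof -
    have "S4 n ?f = (\<Sum>i\<in>{1..n}. \<Sum>j\<in>{1..n}. \<Sum>k\<in>{1..n}. \<bar>P i j\<bar> * \<bar>P k j\<bar>)"
      unfolding S4_def by (intro sum.cong refl) (simp add: of_bool_def if_distrib[of "\<lambda>x. x * _"] cong: if_cong)
    also have "\<dots> = (\<Sum>j\<in>{1..n}. \<Sum>i\<in>{1..n}. \<Sum>k\<in>{1..n}. \<bar>P i j\<bar> * \<bar>P k j\<bar>)"
      by (rule sum.swap)
    also have "\<dots> = (\<Sum>j\<in>{1..n}. (\<Sum>i\<in>{1..n}. \<bar>P i j\<bar>)\<^sup>2)"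
      by (simp add: power2_eq_square sum_product)
    also have "\<dots> \<le> (\<Sum>j\<in>{1..n}. real n * (\<Sum>i\<in>{1..n}. (P i j)\<^sup>2))"
      using sum_squared_le_sum_of_squares[of "\<lambda>i. \<bar>P i _\<bar>" "{1..n}"]
      by (intro sum_mono) (auto simp: mult.commute)
    also have "\<dots> = real n * nP"
      unfolding nP_def sum_distrib_left by (rule sum.swap)
    finally show ?thesis .
  qed
  have 2: "S4 n (\<lambda>i j k l. of_bool (j = k) * (\<bar>P i j\<bar> * \<bar>P k l\<bar>)) = S4 n ?f"
    by (subst S4_swap_kl) (simp add: P_sym)
  have 3: "S4 n (\<lambda>i j k l. of_bool (i = l) * (\<bar>P i j\<bar> * \<bar>P k l\<bar>)) = S4 n ?f"
    by (subst S4_swap_ij) (simp add: P_sym)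
  have 4: "S4 n (\<lambda>i j k l. of_bool (i = k) * (\<bar>P i j\<bar> * \<bar>P k l\<bar>)) = S4 n ?f"
    by (subst S4_swap_ij, subst S4_swap_kl) (simp add: P_sym)
  have "S4 n (\<lambda>i j k l. of_bool (\<not> distinct [i, j, k, l]) * (\<bar>P i j\<bar> * \<bar>P k l\<bar>))
    \<le> S4 n (\<lambda>i j k l. ?f i j k l + of_bool (j = k) * (\<bar>P i j\<bar> * \<bar>P k l\<bar>)
      + of_bool (i = l) * (\<bar>P i j\<bar> * \<bar>P k l\<bar>) + of_bool (i = k) * (\<bar>P i j\<bar> * \<bar>P k l\<bar>))"
    by (rule S4_mono) (auto simp: of_bool_def)
  also have "\<dots> = 4 * S4 n ?f"
    unfolding S4_add 2 3 4 by simp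
  finally show ?thesis using 1 by linarith
qed

lemma S4_PP: "S4 n (\<lambda>i j k l. P i j * P k l) = (\<Sum>i\<in>{1..n}. r i)\<^sup>2"
  unfolding S4_def r_def power2_eq_square by (simp only: flip: sum_distrib_left sum_distrib_right)

lemma S4_PPA: "S4 n (\<lambda>i j k l. P i j * P k l * A i k) = qform {1..n} A r"
proof -
  have "S4 n (\<lambda>i j k l. P i j * P k l * A i k)
    = (\<Sum>i\<in>{1..n}. \<Sum>k\<in>{1..n}. \<Sum>j\<in>{1..n}. \<Sum>l\<in>{1..n}. P i j * P k l * A i k)"
    unfolding S4_def by (rule sum.cong[OF refl]) (rule sum.swap)
  then show ?thesis
    by (simp add: qform_def r_def sum_distrib_left sum_distrib_right mult_ac)
qed

lemma S4_PPAA: "S4 n (\<lambda>i j k l. P i j * P k l * (A i k * A i l)) = (\<Sum>i\<in>{1..n}. r i * q i)"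
proof -
  have "S4 n (\<lambda>i j k l. P i j * P k l * (A i k * A i l)) = S4 n (\<lambda>i j k l. P i j * (A i k * A i l * P k l))"
    by (simp only: mult_ac)
  then show ?thesis
    unfolding S4_def r_def q_def by (simp only: flip: sum_distrib_left sum_distrib_right)
qed

text \<open>These are the terms without a perfect matching between {i, j} and {k, l}: the constant,
  four single signs, and four products of two signs sharing a vertex. The last kind yields the
  troublesome \<open>r i * q i\<close>.\<close>

lemma S4_base:
  "S4 n (\<lambda>i j k l. P i j * P k l * ((1 + A i k + A j l) * (1 + A i l + A j k)))
    = (\<Sum>i\<in>{1..n}. r i)\<^sup>2 + 4 * qform {1..n} A r + 4 * (\<Sum>i\<in>{1..n}. r i * q i)"
proof -
  have a1: "S4 n (\<lambda>i j k l. P i j * P k l * A i l) = qform {1..n} A r"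
    unfolding S4_PPA[symmetric] by (subst S4_swap_kl) (simp add: P_sym)
  have a2: "S4 n (\<lambda>i j k l. P i j * P k l * A j k) = qform {1..n} A r"
    unfolding S4_PPA[symmetric] by (subst S4_swap_ij) (simp add: P_sym)
  have a3: "S4 n (\<lambda>i j k l. P i j * P k l * A j l) = qform {1..n} A r"
    unfolding S4_PPA[symmetric] by (subst S4_swap_ij, subst S4_swap_kl) (simp add: P_sym)
  have b1: "S4 n (\<lambda>i j k l. P i j * P k l * (A j k * A j l)) = (\<Sum>i\<in>{1..n}. r i * q i)"
    unfolding S4_PPAA[symmetric] by (subst S4_swap_ij) (simp add: P_sym)
  have b2: "S4 n (\<lambda>i j k l. P i j * P k l * (A i k * A j k)) = (\<Sum>i\<in>{1..n}. r i * q i)"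
    unfolding S4_PPAA[symmetric] by (subst S4_transpose) (simp add: sgn_adj_commute mult_ac)
  have b3: "S4 n (\<lambda>i j k l. P i j * P k l * (A i l * A j l)) = (\<Sum>i\<in>{1..n}. r i * q i)"
    unfolding b2[symmetric] by (subst S4_swap_kl) (simp add: P_sym)
  have "S4 n (\<lambda>i j k l. P i j * P k l * ((1 + A i k + A j l) * (1 + A i l + A j k)))
    = S4 n (\<lambda>i j k l. P i j * P k l + P i j * P k l * A i k + P i j * P k l * A j l + P i j * P k l * A i l
        + P i j * P k l * A j k + P i j * P k l * (A i k * A i l) + P i j * P k l * (A i k * A j k)
        + P i j * P k l * (A i l * A j l) + P i j * P k l * (A j k * A j l))"
    by (simp add: algebra_simps)
  then show ?thesis
    unfolding S4_add S4_PP S4_PPA S4_PPAA a1 a2 a3 b1 b2 b3 by simp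
qed

text \<open>With a, b and c, d the signs of the two matchings, (1+a)(1+b)(1+c)(1+d) = (1+a+b)(1+c+d)
  + ab(1+c)(1+d) + cd(1+a+b). Exchanging k and l gives the last term the factor ab, so the last two
  terms form \<open>M4\<close>; the first is \<open>S4_base\<close> once distinctness is
  dropped.\<close>

lemma four_body_ge:
  assumes D: "\<bar>qform ({1..n} \<times> {1..n}) (M4 G) (\<lambda>(i, j). P i j)\<bar> \<le> D * nP"
  shows "S4 n (\<lambda>i j k l. dis i j k l * (P i j * P k l) * ((1 + A i k) * (1 + A j l) * (1 + A i l) * (1 + A j k)))
    \<ge> (\<Sum>i\<in>{1..n}. r i)\<^sup>2 + 4 * qform {1..n} A r + 4 * (\<Sum>i\<in>{1..n}. r i * q i) - (36 * real n + D) * nP"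
proof -
  let ?PP = "\<lambda>i j k l. P i j * P k l"
  let ?b = "\<lambda>i j k l. (1 + A i k + A j l) * (1 + A i l + A j k)"
  let ?f3 = "\<lambda>i j k l. dis i j k l * ?PP i j k l * (A i l * A j k * (1 + A i k + A j l))"
  have f3: "S4 n ?f3 = S4 n (\<lambda>i j k l. dis i j k l * ?PP i j k l * (A i k * A j l * (1 + A i l + A j k)))"
    by (subst S4_swap_kl) (simp add: P_sym dis_swap)
  have "S4 n (\<lambda>i j k l. dis i j k l * ?PP i j k l * ((1 + A i k) * (1 + A j l) * (1 + A i l) * (1 + A j k)))
    = S4 n (\<lambda>i j k l. dis i j k l * ?PP i j k l * ?b i j k l
        + dis i j k l * ?PP i j k l * (A i k * A j l * ((1 + A i l) * (1 + A j k))) + ?f3 i j k l)"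
    by (simp add: algebra_simps)
  also have "\<dots> = S4 n (\<lambda>i j k l. dis i j k l * ?PP i j k l * ?b i j k l)
      + S4 n (\<lambda>i j k l. dis i j k l * ?PP i j k l * (A i k * A j l * ((1 + A i l) * (1 + A j k)))
         + dis i j k l * ?PP i j k l * (A i k * A j l * (1 + A i l + A j k)))"
    unfolding S4_add f3 by simp
  also have "S4 n (\<lambda>i j k l. dis i j k l * ?PP i j k l * (A i k * A j l * ((1 + A i l) * (1 + A j k)))
         + dis i j k l * ?PP i j k l * (A i k * A j l * (1 + A i l + A j k)))
     = qform ({1..n} \<times> {1..n}) (M4 G) (\<lambda>(i, j). P i j)"
    unfolding qform_pairs_eq_S4 M4_def g4_def prod.case dis_def by (simp add: algebra_simps)
  finally have eq: "S4 n (\<lambda>i j k l. dis i j k l * ?PP i j k l * ((1 + A i k) * (1 + A j l) * (1 + A i l) * (1 + A j k)))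
    = S4 n (\<lambda>i j k l. dis i j k l * ?PP i j k l * ?b i j k l) + qform ({1..n} \<times> {1..n}) (M4 G) (\<lambda>(i, j). P i j)" .
  \<comment> \<open>Dropping distinctness costs this 9 times the 4n of
    \<open>overlap_abs_le\<close>, whence 36 n.\<close>
  have b9: "\<bar>?b i j k l\<bar> \<le> 9" for i j k l
  proof -
    have "\<bar>1 + A i k + A j l\<bar> \<le> 3" "\<bar>1 + A i l + A j k\<bar> \<le> 3"
      using abs_sgn_adj_le[of G i k] abs_sgn_adj_le[of G j l] abs_sgn_adj_le[of G i l] abs_sgn_adj_le[of G j k] by linarith+
    then have "\<bar>1 + A i k + A j l\<bar> * \<bar>1 + A i l + A j k\<bar> \<le> 3 * 3" by (intro mult_mono) auto
    then show ?thesis by (simp add: abs_mult)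
  qed
  have "S4 n (\<lambda>i j k l. ?PP i j k l * ?b i j k l) - S4 n (\<lambda>i j k l. dis i j k l * ?PP i j k l * ?b i j k l)
      = S4 n (\<lambda>i j k l. ?PP i j k l * ?b i j k l - dis i j k l * ?PP i j k l * ?b i j k l)"
    by (simp only: S4_diff)
  also have "\<dots> \<le> S4 n (\<lambda>i j k l. 9 * (of_bool (\<not> distinct [i, j, k, l]) * (\<bar>P i j\<bar> * \<bar>P k l\<bar>)))"
  proof (rule S4_mono)
    fix i j k l
    have "?PP i j k l * ?b i j k l \<le> \<bar>?PP i j k l\<bar> * \<bar>?b i j k l\<bar>"
      using abs_ge_self[of "?PP i j k l * ?b i j k l"] by (simp only: abs_mult)
    also have "\<dots> \<le> \<bar>?PP i j k l\<bar> * 9" by (intro mult_left_mono b9) simp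
    finally show "?PP i j k l * ?b i j k l - dis i j k l * ?PP i j k l * ?b i j k l
      \<le> 9 * (of_bool (\<not> distinct [i, j, k, l]) * (\<bar>P i j\<bar> * \<bar>P k l\<bar>))"
      unfolding dis_def by (cases "distinct [i, j, k, l]") (simp_all only: of_bool_eq abs_mult, simp_all)
  qed
  also have "\<dots> \<le> 9 * (4 * (real n * nP))"
    unfolding S4_mult by (intro mult_left_mono overlap_abs_le) simp
  finally have "S4 n (\<lambda>i j k l. dis i j k l * ?PP i j k l * ?b i j k l)
      \<ge> S4 n (\<lambda>i j k l. ?PP i j k l * ?b i j k l) - 36 * (real n * nP)" by simp
  moreover have "(36 * real n + D) * nP = 36 * (real n * nP) + D * nP" by (simp add: algebra_simps)
  ultimately show ?thesis
    unfolding eq S4_base using D by linarith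
qed

text \<open>For fixed u the summand factors into a part in i, j and the same part in k, l; the
  correction thus produces a sum of squares.\<close>

lemma S4_PPY: "S4 n (\<lambda>i j k l. P i j * P k l * Y i j k l) = (\<Sum>u\<in>{1..n}. (q u)\<^sup>2)"
proof -
  have "S4 n (\<lambda>i j k l. P i j * P k l * Y i j k l)
    = (\<Sum>i\<in>{1..n}. \<Sum>j\<in>{1..n}. \<Sum>u\<in>{1..n}. \<Sum>k\<in>{1..n}. \<Sum>l\<in>{1..n}. (A u i * A u j * P i j) * (A u k * A u l * P k l))"
  proof -
    have "(\<Sum>k\<in>{1..n}. \<Sum>l\<in>{1..n}. P i j * P k l * Y i j k l)
      = (\<Sum>u\<in>{1..n}. \<Sum>k\<in>{1..n}. \<Sum>l\<in>{1..n}. (A u i * A u j * P i j) * (A u k * A u l * P k l))" for i j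
    proof -
      have "(\<Sum>k\<in>{1..n}. \<Sum>l\<in>{1..n}. P i j * P k l * Y i j k l)
        = (\<Sum>k\<in>{1..n}. \<Sum>l\<in>{1..n}. \<Sum>u\<in>{1..n}. (A u i * A u j * P i j) * (A u k * A u l * P k l))"
        by (simp add: common_sign_def sum_distrib_left mult_ac)
      also have "\<dots> = (\<Sum>k\<in>{1..n}. \<Sum>u\<in>{1..n}. \<Sum>l\<in>{1..n}. (A u i * A u j * P i j) * (A u k * A u l * P k l))"
        by (rule sum.cong[OF refl]) (rule sum.swap)
      also have "\<dots> = (\<Sum>u\<in>{1..n}. \<Sum>k\<in>{1..n}. \<Sum>l\<in>{1..n}. (A u i * A u j * P i j) * (A u k * A u l * P k l))"
        by (rule sum.swap)
      finally show ?thesis .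
    qed
    then show ?thesis unfolding S4_def by simp
  qed
  also have "\<dots> = (\<Sum>i\<in>{1..n}. \<Sum>u\<in>{1..n}. \<Sum>j\<in>{1..n}. \<Sum>k\<in>{1..n}. \<Sum>l\<in>{1..n}. (A u i * A u j * P i j) * (A u k * A u l * P k l))"
    by (rule sum.cong[OF refl]) (rule sum.swap)
  also have "\<dots> = (\<Sum>u\<in>{1..n}. \<Sum>i\<in>{1..n}. \<Sum>j\<in>{1..n}. \<Sum>k\<in>{1..n}. \<Sum>l\<in>{1..n}. (A u i * A u j * P i j) * (A u k * A u l * P k l))"
    by (rule sum.swap)
  also have "\<dots> = (\<Sum>u\<in>{1..n}. (q u)\<^sup>2)"
    unfolding q_def power2_eq_square by (simp only: flip: sum_distrib_left sum_distrib_right)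
  finally show ?thesis .
qed

end

section \<open>Bilinear and operator bounds from quadratic forms\<close>

lemma bilinear_le_of_qform_le:
  fixes A :: "'i \<Rightarrow> 'i \<Rightarrow> real"
  assumes sym: "\<And>a b. A a b = A b a" and N: "\<And>x. \<bar>qform I A x\<bar> \<le> N * (\<Sum>a\<in>I. (x a)\<^sup>2)"
  shows "2 * \<bar>\<Sum>a\<in>I. \<Sum>b\<in>I. x a * A a b * y b\<bar> \<le> N * ((\<Sum>a\<in>I. (x a)\<^sup>2) + (\<Sum>a\<in>I. (y a)\<^sup>2))"
proof -
  let ?B = "\<lambda>x y. \<Sum>a\<in>I. \<Sum>b\<in>I. x a * A a b * y b"
  have sw: "?B y x = ?B x y" for x y
    by (subst sum.swap) (intro sum.cong refl, simp add: sym mult_ac)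
  have plus: "qform I A (\<lambda>a. x a + y a) = ?B x x + ?B x y + ?B y x + ?B y y"
    by (simp add: qform_def algebra_simps sum.distrib)
  have minus: "qform I A (\<lambda>a. x a - y a) = ?B x x - ?B x y - ?B y x + ?B y y"
    by (simp add: qform_def algebra_simps sum.distrib sum_subtractf)
  have sq: "(\<Sum>a\<in>I. (x a + y a)\<^sup>2) + (\<Sum>a\<in>I. (x a - y a)\<^sup>2) = 2 * ((\<Sum>a\<in>I. (x a)\<^sup>2) + (\<Sum>a\<in>I. (y a)\<^sup>2))"
    by (simp add: power2_eq_square algebra_simps sum.distrib sum_subtractf sum_distrib_left)
  have "4 * \<bar>?B x y\<bar> \<le> \<bar>qform I A (\<lambda>a. x a + y a)\<bar> + \<bar>qform I A (\<lambda>a. x a - y a)\<bar>"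
    unfolding plus minus sw[of y x] by linarith
  also have "\<dots> \<le> N * (\<Sum>a\<in>I. (x a + y a)\<^sup>2) + N * (\<Sum>a\<in>I. (x a - y a)\<^sup>2)"
    by (intro add_mono N)
  also have "\<dots> = 2 * (N * ((\<Sum>a\<in>I. (x a)\<^sup>2) + (\<Sum>a\<in>I. (y a)\<^sup>2)))"
    unfolding distrib_left[symmetric] sq by simp
  finally show ?thesis by simp
qed

text \<open>The left vector is chosen as A x, divided by N so that the two squared lengths
  balance.\<close>

lemma operator_norm_le_of_qform_le:
  fixes A :: "'i \<Rightarrow> 'i \<Rightarrow> real"
  assumes sym: "\<And>a b. A a b = A b a" and N: "\<And>x. \<bar>qform I A x\<bar> \<le> N * (\<Sum>a\<in>I. (x a)\<^sup>2)" and "N > 0"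
  shows "(\<Sum>a\<in>I. (\<Sum>b\<in>I. A a b * x b)\<^sup>2) \<le> N\<^sup>2 * (\<Sum>a\<in>I. (x a)\<^sup>2)"
proof -
  define z where "z a = (\<Sum>b\<in>I. A a b * x b)" for a
  let ?Z = "\<Sum>a\<in>I. (z a)\<^sup>2" and ?X = "\<Sum>a\<in>I. (x a)\<^sup>2"
  have "(\<Sum>a\<in>I. \<Sum>b\<in>I. z a / N * A a b * x b) = (\<Sum>a\<in>I. z a / N * z a)"
    by (simp add: z_def sum_distrib_left mult.assoc)
  also have "\<dots> = ?Z / N" by (simp add: power2_eq_square sum_divide_distrib)
  finally have "2 * \<bar>?Z / N\<bar> \<le> N * ((\<Sum>a\<in>I. (z a / N)\<^sup>2) + ?X)"
    using bilinear_le_of_qform_le[OF sym N, of "\<lambda>a. z a / N" x] by simp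
  also have "(\<Sum>a\<in>I. (z a / N)\<^sup>2) = ?Z / N\<^sup>2" by (simp add: power_divide sum_divide_distrib)
  finally have "2 * (?Z / N) \<le> ?Z / N + N * ?X"
    using \<open>N > 0\<close> by (simp add: sum_nonneg power2_eq_square field_simps)
  then have "?Z / N \<le> N * ?X" by simp
  then show ?thesis
    unfolding z_def[symmetric] using \<open>N > 0\<close> by (simp add: power2_eq_square field_simps)
qed

context edge_weights
begin

text \<open>At j = l the sign A u j enters squared, hence harmlessly. What remains is the sum of the
  squared entries of A P, bounded column by column through the norm of A.\<close>

lemma S4_PPY_overlap_le:
  assumes N: "\<And>x. \<bar>qform {1..n} A x\<bar> \<le> N * (\<Sum>a\<in>{1..n}. (x a)\<^sup>2)" and "N > 0"
  shows "S4 n (\<lambda>i j k l. of_bool (j = l) * (P i j * P k l * Y i j k l)) \<le> N\<^sup>2 * nP"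
proof -
  have "S4 n (\<lambda>i j k l. of_bool (j = l) * (P i j * P k l * Y i j k l))
     = (\<Sum>i\<in>{1..n}. \<Sum>j\<in>{1..n}. \<Sum>k\<in>{1..n}. P i j * P k j * Y i j k j)"
    unfolding S4_def by (intro sum.cong refl) (simp add: of_bool_def if_distrib[of "\<lambda>x. x * _"] cong: if_cong)
  also have "\<dots> = (\<Sum>j\<in>{1..n}. \<Sum>i\<in>{1..n}. \<Sum>k\<in>{1..n}. P i j * P k j * Y i j k j)"
    by (rule sum.swap)
  also have "\<dots> = (\<Sum>j\<in>{1..n}. \<Sum>u\<in>{1..n}. (A u j)\<^sup>2 * (\<Sum>i\<in>{1..n}. A u i * P i j)\<^sup>2)"
  proof (rule sum.cong[OF refl])
    fix j
    have "(\<Sum>i\<in>{1..n}. \<Sum>k\<in>{1..n}. P i j * P k j * Y i j k j)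
       = (\<Sum>i\<in>{1..n}. \<Sum>k\<in>{1..n}. \<Sum>u\<in>{1..n}. (A u j)\<^sup>2 * ((A u i * P i j) * (A u k * P k j)))"
      unfolding common_sign_def sum_distrib_left by (intro sum.cong refl) (simp add: power2_eq_square mult_ac)
    also have "\<dots> = (\<Sum>i\<in>{1..n}. \<Sum>u\<in>{1..n}. \<Sum>k\<in>{1..n}. (A u j)\<^sup>2 * ((A u i * P i j) * (A u k * P k j)))"
      by (rule sum.cong[OF refl]) (rule sum.swap)
    also have "\<dots> = (\<Sum>u\<in>{1..n}. \<Sum>i\<in>{1..n}. \<Sum>k\<in>{1..n}. (A u j)\<^sup>2 * ((A u i * P i j) * (A u k * P k j)))"
      by (rule sum.swap)
    also have "\<dots> = (\<Sum>u\<in>{1..n}. (A u j)\<^sup>2 * (\<Sum>i\<in>{1..n}. A u i * P i j)\<^sup>2)"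
      unfolding power2_eq_square[of "\<Sum>i\<in>{1..n}. A _ i * P i j"]
      by (simp only: flip: sum_distrib_left sum_distrib_right)
    finally show "(\<Sum>i\<in>{1..n}. \<Sum>k\<in>{1..n}. P i j * P k j * Y i j k j)
      = (\<Sum>u\<in>{1..n}. (A u j)\<^sup>2 * (\<Sum>i\<in>{1..n}. A u i * P i j)\<^sup>2)" .
  qed
  also have "\<dots> \<le> (\<Sum>j\<in>{1..n}. \<Sum>u\<in>{1..n}. 1 * (\<Sum>i\<in>{1..n}. A u i * P i j)\<^sup>2)"
    by (intro sum_mono mult_right_mono) (auto simp: abs_square_le_1)
  also have "\<dots> \<le> (\<Sum>j\<in>{1..n}. N\<^sup>2 * (\<Sum>i\<in>{1..n}. (P i j)\<^sup>2))"
    unfolding mult_1 by (intro sum_mono operator_norm_le_of_qform_le[OF sgn_adj_commute N \<open>N > 0\<close>])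
  also have "\<dots> = N\<^sup>2 * nP"
    unfolding nP_def sum_distrib_left[symmetric] by (subst sum.swap) simp
  finally show ?thesis .
qed

lemma S4_PPY_diag_nonneg:
  "S4 n (\<lambda>i j k l. of_bool (i = k \<and> j = l) * (P i j * P k l * Y i j k l)) \<ge> 0"
proof -
  have "0 \<le> of_bool (i = k \<and> j = l) * (P i j * P k l * Y i j k l)" for i j k l
  proof (cases "i = k \<and> j = l")
    case True
    have "Y i j i j = (\<Sum>u\<in>{1..n}. (A u i * A u j)\<^sup>2)"
      by (simp add: common_sign_def power2_eq_square mult_ac)
    then have "Y i j i j \<ge> 0" by (simp add: sum_nonneg)
    with True show ?thesis by simp
  qed auto
  then show ?thesis unfolding S4_def by (intro sum_nonneg)
qed

text \<open>Signs are peeled off one at a time: the product is 1 + a(1+b)(1+c)(1+d) + b(1+c)(1+d) +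
  c(1+d) + d. Relabelling makes A i k the leading sign of all four remainders, which add up to
  \<open>M5\<close>; the term 1 leaves the sum of the \<open>(q u)\<^sup>2\<close> up to
  overlaps.\<close>

lemma five_body_ge:
  assumes N: "\<And>x. \<bar>qform {1..n} A x\<bar> \<le> N * (\<Sum>a\<in>{1..n}. (x a)\<^sup>2)" and "N > 0"
    and D: "\<bar>qform ({1..n} \<times> {1..n}) (M5 n G) (\<lambda>(i, j). P i j)\<bar> \<le> D * nP"
  shows "S4 n (\<lambda>i j k l. dis i j k l * (P i j * P k l) * (((1 + A i k) * (1 + A j l) * (1 + A i l) * (1 + A j k)) * Y i j k l))
    \<ge> (\<Sum>u\<in>{1..n}. (q u)\<^sup>2) - (4 * N\<^sup>2 + D) * nP"
proof -
  let ?W = "\<lambda>i j k l. P i j * P k l * Y i j k l"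
  let ?dW = "\<lambda>i j k l. dis i j k l * ?W i j k l"
  let ?f1 = "\<lambda>i j k l. ?dW i j k l * (A i k * ((1 + A j l) * (1 + A i l) * (1 + A j k)))"
  let ?f2 = "\<lambda>i j k l. ?dW i j k l * (A j l * ((1 + A i l) * (1 + A j k)))"
  let ?f3 = "\<lambda>i j k l. ?dW i j k l * (A i l * (1 + A j k))"
  let ?f4 = "\<lambda>i j k l. ?dW i j k l * A j k"
  note symm = P_sym dis_swap Y_swap_ij Y_swap_kl
  have f2: "S4 n ?f2 = S4 n (\<lambda>i j k l. ?dW i j k l * (A i k * ((1 + A i l) * (1 + A j k))))"
    by (subst S4_swap_ij, subst S4_swap_kl) (simp add: symm mult_ac)
  have f3: "S4 n ?f3 = S4 n (\<lambda>i j k l. ?dW i j k l * (A i k * (1 + A j l)))"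
    by (subst S4_swap_kl) (simp add: symm)
  have f4: "S4 n ?f4 = S4 n (\<lambda>i j k l. ?dW i j k l * A i k)"
    by (subst S4_swap_ij) (simp add: symm)
  have "S4 n (\<lambda>i j k l. dis i j k l * (P i j * P k l) * (((1 + A i k) * (1 + A j l) * (1 + A i l) * (1 + A j k)) * Y i j k l))
    = S4 n (\<lambda>i j k l. ?dW i j k l + ?f1 i j k l + ?f2 i j k l + ?f3 i j k l + ?f4 i j k l)"
    by (rule S4_cong) (simp add: algebra_simps)
  also have "\<dots> = S4 n ?dW + S4 n (\<lambda>i j k l. ?f1 i j k l + ?dW i j k l * (A i k * ((1 + A i l) * (1 + A j k)))
      + ?dW i j k l * (A i k * (1 + A j l)) + ?dW i j k l * A i k)"
    unfolding S4_add f2 f3 f4 by simp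
  also have "S4 n (\<lambda>i j k l. ?f1 i j k l + ?dW i j k l * (A i k * ((1 + A i l) * (1 + A j k)))
      + ?dW i j k l * (A i k * (1 + A j l)) + ?dW i j k l * A i k)
    = qform ({1..n} \<times> {1..n}) (M5 n G) (\<lambda>(i, j). P i j)"
    unfolding qform_pairs_eq_S4 M5_def g5_def prod.case dis_def by (rule S4_cong) (simp add: algebra_simps)
  finally have eq: "S4 n (\<lambda>i j k l. dis i j k l * (P i j * P k l) * (((1 + A i k) * (1 + A j l) * (1 + A i l) * (1 + A j k)) * Y i j k l))
    = S4 n ?dW + qform ({1..n} \<times> {1..n}) (M5 n G) (\<lambda>(i, j). P i j)" .
  let ?o1 = "\<lambda>i j k l. of_bool (i = k) * ?W i j k l" and ?o2 = "\<lambda>i j k l. of_bool (i = l) * ?W i j k l"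
  let ?o3 = "\<lambda>i j k l. of_bool (j = k) * ?W i j k l" and ?o4 = "\<lambda>i j k l. of_bool (j = l) * ?W i j k l"
  let ?o5 = "\<lambda>i j k l. of_bool (i = k \<and> j = l) * ?W i j k l" and ?o6 = "\<lambda>i j k l. of_bool (i = l \<and> j = k) * ?W i j k l"
  have o1: "S4 n ?o1 = S4 n ?o4" by (subst S4_swap_ij, subst S4_swap_kl) (simp add: symm)
  have o2: "S4 n ?o2 = S4 n ?o4" by (subst S4_swap_ij) (simp add: symm)
  have o3: "S4 n ?o3 = S4 n ?o4" by (subst S4_swap_kl) (simp add: symm)
  have o6: "S4 n ?o6 = S4 n ?o5" by (subst S4_swap_kl) (simp add: symm)
  \<comment> \<open>Inclusion-exclusion over the four coincidences: given i \<noteq> j and k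
    \<noteq> l, only two pairs of them are compatible. The double coincidences enter with a plus
    sign and are non-negative, so a lower bound may drop them.\<close>
  have "S4 n ?dW = S4 n (\<lambda>i j k l. ?W i j k l - ?o1 i j k l - ?o2 i j k l - ?o3 i j k l - ?o4 i j k l + ?o5 i j k l + ?o6 i j k l)"
  proof (rule S4_cong)
    fix i j k l
    show "?dW i j k l = ?W i j k l - ?o1 i j k l - ?o2 i j k l - ?o3 i j k l - ?o4 i j k l + ?o5 i j k l + ?o6 i j k l"
    proof (cases "i = j \<or> k = l")
      case False
      then show ?thesis unfolding dis_def
        by (cases "i = k"; cases "i = l"; cases "j = k"; cases "j = l") auto
    next
      case True
      then have "?W i j k l = 0" by auto
      then show ?thesis by (simp only: mult_zero_right diff_self add_0)
    qed
  qed
  also have "\<dots> = S4 n ?W - 4 * S4 n ?o4 + 2 * S4 n ?o5"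
    unfolding S4_add S4_diff o1 o2 o3 o6 by simp
  also have "\<dots> \<ge> (\<Sum>u\<in>{1..n}. (q u)\<^sup>2) - 4 * (N\<^sup>2 * nP)"
    using S4_PPY_overlap_le[OF N \<open>N > 0\<close>] S4_PPY_diag_nonneg unfolding S4_PPY by linarith
  finally have "S4 n ?dW \<ge> (\<Sum>u\<in>{1..n}. (q u)\<^sup>2) - 4 * (N\<^sup>2 * nP)" .
  moreover have "(4 * N\<^sup>2 + D) * nP = 4 * (N\<^sup>2 * nP) + D * nP" by (simp add: algebra_simps)
  ultimately show ?thesis unfolding eq using D by linarith
qed

text \<open>Collects the pairs of edges with exactly one common vertex, here i, where moments of
  triples act.\<close>

definition "Z = (\<Sum>i\<in>{1..n}. \<Sum>j\<in>{1..n}. \<Sum>l\<in>{1..n}. of_bool (j \<noteq> l) * (P i j * P i l * (1 + A j l)))"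

text \<open>For fixed i the double sum is \<open>(r i)\<^sup>2\<close> minus its diagonal plus the
  form of A at the i-th row of \<open>P\<close>. This is the origin of the positive
  \<open>\<Sum> r\<^sub>i\<^sup>2\<close>.\<close>

lemma Z_ge:
  assumes N: "\<And>x. \<bar>qform {1..n} A x\<bar> \<le> N * (\<Sum>a\<in>{1..n}. (x a)\<^sup>2)"
  shows "Z \<ge> (\<Sum>i\<in>{1..n}. (r i)\<^sup>2) - (1 + N) * nP"
proof -
  have "(\<Sum>j\<in>{1..n}. \<Sum>l\<in>{1..n}. of_bool (j \<noteq> l) * (P i j * P i l * (1 + A j l)))
     \<ge> (r i)\<^sup>2 - (1 + N) * (\<Sum>j\<in>{1..n}. (P i j)\<^sup>2)" for i
  proof -
    have "(\<Sum>j\<in>{1..n}. \<Sum>l\<in>{1..n}. of_bool (j \<noteq> l) * (P i j * P i l * (1 + A j l)))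
      = (\<Sum>j\<in>{1..n}. \<Sum>l\<in>{1..n}. P i j * P i l - of_bool (j = l) * (P i j)\<^sup>2 + P i j * A j l * P i l)"
      by (intro sum.cong refl) (auto simp: power2_eq_square algebra_simps)
    also have "\<dots> = (r i)\<^sup>2 - (\<Sum>j\<in>{1..n}. (P i j)\<^sup>2) + qform {1..n} A (P i)"
    proof -
      have "(\<Sum>j\<in>{1..n}. \<Sum>l\<in>{1..n}. of_bool (j = l) * (P i j)\<^sup>2) = (\<Sum>j\<in>{1..n}. (P i j)\<^sup>2)"
        by (intro sum.cong refl) (simp add: of_bool_def if_distrib[of "\<lambda>x. x * _"] cong: if_cong)
      then show ?thesis
        unfolding sum.distrib sum_subtractf qform_def r_def power2_eq_square sum_product by simp
    qed
    finally show ?thesis using N[of "P i"] by (simp add: algebra_simps)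
  qed
  then have "Z \<ge> (\<Sum>i\<in>{1..n}. (r i)\<^sup>2 - (1 + N) * (\<Sum>j\<in>{1..n}. (P i j)\<^sup>2))"
    unfolding Z_def by (intro sum_mono)
  then show ?thesis by (simp add: sum_subtractf nP_def flip: sum_distrib_left)
qed

end

section \<open>Pseudo-moments and feasibility\<close>

text \<open>The correction stands under the clique indicator, so the zero constraints survive it,
  and terms with u in \<open>U\<close> vanish through the diagonal sign. As the value depends on
  \<open>U\<close> alone, the constraint on equal unions is automatic.\<close>

definition moment :: "nat \<Rightarrow> nat set set \<Rightarrow> real \<Rightarrow> nat set \<Rightarrow> real" where
  "moment n G \<kappa> U = of_bool (clique G U) * (100 ^ (card U * (card U - 1) div 2) * \<kappa> ^ card U
     + of_bool (card U = 4) * (100 ^ 10 * \<kappa> ^ 5) * (\<Sum>u\<in>{1..n}. \<Prod>v\<in>U. sgn_adj G u v))"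

lemma clique_empty [simp]: "clique G {}"
  by (simp add: clique_def)

lemma clique_insert: "clique G (insert x S) \<longleftrightarrow> clique G S \<and> (\<forall>y\<in>S. y \<noteq> x \<longrightarrow> {x, y} \<in> G)"
  by (auto simp: clique_def insert_commute)

lemma clique_subset: "clique G T \<Longrightarrow> S \<subseteq> T \<Longrightarrow> clique G S"
  by (auto simp: clique_def)

text \<open>Each edge indicator brings a factor 1/2; hence 50 = 100/2, 125000 = 100^3/8 and 64 = 2^6
  in the moments below.\<close>

lemma of_bool_edge: "i \<noteq> j \<Longrightarrow> of_bool ({i, j} \<in> G) = (1 + sgn_adj G i j) / 2"
  by (simp add: sgn_adj_def)

lemma moment_empty: "moment n G \<kappa> {} = 1"
  by (simp add: moment_def)

lemma moment_single: "moment n G \<kappa> {i} = \<kappa>"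
  by (simp add: moment_def clique_insert)

lemma moment_pair: "i \<noteq> j \<Longrightarrow> moment n G \<kappa> {i, j} = 50 * \<kappa>\<^sup>2 * (1 + sgn_adj G i j)"
  by (simp add: moment_def clique_insert of_bool_edge power2_eq_square)

lemma moment_triple:
  assumes "distinct [i, j, k]"
  shows "moment n G \<kappa> {i, j, k}
    = 125000 * \<kappa> ^ 3 * ((1 + sgn_adj G i j) * (1 + sgn_adj G i k) * (1 + sgn_adj G j k))"
proof -
  have "of_bool (clique G {i, j, k}) = of_bool ({i, j} \<in> G) * of_bool ({i, k} \<in> G) * (of_bool ({j, k} \<in> G) :: real)"
    using assms by (auto simp: clique_insert)
  also have "\<dots> = (1 + sgn_adj G i j) / 2 * ((1 + sgn_adj G i k) / 2) * ((1 + sgn_adj G j k) / 2)"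
    using assms by (simp add: of_bool_edge)
  finally have cl: "of_bool (clique G {i, j, k}) = (1 + sgn_adj G i j) / 2 * ((1 + sgn_adj G i k) / 2) * ((1 + sgn_adj G j k) / 2)" .
  have "card {i, j, k} = 3" using assms by simp
  then show ?thesis unfolding moment_def cl by simp
qed

lemma moment_quadruple:
  assumes "distinct [i, j, k, l]"
  shows "moment n G \<kappa> {i, j, k, l}
    = (1 + sgn_adj G i j) * (1 + sgn_adj G k l) / 64 *
      ((1 + sgn_adj G i k) * (1 + sgn_adj G j l) * (1 + sgn_adj G i l) * (1 + sgn_adj G j k)) *
      (100 ^ 6 * \<kappa> ^ 4 + 100 ^ 10 * \<kappa> ^ 5 * common_sign n G i j k l)"
proof -
  have "of_bool (clique G {i, j, k, l}) = of_bool ({i, j} \<in> G) * of_bool ({k, l} \<in> G) *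
      (of_bool ({i, k} \<in> G) * of_bool ({j, l} \<in> G) * of_bool ({i, l} \<in> G) * (of_bool ({j, k} \<in> G) :: real))"
    using assms by (auto simp: clique_insert)
  also have "\<dots> = (1 + sgn_adj G i j) / 2 * ((1 + sgn_adj G k l) / 2) *
      ((1 + sgn_adj G i k) / 2 * ((1 + sgn_adj G j l) / 2) * ((1 + sgn_adj G i l) / 2) * ((1 + sgn_adj G j k) / 2))"
    using assms by (simp add: of_bool_edge)
  finally have cl: "of_bool (clique G {i, j, k, l}) = (1 + sgn_adj G i j) * (1 + sgn_adj G k l) / 64 *
      ((1 + sgn_adj G i k) * (1 + sgn_adj G j l) * (1 + sgn_adj G i l) * (1 + sgn_adj G j k))"
    by simp
  have c: "card {i, j, k, l} = 4" using assms by simp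
  have s: "(\<Sum>u\<in>{1..n}. \<Prod>v\<in>{i, j, k, l}. sgn_adj G u v) = common_sign n G i j k l"
    unfolding common_sign_def using assms by (intro sum.cong refl) (simp add: mult_ac)
  have e: "of_bool ((4::nat) = 4) = (1::real)" "(4::nat) * (4 - 1) div 2 = 6" by simp_all
  show ?thesis unfolding moment_def cl c s e by simp
qed

lemma sum_of_bool_eq: "finite A \<Longrightarrow> (\<Sum>k\<in>A. of_bool (i = k) * f k) = (if i \<in> A then f i else (0::real))"
  by (simp add: of_bool_def if_distrib[of "\<lambda>x. x * _"] cong: if_cong)

context edge_weights
begin

lemma P_mult_A_cases: "P i j = 0 \<or> (i \<noteq> j \<and> A i j = 1 \<and> A j i = 1)"
  using P_supp[of i j] sgn_adj_commute[of G i j] by (cases "P i j = 0") auto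

lemma sum_pair_moments:
  "(\<Sum>k\<in>{1..n}. \<Sum>l\<in>{1..n}. moment n G \<kappa> {k, l} * P k l) = 100 * \<kappa>\<^sup>2 * (\<Sum>i\<in>{1..n}. r i)"
proof -
  have pt: "moment n G \<kappa> {k, l} * P k l = 100 * \<kappa>\<^sup>2 * P k l" for k l
    using P_mult_A_cases[of k l] by (auto simp: moment_pair)
  show ?thesis unfolding pt r_def sum_distrib_left ..
qed

lemma sum_single_single_moments:
  "(\<Sum>i\<in>{1..n}. \<Sum>k\<in>{1..n}. p i * (moment n G \<kappa> {i, k} * p k))
    = \<kappa> * (\<Sum>i\<in>{1..n}. (p i)\<^sup>2)
      + 50 * \<kappa>\<^sup>2 * ((\<Sum>i\<in>{1..n}. p i)\<^sup>2 - (\<Sum>i\<in>{1..n}. (p i)\<^sup>2) + qform {1..n} A p)"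
proof -
  have "p i * (moment n G \<kappa> {i, k} * p k) = (\<kappa> - 50 * \<kappa>\<^sup>2) * (of_bool (i = k) * (p k)\<^sup>2)
      + 50 * \<kappa>\<^sup>2 * (p i * p k + p i * A i k * p k)" for i k
    by (cases "i = k") (auto simp: moment_pair moment_single power2_eq_square algebra_simps)
  then have "(\<Sum>i\<in>{1..n}. \<Sum>k\<in>{1..n}. p i * (moment n G \<kappa> {i, k} * p k))
    = (\<kappa> - 50 * \<kappa>\<^sup>2) * (\<Sum>i\<in>{1..n}. \<Sum>k\<in>{1..n}. of_bool (i = k) * (p k)\<^sup>2)
      + 50 * \<kappa>\<^sup>2 * ((\<Sum>i\<in>{1..n}. \<Sum>k\<in>{1..n}. p i * p k) + qform {1..n} A p)"
    unfolding qform_def by (simp only: sum.distrib sum_distrib_left distrib_left)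
  moreover have "(\<Sum>i\<in>{1..n}. \<Sum>k\<in>{1..n}. of_bool (i = k) * (p k)\<^sup>2) = (\<Sum>i\<in>{1..n}. (p i)\<^sup>2)"
    by (intro sum.cong refl) (simp only: sum_of_bool_eq finite_atLeastAtMost if_True)
  moreover have "(\<Sum>i\<in>{1..n}. \<Sum>k\<in>{1..n}. p i * p k) = (\<Sum>i\<in>{1..n}. p i)\<^sup>2"
    by (simp add: power2_eq_square sum_product)
  ultimately show ?thesis by (simp add: algebra_simps)
qed

text \<open>If i is k or l, the union is a pair with moment 100 \<kappa>^2, where the formula for
  triples, with A i i = 0, would give 500000 \<kappa>^3. The coefficient of \<open>p i * r i\<close>
  makes up the difference.\<close>

lemma sum_single_pair_moments:
  "(\<Sum>i\<in>{1..n}. \<Sum>k\<in>{1..n}. \<Sum>l\<in>{1..n}. p i * (moment n G \<kappa> {i, k, l} * P k l))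
    = 2 * (100 * \<kappa>\<^sup>2 - 500000 * \<kappa> ^ 3) * (\<Sum>i\<in>{1..n}. p i * r i)
      + 250000 * \<kappa> ^ 3 * ((\<Sum>i\<in>{1..n}. p i) * (\<Sum>i\<in>{1..n}. r i)
         + 2 * (\<Sum>i\<in>{1..n}. \<Sum>k\<in>{1..n}. p i * A i k * r k) + (\<Sum>i\<in>{1..n}. p i * q i))"
proof -
  let ?V = "{1..n}" and ?c = "100 * \<kappa>\<^sup>2 - 500000 * \<kappa> ^ 3"
  have pt: "p i * (moment n G \<kappa> {i, k, l} * P k l) = ?c * (of_bool (i = k) * (p i * P k l)) + ?c * (of_bool (i = l) * (p i * P k l))
     + 250000 * \<kappa> ^ 3 * (p i * P k l + p i * A i k * P k l + p i * A i l * P k l + p i * (A i k * A i l * P k l))" for i k l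
  proof (cases "P k l = 0")
    case False
    then have kl: "k \<noteq> l" "A k l = 1" "A l k = 1" using P_mult_A_cases[of k l] by auto
    show ?thesis
    proof (cases "i = k \<or> i = l")
      case True
      then show ?thesis using kl by (auto simp: moment_pair insert_commute algebra_simps)
    next
      case False
      then have "distinct [i, k, l]" using kl by auto
      then show ?thesis using kl False by (auto simp: moment_triple algebra_simps)
    qed
  qed simp
  have 1: "(\<Sum>i\<in>?V. \<Sum>k\<in>?V. \<Sum>l\<in>?V. of_bool (i = k) * (p i * P k l)) = (\<Sum>i\<in>?V. p i * r i)"
    unfolding r_def sum_distrib_left[symmetric]
    by (intro sum.cong refl) (simp only: sum_of_bool_eq finite_atLeastAtMost if_True)
  have 2: "(\<Sum>i\<in>?V. \<Sum>k\<in>?V. \<Sum>l\<in>?V. of_bool (i = l) * (p i * P k l)) = (\<Sum>i\<in>?V. p i * r i)"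
    unfolding 1[symmetric]
    by (rule sum.cong[OF refl], subst sum.swap) (simp add: P_sym)
  have 3: "(\<Sum>i\<in>?V. \<Sum>k\<in>?V. \<Sum>l\<in>?V. p i * P k l) = (\<Sum>i\<in>?V. p i) * (\<Sum>i\<in>?V. r i)"
    unfolding r_def by (simp only: flip: sum_distrib_left sum_distrib_right)
  have 4: "(\<Sum>i\<in>?V. \<Sum>k\<in>?V. \<Sum>l\<in>?V. p i * A i k * P k l) = (\<Sum>i\<in>?V. \<Sum>k\<in>?V. p i * A i k * r k)"
    unfolding r_def by (simp only: flip: sum_distrib_left)
  have 5: "(\<Sum>i\<in>?V. \<Sum>k\<in>?V. \<Sum>l\<in>?V. p i * A i l * P k l) = (\<Sum>i\<in>?V. \<Sum>k\<in>?V. p i * A i k * r k)"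
    unfolding 4[symmetric]
    by (rule sum.cong[OF refl], subst sum.swap) (simp add: P_sym)
  have 6: "(\<Sum>i\<in>?V. \<Sum>k\<in>?V. \<Sum>l\<in>?V. p i * (A i k * A i l * P k l)) = (\<Sum>i\<in>?V. p i * q i)"
    unfolding q_def by (simp only: flip: sum_distrib_left)
  have "(\<Sum>i\<in>?V. \<Sum>k\<in>?V. \<Sum>l\<in>?V. p i * (moment n G \<kappa> {i, k, l} * P k l))
    = ?c * (\<Sum>i\<in>?V. p i * r i) + ?c * (\<Sum>i\<in>?V. p i * r i)
      + 250000 * \<kappa> ^ 3 * ((\<Sum>i\<in>?V. p i) * (\<Sum>i\<in>?V. r i) + (\<Sum>i\<in>?V. \<Sum>k\<in>?V. p i * A i k * r k)
        + (\<Sum>i\<in>?V. \<Sum>k\<in>?V. p i * A i k * r k) + (\<Sum>i\<in>?V. p i * q i))"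
    unfolding pt sum.distrib sum_distrib_left[symmetric, of "250000 * \<kappa> ^ 3"] sum_distrib_left[symmetric, of ?c] 1 2 3 4 5 6
    by simp
  then show ?thesis by (simp add: algebra_simps)
qed

text \<open>Sorted by the overlap of {i, j} and {k, l}: two common vertices in 2 arrangements; one
  in 4 arrangements, each with 125000 times 4 from the two edges known to be present; or none, where
  the known edges contribute 4 out of 64, whence 1/16.\<close>

lemma sum_pair_pair_moments:
  "S4 n (\<lambda>i j k l. P i j * (moment n G \<kappa> {i, j, k, l} * P k l))
    = 200 * \<kappa>\<^sup>2 * nP + 2 * 10 ^ 6 * \<kappa> ^ 3 * Z
      + 1 / 16 * S4 n (\<lambda>i j k l. dis i j k l * (P i j * P k l) * (((1 + A i k) * (1 + A j l) * (1 + A i l) * (1 + A j k))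
         * (100 ^ 6 * \<kappa> ^ 4 + 100 ^ 10 * \<kappa> ^ 5 * Y i j k l)))"
proof -
  let ?PP = "\<lambda>i j k l. P i j * P k l"
  let ?d1 = "\<lambda>i j k l. of_bool (i = k \<and> j = l) * ?PP i j k l" and ?d2 = "\<lambda>i j k l. of_bool (i = l \<and> j = k) * ?PP i j k l"
  let ?e1 = "\<lambda>i j k l. of_bool (i = k \<and> j \<noteq> l) * (?PP i j k l * (1 + A j l))"
  let ?e2 = "\<lambda>i j k l. of_bool (i = l \<and> j \<noteq> k) * (?PP i j k l * (1 + A j k))"
  let ?e3 = "\<lambda>i j k l. of_bool (j = k \<and> i \<noteq> l) * (?PP i j k l * (1 + A i l))"
  let ?e4 = "\<lambda>i j k l. of_bool (j = l \<and> i \<noteq> k) * (?PP i j k l * (1 + A i k))"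
  let ?F = "\<lambda>i j k l. dis i j k l * (P i j * P k l) * (((1 + A i k) * (1 + A j l) * (1 + A i l) * (1 + A j k))
         * (100 ^ 6 * \<kappa> ^ 4 + 100 ^ 10 * \<kappa> ^ 5 * Y i j k l))"
  have pt: "P i j * (moment n G \<kappa> {i, j, k, l} * P k l) = 100 * \<kappa>\<^sup>2 * (?d1 i j k l + ?d2 i j k l)
      + 500000 * \<kappa> ^ 3 * (?e1 i j k l + ?e2 i j k l + ?e3 i j k l + ?e4 i j k l) + 1 / 16 * ?F i j k l" for i j k l
  proof (cases "P i j = 0 \<or> P k l = 0")
    case True
    then show ?thesis by auto
  next
    case False
    then have ij: "i \<noteq> j" "A i j = 1" "A j i = 1" and kl: "k \<noteq> l" "A k l = 1" "A l k = 1"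
      using P_mult_A_cases[of i j] P_mult_A_cases[of k l] by auto
    show ?thesis
    proof (cases "distinct [i, j, k, l]")
      case True
      then have "P i j * (moment n G \<kappa> {i, j, k, l} * P k l) = 1 / 16 * ?F i j k l"
        unfolding moment_quadruple[OF True] ij kl dis_def by simp
      then show ?thesis using True by simp
    next
      case False
      then have d0: "dis i j k l = 0" by (simp add: dis_def)
      consider "i = k" "j = l" | "i = l" "j = k" | "i = k" "j \<noteq> l" | "i = l" "j \<noteq> k" | "j = k" "i \<noteq> l" | "j = l" "i \<noteq> k"
        using False ij(1) kl(1) by auto
      then show ?thesis
      proof cases
        case 1
        then have "{i, j, k, l} = {i, j}" by auto
        with 1 d0 ij kl show ?thesis by (simp add: moment_pair)
      next
        case 2
        then have "{i, j, k, l} = {i, j}" by auto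
        with 2 d0 ij kl show ?thesis by (simp add: moment_pair)
      next
        case 3
        then have s: "{i, j, k, l} = {i, j, l}" by auto
        have "distinct [i, j, l]" using 3 ij kl by auto
        then show ?thesis unfolding s using 3 d0 ij kl by (simp add: moment_triple)
      next
        case 4
        then have s: "{i, j, k, l} = {i, j, k}" by auto
        have "distinct [i, j, k]" using 4 ij kl by auto
        then show ?thesis unfolding s using 4 d0 ij kl by (simp add: moment_triple)
      next
        case 5
        then have s: "{i, j, k, l} = {i, j, l}" by auto
        have "distinct [i, j, l]" using 5 ij kl by auto
        then show ?thesis unfolding s using 5 d0 ij kl by (simp add: moment_triple)
      next
        case 6
        then have s: "{i, j, k, l} = {i, j, k}" by auto
        have "distinct [i, j, k]" using 6 ij kl by auto
        then show ?thesis unfolding s using 6 d0 ij kl by (simp add: moment_triple)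
      qed
    qed
  qed
  have d1: "S4 n ?d1 = nP"
  proof -
    have "S4 n ?d1 = (\<Sum>i\<in>{1..n}. \<Sum>j\<in>{1..n}. \<Sum>k\<in>{1..n}. of_bool (i = k) * (\<Sum>l\<in>{1..n}. of_bool (j = l) * ?PP i j k l))"
      unfolding S4_def sum_distrib_left by (intro sum.cong refl) (simp add: of_bool_conj)
    also have "\<dots> = nP"
      unfolding nP_def by (intro sum.cong refl) (simp only: sum_of_bool_eq finite_atLeastAtMost if_True power2_eq_square)
    finally show ?thesis .
  qed
  have d2: "S4 n ?d2 = nP" unfolding d1[symmetric] by (subst S4_swap_kl) (simp add: P_sym)
  have e1: "S4 n ?e1 = Z"
  proof -
    have "S4 n ?e1 = (\<Sum>i\<in>{1..n}. \<Sum>j\<in>{1..n}. \<Sum>k\<in>{1..n}. of_bool (i = k) * (\<Sum>l\<in>{1..n}. of_bool (j \<noteq> l) * (?PP i j k l * (1 + A j l))))"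
      unfolding S4_def sum_distrib_left by (intro sum.cong refl) (simp add: of_bool_conj)
    also have "\<dots> = Z"
      unfolding Z_def
      by (rule sum.cong[OF refl], rule sum.cong[OF refl]) (simp only: sum_of_bool_eq finite_atLeastAtMost if_True)
    finally show ?thesis .
  qed
  have e2: "S4 n ?e2 = Z" unfolding e1[symmetric] by (subst S4_swap_kl) (simp add: P_sym)
  have e3: "S4 n ?e3 = Z" unfolding e1[symmetric] by (subst S4_swap_ij) (simp add: P_sym)
  have e4: "S4 n ?e4 = Z" unfolding e1[symmetric] by (subst S4_swap_ij, subst S4_swap_kl) (simp add: P_sym)
  have "S4 n (\<lambda>i j k l. P i j * (moment n G \<kappa> {i, j, k, l} * P k l))
    = 100 * \<kappa>\<^sup>2 * (nP + nP) + 500000 * \<kappa> ^ 3 * (Z + Z + Z + Z) + 1 / 16 * S4 n ?F"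
    unfolding pt S4_add S4_mult d1 d2 e1 e2 e3 e4 ..
  then show ?thesis by simp
qed

end

section \<open>Numerical inequalities for the three parts of the form\<close>

lemma low_rank_part_nonneg:
  fixes \<kappa> p0 s t :: real
  shows "0 \<le> p0\<^sup>2 + 2 * \<kappa> * p0 * t + 100 * \<kappa>\<^sup>2 * p0 * s + 50 * \<kappa>\<^sup>2 * t\<^sup>2 + 250000 * \<kappa> ^ 3 * (t * s)
    + 10 ^ 12 * \<kappa> ^ 4 / 64 * s\<^sup>2"
proof -
  define T S where "T = \<kappa> * t" and "S = \<kappa>\<^sup>2 * s"
  \<comment> \<open>The first two squares use up half of p0^2 each and cost 2 T^2 and 5000 S^2; the
    third takes the remaining 48 T^2 and the whole T S term. What is left at S^2 is positive by a
    wide margin, the effect of the log-convex factors.\<close>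
  have "p0\<^sup>2 + 2 * \<kappa> * p0 * t + 100 * \<kappa>\<^sup>2 * p0 * s + 50 * \<kappa>\<^sup>2 * t\<^sup>2 + 250000 * \<kappa> ^ 3 * (t * s) + 10 ^ 12 * \<kappa> ^ 4 / 64 * s\<^sup>2
    = (p0 + 2 * T)\<^sup>2 / 2 + (p0 + 100 * S)\<^sup>2 / 2 + 48 * (T + 15625 / 6 * S)\<^sup>2
      + (10 ^ 12 / 64 - 5000 - 48 * (15625 / 6)\<^sup>2) * S\<^sup>2"
    unfolding T_def S_def by (simp add: power2_eq_square power3_eq_cube power4_eq_xxxx field_simps)
  also have "\<dots> \<ge> 0"
    by (intro add_nonneg_nonneg mult_nonneg_nonneg) (auto simp: power_divide)
  finally show ?thesis .
qed

lemma power5_eq_xxxxx: "x ^ 5 = x * x * x * x * (x :: real)"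
  by (simp add: eval_nat_numeral)

lemma powers_of_ten:
  "(10::real) ^ 6 = 1000000" "(10::real) ^ 12 = 1000000000000" "(10::real) ^ 20 = 100000000000000000000"
  by simp_all

text \<open>After division by \<kappa> this is a form in p, \<kappa> r, \<kappa>^2 q with squares
  \<open>np\<close>, \<open>R\<close>, \<open>Q\<close>. The genuine cross terms are
  \<open>x1\<close>, \<open>x2\<close>, \<open>x3\<close>; the terms \<open>a1\<close>,
  \<open>a2\<close>, \<open>a3\<close>, \<open>u1\<close>, \<open>u2\<close> carry a further
  \<kappa> or \<kappa> N and are negligible.\<close>

lemma vector_part_nonneg:
  fixes \<kappa> N np nr nq pr pq rq pAp pAr rAr :: real
  assumes \<kappa>: "0 < \<kappa>" "\<kappa> \<le> 1 / 10 ^ 20" and N: "0 < N" "\<kappa> * N \<le> 1 / 10 ^ 20"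
    and nn: "0 \<le> np" "0 \<le> nr" "0 \<le> nq"
    and pr: "\<bar>\<kappa> * pr\<bar> \<le> np / 1600 + 400 * (\<kappa>\<^sup>2 * nr)"
    and pq: "\<bar>\<kappa>\<^sup>2 * pq\<bar> \<le> np / (2 * 10 ^ 6) + 10 ^ 6 / 2 * (\<kappa> ^ 4 * nq)"
    and rq: "\<bar>\<kappa> ^ 3 * rq\<bar> \<le> (\<kappa>\<^sup>2 * nr) / 10 ^ 6 + 10 ^ 6 / 4 * (\<kappa> ^ 4 * nq)"
    and pAp: "\<bar>pAp\<bar> \<le> N * np" and pAr: "2 * \<bar>\<kappa> * pAr\<bar> \<le> N * (np + \<kappa>\<^sup>2 * nr)" and rAr: "\<bar>rAr\<bar> \<le> N * nr"
  shows "0 \<le> \<kappa> * np + 50 * \<kappa>\<^sup>2 * (pAp - np) + 2 * (100 * \<kappa>\<^sup>2 - 500000 * \<kappa> ^ 3) * pr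
     + 250000 * \<kappa> ^ 3 * (2 * pAr + pq) + 500000 * \<kappa> ^ 3 * nr + 10 ^ 12 * \<kappa> ^ 4 / 16 * (rAr + rq)
     + 10 ^ 20 * \<kappa> ^ 5 / 64 * nq"
proof -
  define R Q x1 x2 x3 where "R = \<kappa>\<^sup>2 * nr" and "Q = \<kappa> ^ 4 * nq" and "x1 = \<kappa> * pr" and "x2 = \<kappa>\<^sup>2 * pq" and "x3 = \<kappa> ^ 3 * rq"
  define a1 a2 a3 u1 u2 where "a1 = \<kappa> * pAp" and "a2 = \<kappa> * (\<kappa> * pAr)" and "a3 = \<kappa> * (\<kappa>\<^sup>2 * rAr)"
    and "u1 = \<kappa> * x1" and "u2 = \<kappa> * np"
  have R0: "R \<ge> 0" and Q0: "Q \<ge> 0" using nn \<kappa> by (auto simp: R_def Q_def)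
  have x: "\<bar>x1\<bar> \<le> np / 1600 + 400 * R" "\<bar>x2\<bar> \<le> np / (2 * 10 ^ 6) + 10 ^ 6 / 2 * Q" "\<bar>x3\<bar> \<le> R / 10 ^ 6 + 10 ^ 6 / 4 * Q"
    using pr pq rq by (simp_all add: R_def Q_def x1_def x2_def x3_def)
  have small: "\<kappa> * y \<le> y / 10 ^ 20" "\<kappa> * N * y \<le> y / 10 ^ 20" if "0 \<le> y" for y
    using mult_right_mono[OF \<kappa>(2) that] mult_right_mono[OF N(2) that] by simp_all
  have a1: "\<bar>a1\<bar> \<le> np / 10 ^ 20"
  proof -
    have "\<bar>a1\<bar> = \<kappa> * \<bar>pAp\<bar>" using \<kappa> by (simp add: a1_def abs_mult)
    also have "\<dots> \<le> \<kappa> * (N * np)" using pAp \<kappa> by (intro mult_left_mono) auto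
    also have "\<dots> \<le> np / 10 ^ 20" using small(2)[OF nn(1)] by (simp add: mult.assoc)
    finally show ?thesis .
  qed
  have a2: "\<bar>a2\<bar> \<le> (np + R) / 10 ^ 20"
  proof -
    have "2 * \<bar>a2\<bar> = \<kappa> * (2 * \<bar>\<kappa> * pAr\<bar>)" using \<kappa> by (simp add: a2_def abs_mult)
    also have "\<dots> \<le> \<kappa> * (N * (np + R))" using pAr \<kappa> unfolding R_def by (intro mult_left_mono) auto
    also have "\<dots> \<le> (np + R) / 10 ^ 20" using small(2)[of "np + R"] nn R0 by (simp add: mult.assoc)
    finally show ?thesis using nn R0 by simp
  qed
  have a3: "\<bar>a3\<bar> \<le> R / 10 ^ 20"
  proof -
    have "\<bar>a3\<bar> = \<kappa> * (\<kappa>\<^sup>2 * \<bar>rAr\<bar>)" using \<kappa> by (simp add: a3_def abs_mult)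
    also have "\<dots> \<le> \<kappa> * (\<kappa>\<^sup>2 * (N * nr))" using rAr \<kappa> by (intro mult_left_mono) auto
    also have "\<dots> = \<kappa> * N * R" by (simp add: R_def)
    also have "\<dots> \<le> R / 10 ^ 20" using small(2)[OF R0] .
    finally show ?thesis .
  qed
  have u1: "\<bar>u1\<bar> \<le> (np / 1600 + 400 * R) / 10 ^ 20"
  proof -
    have "\<bar>u1\<bar> = \<kappa> * \<bar>x1\<bar>" using \<kappa> by (simp add: u1_def abs_mult)
    also have "\<dots> \<le> \<bar>x1\<bar> / 10 ^ 20" by (rule small(1)) simp
    finally show ?thesis using x(1) by (simp add: field_simps)
  qed
  have u2: "u2 \<le> np / 10 ^ 20" unfolding u2_def by (rule small(1)[OF nn(1)])
  \<comment> \<open>Budget for the cross terms: a quarter of \<open>np\<close>, 142500 out of 500000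
    for \<open>R\<close>, and about one percent of the coefficient of \<open>Q\<close>.\<close>
  have b: "200 * x1 \<ge> - (np / 8) - 80000 * R" "250000 * x2 \<ge> - (np / 8) - 125000000000 * Q"
    "10 ^ 12 / 16 * x3 \<ge> - 62500 * R - 15625000000000000 * Q"
    using abs_le_D2[OF x(1)] abs_le_D2[OF x(2)] abs_le_D2[OF x(3)] unfolding powers_of_ten by simp_all
  have c: "50 * a1 \<ge> - (np / 100)" "50 * u2 \<le> np / 100" "10 ^ 6 * u1 \<le> np / 100 + R"
    "500000 * a2 \<ge> - (np / 100) - R" "10 ^ 12 / 16 * a3 \<ge> - R"
    using abs_le_D2[OF a1] u2 abs_le_D1[OF u1] abs_le_D2[OF a2] abs_le_D2[OF a3] nn R0
    unfolding powers_of_ten by simp_all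
  have d: "10 ^ 20 / 64 * Q \<ge> 1562500000000000000 * Q" unfolding powers_of_ten by simp
  have "0 \<le> np + 50 * a1 - 50 * u2 + 200 * x1 - 10 ^ 6 * u1 + 500000 * a2 + 250000 * x2 + 500000 * R
      + 10 ^ 12 / 16 * a3 + 10 ^ 12 / 16 * x3 + 10 ^ 20 / 64 * Q"
    using b c d nn R0 Q0 by linarith
  then have "0 \<le> \<kappa> * (np + 50 * a1 - 50 * u2 + 200 * x1 - 10 ^ 6 * u1 + 500000 * a2 + 250000 * x2 + 500000 * R
      + 10 ^ 12 / 16 * a3 + 10 ^ 12 / 16 * x3 + 10 ^ 20 / 64 * Q)"
    using \<kappa> by simp
  also have "\<dots> = \<kappa> * np + 50 * \<kappa>\<^sup>2 * (pAp - np) + 2 * (100 * \<kappa>\<^sup>2 - 500000 * \<kappa> ^ 3) * pr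
     + 250000 * \<kappa> ^ 3 * (2 * pAr + pq) + 500000 * \<kappa> ^ 3 * nr + 10 ^ 12 * \<kappa> ^ 4 / 16 * (rAr + rq)
     + 10 ^ 20 * \<kappa> ^ 5 / 64 * nq"
    unfolding R_def Q_def x1_def x2_def x3_def a1_def a2_def a3_def u1_def u2_def
    by (simp add: power2_eq_square power3_eq_cube power4_eq_xxxx power5_eq_xxxxx field_simps)
  finally show ?thesis .
qed

text \<open>After division by \<kappa>^2 the errors are multiples of 10^-20. The largest multiplier,
  10^20/64, belongs to the correction; the threshold 10^-20 undoes it, leaving 1/64 against
  50.\<close>

lemma matrix_part_nonneg:
  fixes \<kappa> N a b nP :: real
  assumes \<kappa>: "0 < \<kappa>" "\<kappa> \<le> 1 / 10 ^ 20" and N: "\<kappa> * N \<le> 1 / 10 ^ 20"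
    and a: "\<kappa>\<^sup>2 * a \<le> 1 / 10 ^ 20" and b: "\<kappa> ^ 3 * b \<le> 1 / 10 ^ 20" and "0 \<le> nP"
  shows "0 \<le> (50 * \<kappa>\<^sup>2 - 500000 * \<kappa> ^ 3 * (1 + N) - 10 ^ 12 * \<kappa> ^ 4 / 64 * a - 10 ^ 20 * \<kappa> ^ 5 / 64 * b) * nP"
proof -
  have "0 \<le> 50 - 500000 * (\<kappa> + \<kappa> * N) - 10 ^ 12 / 64 * (\<kappa>\<^sup>2 * a) - 10 ^ 20 / 64 * (\<kappa> ^ 3 * b)"
    using \<kappa>(2) N a b by (simp add: field_simps)
  then have "0 \<le> \<kappa>\<^sup>2 * (50 - 500000 * (\<kappa> + \<kappa> * N) - 10 ^ 12 / 64 * (\<kappa>\<^sup>2 * a) - 10 ^ 20 / 64 * (\<kappa> ^ 3 * b))"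
    by simp
  also have "\<dots> = 50 * \<kappa>\<^sup>2 - 500000 * \<kappa> ^ 3 * (1 + N) - 10 ^ 12 * \<kappa> ^ 4 / 64 * a - 10 ^ 20 * \<kappa> ^ 5 / 64 * b"
    by (simp add: power2_eq_square power3_eq_cube power4_eq_xxxx power5_eq_xxxxx field_simps)
  finally show ?thesis using \<open>0 \<le> nP\<close> by simp
qed

text \<open>Arithmetic-geometric mean with a free weight c, by which the budget of each square is
  distributed.\<close>

lemma abs_sum_mult_le:
  fixes x y :: "'i \<Rightarrow> real"
  assumes "c > 0"
  shows "\<bar>\<Sum>i\<in>I. x i * y i\<bar> \<le> c * (\<Sum>i\<in>I. (x i)\<^sup>2) + 1 / (4 * c) * (\<Sum>i\<in>I. (y i)\<^sup>2)"
proof -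
  have "\<bar>a * b\<bar> \<le> c * a\<^sup>2 + 1 / (4 * c) * b\<^sup>2" for a b :: real
  proof -
    have "0 \<le> c * (\<bar>a\<bar> - \<bar>b\<bar> / (2 * c))\<^sup>2" using assms by simp
    also have "\<dots> = c * a\<^sup>2 + 1 / (4 * c) * b\<^sup>2 - \<bar>a * b\<bar>"
      using assms by (simp add: power2_diff power_divide abs_mult field_simps) (simp add: power2_eq_square)
    finally show ?thesis by simp
  qed
  then have "\<bar>\<Sum>i\<in>I. x i * y i\<bar> \<le> (\<Sum>i\<in>I. c * (x i)\<^sup>2 + 1 / (4 * c) * (y i)\<^sup>2)"
    by (intro order_trans[OF sum_abs] sum_mono) auto
  then show ?thesis by (simp add: sum.distrib sum_distrib_left)
qed

context edge_weights
begin

text \<open>The form splits into a part in the scalars p0, \<Sum> p, \<Sum> r, a part in the vectors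
  p, r, q, and a multiple of \<open>nP\<close>, each non-negative by itself. A quarter of the
  diagonal term 200 \<kappa>^2 \<open>nP\<close> pays for all errors measured by
  \<open>nP\<close>.\<close>

theorem moment_form_nonneg:
  fixes \<kappa> N D4 D5 p0 :: real and p :: "nat \<Rightarrow> real"
  assumes \<kappa>: "0 < \<kappa>" "\<kappa> \<le> 1 / 10 ^ 20" and N0: "0 < N" "\<kappa> * N \<le> 1 / 10 ^ 20"
    and small4: "\<kappa>\<^sup>2 * (36 * real n + D4) \<le> 1 / 10 ^ 20" and small5: "\<kappa> ^ 3 * (4 * N\<^sup>2 + D5) \<le> 1 / 10 ^ 20"
    and N: "\<And>x. \<bar>qform {1..n} A x\<bar> \<le> N * (\<Sum>a\<in>{1..n}. (x a)\<^sup>2)"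
    and D4: "\<bar>qform ({1..n} \<times> {1..n}) (M4 G) (\<lambda>(i, j). P i j)\<bar> \<le> D4 * nP"
    and D5: "\<bar>qform ({1..n} \<times> {1..n}) (M5 n G) (\<lambda>(i, j). P i j)\<bar> \<le> D5 * nP"
  shows "0 \<le> p0\<^sup>2 + 2 * \<kappa> * p0 * (\<Sum>i\<in>{1..n}. p i) + p0 * (\<Sum>k\<in>{1..n}. \<Sum>l\<in>{1..n}. moment n G \<kappa> {k, l} * P k l)
    + (\<Sum>i\<in>{1..n}. \<Sum>k\<in>{1..n}. p i * (moment n G \<kappa> {i, k} * p k))
    + (\<Sum>i\<in>{1..n}. \<Sum>k\<in>{1..n}. \<Sum>l\<in>{1..n}. p i * (moment n G \<kappa> {i, k, l} * P k l))
    + 1 / 4 * S4 n (\<lambda>i j k l. P i j * (moment n G \<kappa> {i, j, k, l} * P k l))"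
proof -
  let ?V = "{1..n}"
  define t s np nr nq pr pq rq pAp pAr rAr where
    "t = (\<Sum>i\<in>?V. p i)" and "s = (\<Sum>i\<in>?V. r i)" and "np = (\<Sum>i\<in>?V. (p i)\<^sup>2)" and "nr = (\<Sum>i\<in>?V. (r i)\<^sup>2)"
    and "nq = (\<Sum>i\<in>?V. (q i)\<^sup>2)" and "pr = (\<Sum>i\<in>?V. p i * r i)" and "pq = (\<Sum>i\<in>?V. p i * q i)"
    and "rq = (\<Sum>i\<in>?V. r i * q i)" and "pAp = qform ?V A p" and "pAr = (\<Sum>i\<in>?V. \<Sum>k\<in>?V. p i * A i k * r k)"
    and "rAr = qform ?V A r"
  note defs = t_def s_def np_def nr_def nq_def pr_def pq_def rq_def pAp_def pAr_def rAr_def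
  define W where "W = S4 n (\<lambda>i j k l. dis i j k l * (P i j * P k l) * (((1 + A i k) * (1 + A j l) * (1 + A i l) * (1 + A j k))
         * (100 ^ 6 * \<kappa> ^ 4 + 100 ^ 10 * \<kappa> ^ 5 * Y i j k l)))"
  have W: "W \<ge> 10 ^ 12 * \<kappa> ^ 4 * (s\<^sup>2 + 4 * rAr + 4 * rq - (36 * real n + D4) * nP)
      + 10 ^ 20 * \<kappa> ^ 5 * (nq - (4 * N\<^sup>2 + D5) * nP)"
  proof -
    let ?Pi = "\<lambda>i j k l. (1 + A i k) * (1 + A j l) * (1 + A i l) * (1 + A j k)"
    have "W = S4 n (\<lambda>i j k l. (10 ^ 12 * \<kappa> ^ 4) * (dis i j k l * (P i j * P k l) * ?Pi i j k l)
       + (10 ^ 20 * \<kappa> ^ 5) * (dis i j k l * (P i j * P k l) * (?Pi i j k l * Y i j k l)))"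
    proof -
      have "d * x * (y * (a + b * z)) = a * (d * x * y) + b * (d * x * (y * z))" for d x y z a b :: real
        by (simp add: algebra_simps)
      moreover have "100 ^ 6 = (10 ^ 12 :: real)" "100 ^ 10 = (10 ^ 20 :: real)" by simp_all
      ultimately show ?thesis unfolding W_def by (simp only:)
    qed
    also have "\<dots> = (10 ^ 12 * \<kappa> ^ 4) * S4 n (\<lambda>i j k l. dis i j k l * (P i j * P k l) * ?Pi i j k l)
       + (10 ^ 20 * \<kappa> ^ 5) * S4 n (\<lambda>i j k l. dis i j k l * (P i j * P k l) * (?Pi i j k l * Y i j k l))"
      by (simp only: S4_add S4_mult)
    finally show ?thesis
      using four_body_ge[OF D4] five_body_ge[OF N N0(1) D5] \<kappa>(1) unfolding defs
      by (auto intro!: add_mono mult_left_mono)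
  qed
  have Zge: "Z \<ge> nr - (1 + N) * nP" unfolding defs by (rule Z_ge[OF N])
  have L: "0 \<le> p0\<^sup>2 + 2 * \<kappa> * p0 * t + 100 * \<kappa>\<^sup>2 * p0 * s + 50 * \<kappa>\<^sup>2 * t\<^sup>2 + 250000 * \<kappa> ^ 3 * (t * s)
    + 10 ^ 12 * \<kappa> ^ 4 / 64 * s\<^sup>2"
    by (rule low_rank_part_nonneg)
  have Vp: "0 \<le> \<kappa> * np + 50 * \<kappa>\<^sup>2 * (pAp - np) + 2 * (100 * \<kappa>\<^sup>2 - 500000 * \<kappa> ^ 3) * pr
     + 250000 * \<kappa> ^ 3 * (2 * pAr + pq) + 500000 * \<kappa> ^ 3 * nr + 10 ^ 12 * \<kappa> ^ 4 / 16 * (rAr + rq)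
     + 10 ^ 20 * \<kappa> ^ 5 / 64 * nq"
  proof (rule vector_part_nonneg[OF \<kappa> N0])
    show "0 \<le> np" "0 \<le> nr" "0 \<le> nq" unfolding defs by (auto intro!: sum_nonneg)
    show "\<bar>\<kappa> * pr\<bar> \<le> np / 1600 + 400 * (\<kappa>\<^sup>2 * nr)"
      using abs_sum_mult_le[of "1 / 1600" p "\<lambda>i. \<kappa> * r i" ?V] unfolding defs
      by (simp add: power_mult_distrib sum_distrib_left mult_ac)
    show "\<bar>\<kappa>\<^sup>2 * pq\<bar> \<le> np / (2 * 10 ^ 6) + 10 ^ 6 / 2 * (\<kappa> ^ 4 * nq)"
      using abs_sum_mult_le[of "1 / (2 * 10 ^ 6)" p "\<lambda>i. \<kappa>\<^sup>2 * q i" ?V] unfolding defs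
      by (simp add: power_mult_distrib sum_distrib_left mult_ac flip: power_mult)
    show "\<bar>\<kappa> ^ 3 * rq\<bar> \<le> (\<kappa>\<^sup>2 * nr) / 10 ^ 6 + 10 ^ 6 / 4 * (\<kappa> ^ 4 * nq)"
    proof -
      have "(\<Sum>i\<in>?V. (\<kappa> * r i) * (\<kappa>\<^sup>2 * q i)) = \<kappa> ^ 3 * rq"
        unfolding defs sum_distrib_left by (intro sum.cong refl) (simp add: power2_eq_square power3_eq_cube)
      moreover have "(\<Sum>i\<in>?V. (\<kappa> * r i)\<^sup>2) = \<kappa>\<^sup>2 * nr" "(\<Sum>i\<in>?V. (\<kappa>\<^sup>2 * q i)\<^sup>2) = \<kappa> ^ 4 * nq"
        unfolding defs sum_distrib_left by (simp_all add: power_mult_distrib flip: power_mult)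
      ultimately show ?thesis
        using abs_sum_mult_le[of "1 / 10 ^ 6" "\<lambda>i. \<kappa> * r i" "\<lambda>i. \<kappa>\<^sup>2 * q i" ?V] by simp
    qed
    show "\<bar>pAp\<bar> \<le> N * np" "\<bar>rAr\<bar> \<le> N * nr" unfolding defs by (rule N)+
    show "2 * \<bar>\<kappa> * pAr\<bar> \<le> N * (np + \<kappa>\<^sup>2 * nr)"
    proof -
      have "(\<Sum>a\<in>?V. \<Sum>b\<in>?V. p a * A a b * (\<kappa> * r b)) = \<kappa> * pAr"
        unfolding defs sum_distrib_left by (simp add: mult_ac)
      moreover have "(\<Sum>i\<in>?V. (\<kappa> * r i)\<^sup>2) = \<kappa>\<^sup>2 * nr"
        unfolding defs sum_distrib_left by (simp add: power_mult_distrib)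
      ultimately show ?thesis
        using bilinear_le_of_qform_le[OF sgn_adj_commute N, of p "\<lambda>i. \<kappa> * r i"] unfolding np_def by simp
    qed
  qed
  have Mp: "0 \<le> (50 * \<kappa>\<^sup>2 - 500000 * \<kappa> ^ 3 * (1 + N) - 10 ^ 12 * \<kappa> ^ 4 / 64 * (36 * real n + D4)
      - 10 ^ 20 * \<kappa> ^ 5 / 64 * (4 * N\<^sup>2 + D5)) * nP"
    by (rule matrix_part_nonneg[OF \<kappa> N0(2) small4 small5 nP_nonneg])
  have Z': "500000 * \<kappa> ^ 3 * Z \<ge> 500000 * \<kappa> ^ 3 * (nr - (1 + N) * nP)"
    using Zge \<kappa>(1) by (intro mult_left_mono) auto
  have "0 \<le> (p0\<^sup>2 + 2 * \<kappa> * p0 * t + 100 * \<kappa>\<^sup>2 * p0 * s + 50 * \<kappa>\<^sup>2 * t\<^sup>2 + 250000 * \<kappa> ^ 3 * (t * s)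
    + 10 ^ 12 * \<kappa> ^ 4 / 64 * s\<^sup>2) + (\<kappa> * np + 50 * \<kappa>\<^sup>2 * (pAp - np) + 2 * (100 * \<kappa>\<^sup>2 - 500000 * \<kappa> ^ 3) * pr
     + 250000 * \<kappa> ^ 3 * (2 * pAr + pq) + 500000 * \<kappa> ^ 3 * nr + 10 ^ 12 * \<kappa> ^ 4 / 16 * (rAr + rq)
     + 10 ^ 20 * \<kappa> ^ 5 / 64 * nq) + ((50 * \<kappa>\<^sup>2 - 500000 * \<kappa> ^ 3 * (1 + N) - 10 ^ 12 * \<kappa> ^ 4 / 64 * (36 * real n + D4)
      - 10 ^ 20 * \<kappa> ^ 5 / 64 * (4 * N\<^sup>2 + D5)) * nP)"
    using L Vp Mp by linarith
  also have "\<dots> = p0\<^sup>2 + 2 * \<kappa> * p0 * t + p0 * (100 * \<kappa>\<^sup>2 * s) + (\<kappa> * np + 50 * \<kappa>\<^sup>2 * (t\<^sup>2 - np + pAp))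
     + (2 * (100 * \<kappa>\<^sup>2 - 500000 * \<kappa> ^ 3) * pr + 250000 * \<kappa> ^ 3 * (t * s + 2 * pAr + pq))
     + 50 * \<kappa>\<^sup>2 * nP + 500000 * \<kappa> ^ 3 * (nr - (1 + N) * nP)
     + 1 / 64 * (10 ^ 12 * \<kappa> ^ 4 * (s\<^sup>2 + 4 * rAr + 4 * rq - (36 * real n + D4) * nP)
      + 10 ^ 20 * \<kappa> ^ 5 * (nq - (4 * N\<^sup>2 + D5) * nP))"
    by (simp add: algebra_simps)
  also have "\<dots> \<le> p0\<^sup>2 + 2 * \<kappa> * p0 * t + p0 * (100 * \<kappa>\<^sup>2 * s) + (\<kappa> * np + 50 * \<kappa>\<^sup>2 * (t\<^sup>2 - np + pAp))
     + (2 * (100 * \<kappa>\<^sup>2 - 500000 * \<kappa> ^ 3) * pr + 250000 * \<kappa> ^ 3 * (t * s + 2 * pAr + pq))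
     + 50 * \<kappa>\<^sup>2 * nP + 500000 * \<kappa> ^ 3 * Z + 1 / 64 * W"
    by (intro add_mono order_refl Z' mult_left_mono[OF W]) simp
  also have "\<dots> = p0\<^sup>2 + 2 * \<kappa> * p0 * t + p0 * (100 * \<kappa>\<^sup>2 * s) + (\<kappa> * np + 50 * \<kappa>\<^sup>2 * (t\<^sup>2 - np + pAp))
     + (2 * (100 * \<kappa>\<^sup>2 - 500000 * \<kappa> ^ 3) * pr + 250000 * \<kappa> ^ 3 * (t * s + 2 * pAr + pq))
     + 1 / 4 * (200 * \<kappa>\<^sup>2 * nP + 2 * 10 ^ 6 * \<kappa> ^ 3 * Z + 1 / 16 * W)"
    by simp
  finally show ?thesis
    unfolding sum_pair_moments sum_single_single_moments sum_single_pair_moments sum_pair_pair_moments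
      W_def[symmetric] defs by simp
qed

end

section \<open>Expanding the form over sets of size at most two\<close>

lemma sum_vertex_pairs:
  fixes F :: "nat set \<Rightarrow> real"
  shows "(\<Sum>i\<in>{1..n}. \<Sum>j\<in>{1..n}. of_bool (i \<noteq> j) * F {i, j}) = 2 * (\<Sum>e\<in>vertex_pairs n. F e)"
proof -
  let ?V = "{1..n}" and ?T = "{(i, j). i \<in> {1..n} \<and> j \<in> {1..n} \<and> i < j}"
  have "inj_on (\<lambda>(i, j). {i, j}) ?T"
    by (auto simp: inj_on_def doubleton_eq_iff)
  moreover have "vertex_pairs n = (\<lambda>(i, j). {i, j}) ` ?T"
  proof (intro equalityI subsetI)
    fix e assume "e \<in> vertex_pairs n"
    then obtain i j where e: "e = {i, j}" "i \<noteq> j" "i \<in> ?V" "j \<in> ?V"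
      by (auto simp: vertex_pairs_def card_2_iff)
    show "e \<in> (\<lambda>(i, j). {i, j}) ` ?T"
    proof (cases "i < j")
      case True
      then show ?thesis using e by (intro image_eqI[of _ _ "(i, j)"]) auto
    next
      case False
      then show ?thesis using e by (intro image_eqI[of _ _ "(j, i)"]) auto
    qed
  next
    fix e assume "e \<in> (\<lambda>(i, j). {i, j}) ` ?T"
    then show "e \<in> vertex_pairs n" by (auto simp: vertex_pairs_def)
  qed
  ultimately have "(\<Sum>e\<in>vertex_pairs n. F e) = (\<Sum>(i, j)\<in>?T. F {i, j})"
    by (simp add: sum.reindex case_prod_unfold comp_def)
  also have "\<dots> = (\<Sum>(i, j)\<in>?V \<times> ?V. of_bool (i < j) * F {i, j})"
    by (rule sum.mono_neutral_cong_left) auto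
  also have "\<dots> = (\<Sum>i\<in>?V. \<Sum>j\<in>?V. of_bool (i < j) * F {i, j})"
    by (simp only: sum.cartesian_product)
  finally have lt: "(\<Sum>e\<in>vertex_pairs n. F e) = (\<Sum>i\<in>?V. \<Sum>j\<in>?V. of_bool (i < j) * F {i, j})" .
  have gt: "(\<Sum>i\<in>?V. \<Sum>j\<in>?V. of_bool (j < i) * F {i, j}) = (\<Sum>i\<in>?V. \<Sum>j\<in>?V. of_bool (i < j) * F {i, j})"
    by (subst sum.swap) (simp add: insert_commute)
  have "(\<Sum>i\<in>?V. \<Sum>j\<in>?V. of_bool (i \<noteq> j) * F {i, j})
    = (\<Sum>i\<in>?V. \<Sum>j\<in>?V. of_bool (i < j) * F {i, j} + of_bool (j < i) * F {i, j})"
    by (intro sum.cong refl) auto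
  then show ?thesis unfolding lt sum.distrib gt by simp
qed

lemma sum_subsets_le2:
  fixes F :: "nat set \<Rightarrow> real"
  shows "(\<Sum>S\<in>subsets_le2 n. F S) = F {} + (\<Sum>i\<in>{1..n}. F {i})
     + 1 / 2 * (\<Sum>i\<in>{1..n}. \<Sum>j\<in>{1..n}. of_bool (i \<noteq> j) * F {i, j})"
proof -
  have eq: "subsets_le2 n = insert {} ((\<lambda>i. {i}) ` {1..n} \<union> vertex_pairs n)"
  proof (intro equalityI subsetI)
    fix S assume S: "S \<in> subsets_le2 n"
    then have "finite S" by (auto simp: subsets_le2_def intro: finite_subset)
    moreover have "card S = 0 \<or> card S = 1 \<or> card S = 2" using S by (auto simp: subsets_le2_def)
    ultimately show "S \<in> insert {} ((\<lambda>i. {i}) ` {1..n} \<union> vertex_pairs n)"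
      using S by (auto simp: subsets_le2_def vertex_pairs_def card_1_singleton_iff)
  qed (auto simp: subsets_le2_def vertex_pairs_def)
  have "(\<Sum>S\<in>subsets_le2 n. F S) = F {} + (\<Sum>S\<in>(\<lambda>i. {i}) ` {1..n} \<union> vertex_pairs n. F S)"
    unfolding eq by (rule sum.insert) (auto simp: vertex_pairs_def)
  also have "(\<Sum>S\<in>(\<lambda>i. {i}) ` {1..n} \<union> vertex_pairs n. F S) = (\<Sum>S\<in>(\<lambda>i. {i}) ` {1..n}. F S) + (\<Sum>S\<in>vertex_pairs n. F S)"
    by (rule sum.union_disjoint) (auto simp: vertex_pairs_def)
  also have "(\<Sum>S\<in>(\<lambda>i. {i}) ` {1..n}. F S) = (\<Sum>i\<in>{1..n}. F {i})"
    by (subst sum.reindex) auto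
  finally show ?thesis unfolding sum_vertex_pairs by simp
qed

lemma moment_Un_eq_0: "\<not> clique G S \<or> \<not> clique G T \<Longrightarrow> moment n G \<kappa> (S \<union> T) = 0"
  using clique_subset[of G "S \<union> T" S] clique_subset[of G "S \<union> T" T] by (auto simp: moment_def)

text \<open>Coefficients of non-cliques meet only zero entries, so \<open>y\<close> drops them.
  \<open>P\<close> lists each unordered pair twice, hence 1/2 for one pair index and 1/4 for two;
  terms that mix sizes occur on both sides of the diagonal and regain a factor 2.\<close>

lemma moment_form_expand:
  fixes G :: "nat set set" and x :: "nat set \<Rightarrow> real"
  defines "y \<equiv> \<lambda>S. of_bool (clique G S) * x S"
  defines "P \<equiv> \<lambda>i j. of_bool (i \<noteq> j) * y {i, j}"
  shows "(\<Sum>S\<in>subsets_le2 n. \<Sum>T\<in>subsets_le2 n. x S * moment n G \<kappa> (S \<union> T) * x T)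
    = (y {})\<^sup>2 + 2 * \<kappa> * y {} * (\<Sum>i\<in>{1..n}. y {i}) + y {} * (\<Sum>k\<in>{1..n}. \<Sum>l\<in>{1..n}. moment n G \<kappa> {k, l} * P k l)
    + (\<Sum>i\<in>{1..n}. \<Sum>k\<in>{1..n}. y {i} * (moment n G \<kappa> {i, k} * y {k}))
    + (\<Sum>i\<in>{1..n}. \<Sum>k\<in>{1..n}. \<Sum>l\<in>{1..n}. y {i} * (moment n G \<kappa> {i, k, l} * P k l))
    + 1 / 4 * S4 n (\<lambda>i j k l. P i j * (moment n G \<kappa> {i, j, k, l} * P k l))"
proof -
  let ?V = "{1..n}" and ?m = "moment n G \<kappa>"
  define J where "J S = (\<Sum>T\<in>subsets_le2 n. ?m (S \<union> T) * y T)" for S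
  have xy: "x S * ?m (S \<union> T) * x T = y S * (?m (S \<union> T) * y T)" for S T
    using moment_Un_eq_0[of G S T n \<kappa>] by (cases "clique G S"; cases "clique G T") (auto simp: y_def)
  have Q: "(\<Sum>S\<in>subsets_le2 n. \<Sum>T\<in>subsets_le2 n. x S * ?m (S \<union> T) * x T) = (\<Sum>S\<in>subsets_le2 n. y S * J S)"
    unfolding J_def sum_distrib_left xy ..
  have J: "J S = ?m S * y {} + (\<Sum>k\<in>?V. ?m (S \<union> {k}) * y {k}) + 1 / 2 * (\<Sum>k\<in>?V. \<Sum>l\<in>?V. ?m (S \<union> {k, l}) * P k l)" for S
    unfolding J_def sum_subsets_le2 P_def by (simp add: mult_ac)
  have J0: "J {} = y {} + \<kappa> * (\<Sum>k\<in>?V. y {k}) + 1 / 2 * (\<Sum>k\<in>?V. \<Sum>l\<in>?V. ?m {k, l} * P k l)"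
    unfolding J by (simp add: moment_empty moment_single sum_distrib_left)
  have J1: "J {i} = \<kappa> * y {} + (\<Sum>k\<in>?V. ?m {i, k} * y {k}) + 1 / 2 * (\<Sum>k\<in>?V. \<Sum>l\<in>?V. ?m {i, k, l} * P k l)" for i
    unfolding J Un_insert_left Un_empty_left moment_single ..
  have J2: "J {i, j} = ?m {i, j} * y {} + (\<Sum>k\<in>?V. ?m {k, i, j} * y {k}) + 1 / 2 * (\<Sum>k\<in>?V. \<Sum>l\<in>?V. ?m {i, j, k, l} * P k l)" for i j
  proof -
    have k: "{i, j} \<union> {k} = {k, i, j}" and kl: "{i, j} \<union> {k, l} = {i, j, k, l}" for k l by auto
    show ?thesis unfolding J k kl ..
  qed
  have pp: "(\<Sum>i\<in>?V. \<Sum>j\<in>?V. P i j * (\<Sum>k\<in>?V. ?m {k, i, j} * y {k}))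
    = (\<Sum>i\<in>?V. \<Sum>k\<in>?V. \<Sum>l\<in>?V. y {i} * (?m {i, k, l} * P k l))"
  proof -
    have "(\<Sum>i\<in>?V. \<Sum>j\<in>?V. P i j * (\<Sum>k\<in>?V. ?m {k, i, j} * y {k}))
      = (\<Sum>i\<in>?V. \<Sum>j\<in>?V. \<Sum>k\<in>?V. y {k} * (?m {k, i, j} * P i j))"
      unfolding sum_distrib_left by (intro sum.cong refl) (simp only: mult_ac)
    also have "\<dots> = (\<Sum>i\<in>?V. \<Sum>k\<in>?V. \<Sum>j\<in>?V. y {k} * (?m {k, i, j} * P i j))"
      by (rule sum.cong[OF refl]) (rule sum.swap)
    also have "\<dots> = (\<Sum>k\<in>?V. \<Sum>i\<in>?V. \<Sum>j\<in>?V. y {k} * (?m {k, i, j} * P i j))"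
      by (rule sum.swap)
    finally show ?thesis .
  qed
  have s0: "y {} * J {} = (y {})\<^sup>2 + \<kappa> * y {} * (\<Sum>i\<in>?V. y {i}) + 1 / 2 * (y {} * (\<Sum>k\<in>?V. \<Sum>l\<in>?V. ?m {k, l} * P k l))"
    unfolding J0 by (simp add: power2_eq_square distrib_left mult_ac)
  have s1: "(\<Sum>i\<in>?V. y {i} * J {i}) = \<kappa> * y {} * (\<Sum>i\<in>?V. y {i}) + (\<Sum>i\<in>?V. \<Sum>k\<in>?V. y {i} * (?m {i, k} * y {k}))
     + 1 / 2 * (\<Sum>i\<in>?V. \<Sum>k\<in>?V. \<Sum>l\<in>?V. y {i} * (?m {i, k, l} * P k l))"
    unfolding J1 by (simp add: distrib_left sum.distrib sum_distrib_left mult_ac)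
  have s2: "(\<Sum>i\<in>?V. \<Sum>j\<in>?V. P i j * J {i, j}) = y {} * (\<Sum>k\<in>?V. \<Sum>l\<in>?V. ?m {k, l} * P k l)
     + (\<Sum>i\<in>?V. \<Sum>k\<in>?V. \<Sum>l\<in>?V. y {i} * (?m {i, k, l} * P k l))
     + 1 / 2 * S4 n (\<lambda>i j k l. P i j * (?m {i, j, k, l} * P k l))"
  proof -
    have "(\<Sum>i\<in>?V. \<Sum>j\<in>?V. P i j * J {i, j}) = (\<Sum>i\<in>?V. \<Sum>j\<in>?V. P i j * (?m {i, j} * y {}))
      + (\<Sum>i\<in>?V. \<Sum>j\<in>?V. P i j * (\<Sum>k\<in>?V. ?m {k, i, j} * y {k}))
      + (\<Sum>i\<in>?V. \<Sum>j\<in>?V. P i j * (1 / 2 * (\<Sum>k\<in>?V. \<Sum>l\<in>?V. ?m {i, j, k, l} * P k l)))"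
      unfolding J2 distrib_left sum.distrib ..
    moreover have "(\<Sum>i\<in>?V. \<Sum>j\<in>?V. P i j * (?m {i, j} * y {})) = y {} * (\<Sum>k\<in>?V. \<Sum>l\<in>?V. ?m {k, l} * P k l)"
      unfolding sum_distrib_left by (intro sum.cong refl) (simp only: mult_ac)
    moreover have "(\<Sum>i\<in>?V. \<Sum>j\<in>?V. P i j * (1 / 2 * (\<Sum>k\<in>?V. \<Sum>l\<in>?V. ?m {i, j, k, l} * P k l)))
      = 1 / 2 * S4 n (\<lambda>i j k l. P i j * (?m {i, j, k, l} * P k l))"
      unfolding S4_def sum_distrib_left by (intro sum.cong refl) (simp only: mult_ac)
    ultimately show ?thesis unfolding pp by simp
  qed
  have "(\<Sum>S\<in>subsets_le2 n. y S * J S) = y {} * J {} + (\<Sum>i\<in>?V. y {i} * J {i})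
     + 1 / 2 * (\<Sum>i\<in>?V. \<Sum>j\<in>?V. P i j * J {i, j})"
    unfolding sum_subsets_le2 P_def by (simp add: mult.assoc)
  then show ?thesis unfolding Q s0 s1 s2 by (simp add: algebra_simps)
qed

text \<open>With w = sqrt n, the choice of \<kappa> makes \<kappa> w \<Lambda> equal to z = 10^-20.
  The norms w \<Lambda>, w^2 \<Lambda>, w^3 \<Lambda> come with \<kappa>, \<kappa>^2, \<kappa>^3, so
  every smallness requirement is bounded by a polynomial in z.\<close>

lemma pos_semidef_moment:
  assumes pr: "pseudorandom n \<Lambda> G" and "n \<ge> 1" "\<Lambda> \<ge> 1" and \<kappa>: "\<kappa> = 1 / (sqrt n * \<Lambda> * 10 ^ 20)"
  shows "pos_semidef_on (subsets_le2 n) (\<lambda>S T. moment n G \<kappa> (S \<union> T))"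
  unfolding pos_semidef_on_def
proof (intro conjI allI ballI)
  fix x :: "nat set \<Rightarrow> real"
  define y where "y = (\<lambda>S. of_bool (clique G S) * x S)"
  define P where "P = (\<lambda>i j. of_bool (i \<noteq> j) * y {i, j})"
  interpret edge_weights n G P
  proof
    show "P i j = P j i" for i j by (simp add: P_def insert_commute eq_commute)
    show "sgn_adj G i j = 1" if "P i j \<noteq> 0" for i j
      using that by (auto simp: P_def y_def clique_insert sgn_adj_def split: if_splits)
  qed
  define w where "w = sqrt n"
  have w: "w \<ge> 1" "real n = w\<^sup>2" using \<open>n \<ge> 1\<close> by (auto simp: w_def)
  define z where "z = (1 / 10 ^ 20 :: real)"
  have z: "z > 0" "z \<le> 1 / 100" by (simp_all add: z_def)
  have \<kappa>w: "\<kappa> * w * \<Lambda> = z" "\<kappa> > 0" using w \<open>\<Lambda> \<ge> 1\<close> by (auto simp: \<kappa> w_def[symmetric] z_def)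
  have \<kappa>le: "\<kappa> * w \<le> z" "\<kappa> \<le> z"
  proof -
    show 1: "\<kappa> * w \<le> z"
      using mult_left_mono[OF \<open>\<Lambda> \<ge> 1\<close>, of "\<kappa> * w"] \<kappa>w w by simp
    show "\<kappa> \<le> z" using mult_left_mono[OF w(1), of \<kappa>] \<kappa>w(2) 1 by linarith
  qed
  have "0 \<le> (y {})\<^sup>2 + 2 * \<kappa> * y {} * (\<Sum>i\<in>{1..n}. y {i}) + y {} * (\<Sum>k\<in>{1..n}. \<Sum>l\<in>{1..n}. moment n G \<kappa> {k, l} * P k l)
    + (\<Sum>i\<in>{1..n}. \<Sum>k\<in>{1..n}. y {i} * (moment n G \<kappa> {i, k} * y {k}))
    + (\<Sum>i\<in>{1..n}. \<Sum>k\<in>{1..n}. \<Sum>l\<in>{1..n}. y {i} * (moment n G \<kappa> {i, k, l} * P k l))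
    + 1 / 4 * S4 n (\<lambda>i j k l. P i j * (moment n G \<kappa> {i, j, k, l} * P k l))"
  proof (rule moment_form_nonneg[of \<kappa> "w * \<Lambda>" "w\<^sup>2 * \<Lambda>" "w\<^sup>2 * w * \<Lambda>"])
    show "0 < \<kappa>" "\<kappa> \<le> 1 / 10 ^ 20" "0 < w * \<Lambda>" "\<kappa> * (w * \<Lambda>) \<le> 1 / 10 ^ 20"
      using \<kappa>w \<kappa>le w \<open>\<Lambda> \<ge> 1\<close> by (auto simp: z_def mult.assoc)
    have kw2: "(\<kappa> * w)\<^sup>2 \<le> z * z"
      unfolding power2_eq_square using \<kappa>le \<kappa>w w z by (intro mult_mono) auto
    show "\<kappa>\<^sup>2 * (36 * real n + w\<^sup>2 * \<Lambda>) \<le> 1 / 10 ^ 20"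
    proof -
      have "\<kappa>\<^sup>2 * (36 * real n + w\<^sup>2 * \<Lambda>) = 36 * (\<kappa> * w)\<^sup>2 + (\<kappa> * w) * (\<kappa> * w * \<Lambda>)"
        by (simp add: w(2) power2_eq_square algebra_simps)
      also have "\<dots> \<le> 36 * (z * z) + z * z"
        unfolding \<kappa>w using kw2 \<kappa>le z by (intro add_mono mult_left_mono mult_right_mono) auto
      also have "\<dots> = (37 * z) * z" by simp
      also have "\<dots> \<le> 1 * z" using z by (intro mult_right_mono) auto
      finally show ?thesis by (simp add: z_def)
    qed
    show "\<kappa> ^ 3 * (4 * (w * \<Lambda>)\<^sup>2 + w\<^sup>2 * w * \<Lambda>) \<le> 1 / 10 ^ 20"
    proof -
      have "\<kappa> ^ 3 * (4 * (w * \<Lambda>)\<^sup>2 + w\<^sup>2 * w * \<Lambda>) = 4 * \<kappa> * (\<kappa> * w * \<Lambda>)\<^sup>2 + (\<kappa> * w)\<^sup>2 * (\<kappa> * w * \<Lambda>)"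
        by (simp add: power2_eq_square power3_eq_cube algebra_simps)
      also have "\<dots> \<le> 4 * z * z\<^sup>2 + (z * z) * z"
        unfolding \<kappa>w using kw2 \<kappa>le z by (intro add_mono mult_left_mono mult_right_mono) auto
      also have "\<dots> = (5 * z * z) * z" by (simp add: power2_eq_square)
      also have "\<dots> \<le> 1 * z"
      proof (intro mult_right_mono)
        have "5 * z * z \<le> 1 * 1" using z by (intro mult_mono) auto
        then show "5 * z * z \<le> 1" by simp
      qed (use z in auto)
      finally show ?thesis by (simp add: z_def)
    qed
    show "\<bar>qform {1..n} (sgn_adj G) x\<bar> \<le> w * \<Lambda> * (\<Sum>a\<in>{1..n}. (x a)\<^sup>2)" for x
      using pr by (simp only: pseudorandom_def w_def)
    show "\<bar>qform ({1..n} \<times> {1..n}) (M4 G) (\<lambda>(i, j). P i j)\<bar> \<le> w\<^sup>2 * \<Lambda> * nP"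
      using pr unfolding nP_eq[symmetric] pseudorandom_def w(2) by blast
    have "real n * sqrt (real n) = w\<^sup>2 * w" by (simp add: w_def)
    then show "\<bar>qform ({1..n} \<times> {1..n}) (M5 n G) (\<lambda>(i, j). P i j)\<bar> \<le> w\<^sup>2 * w * \<Lambda> * nP"
      using pr unfolding nP_eq[symmetric] pseudorandom_def by metis
  qed
  then show "0 \<le> (\<Sum>S\<in>subsets_le2 n. \<Sum>T\<in>subsets_le2 n. x S * moment n G \<kappa> (S \<union> T) * x T)"
    unfolding moment_form_expand by (simp only: y_def P_def)
qed (simp add: Un_commute)

section \<open>Feasibility and objective value\<close>

lemma moment_bounds:
  assumes pr: "pseudorandom n \<Lambda> G" and "n \<ge> 1" "\<Lambda> \<ge> 1" and \<kappa>: "\<kappa> = 1 / (sqrt n * \<Lambda> * 10 ^ 20)"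
    and U: "U \<subseteq> {1..n}" "card U \<le> 4"
  shows "0 \<le> moment n G \<kappa> U" "moment n G \<kappa> U \<le> 1"
proof -
  define w where "w = sqrt n * \<Lambda>"
  have "1 * 1 \<le> sqrt n * \<Lambda>" using assms(2,3) by (intro mult_mono) auto
  then have w: "w \<ge> 1" by (simp add: w_def)
  have \<kappa>w: "\<kappa> * w * 10 ^ 20 = 1" using w by (simp add: \<kappa> w_def[symmetric])
  have \<kappa>0: "\<kappa> > 0" using w by (simp add: \<kappa> w_def[symmetric])
  have \<kappa>1: "\<kappa> * 10 ^ 20 \<le> 1"
  proof -
    have "\<kappa> * 10 ^ 20 * 1 \<le> \<kappa> * 10 ^ 20 * w" using w \<kappa>0 by (intro mult_left_mono) auto
    also have "\<dots> = 1" using \<kappa>w by (simp only: mult_ac)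
    finally show ?thesis by simp
  qed
  let ?b = "100 ^ (card U * (card U - 1) div 2) * \<kappa> ^ card U"
  \<comment> \<open>Applied with e = k(k-1)/2, which is at most 2k for k up to 4; the base 100^2
    \<kappa> is below 1/2.\<close>
  have pw: "100 ^ e * \<kappa> ^ k \<le> 1 / 2" if "1 \<le> k" "e \<le> 2 * k" for e k
  proof -
    have "100 ^ e * \<kappa> ^ k \<le> 100 ^ (2 * k) * \<kappa> ^ k"
      using that \<kappa>0 by (intro mult_right_mono power_increasing) auto
    also have "\<dots> = (100 ^ 2 * \<kappa>) ^ k" by (simp only: power_mult power_mult_distrib)
    also have "\<dots> \<le> (1 / 2) ^ k" using \<kappa>0 \<kappa>1 by (intro power_mono) auto
    also have "\<dots> \<le> (1 / 2) ^ 1" using that by (intro power_decreasing) auto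
    finally show ?thesis by simp
  qed
  have "(0 \<le> moment n G \<kappa> U) \<and> (moment n G \<kappa> U \<le> 1)"
  proof (cases "card U = 4")
    case True
    have "finite U" using U(1) finite_subset by auto
    then obtain xs where xs: "set xs = U" "distinct xs" using finite_distinct_list by blast
    then have "length xs = 4" using True distinct_card by fastforce
    then obtain i j k l where ijkl: "xs = [i, j, k, l]"
      by (auto simp: numeral_eq_Suc length_Suc_conv)
    define y where "y = common_sign n G i j k l"
    have s: "(\<Sum>u\<in>{1..n}. \<Prod>v\<in>U. sgn_adj G u v) = y"
      unfolding y_def common_sign_def xs(1)[symmetric] ijkl using xs(2)[unfolded ijkl]
      by (intro sum.cong refl) (simp add: mult_ac)
    have "\<bar>y\<bar> \<le> w"
      using pr U(1) xs ijkl unfolding pseudorandom_def y_def w_def by (auto simp del: distinct.simps)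
    then have "\<bar>100 ^ 10 * \<kappa> ^ 5 * y\<bar> \<le> 100 ^ 10 * \<kappa> ^ 5 * w"
      using \<kappa>0 by (simp add: abs_mult)
    \<comment> \<open>One factor \<kappa> pays for the bound w on the sign sum: the correction is at
      most \<kappa>^4, below the main term 100^6 \<kappa>^4, so the moment stays
      non-negative.\<close>
    also have "\<dots> = \<kappa> ^ 4 * (\<kappa> * w * 10 ^ 20)" by (simp add: power4_eq_xxxx power5_eq_xxxxx)
    also have "\<dots> \<le> 100 ^ 6 * \<kappa> ^ 4" unfolding \<kappa>w using \<kappa>0 by simp
    finally have "\<bar>100 ^ 10 * \<kappa> ^ 5 * y\<bar> \<le> 100 ^ 6 * \<kappa> ^ 4" .
    moreover have "100 ^ 6 * \<kappa> ^ 4 \<le> 1 / 2" by (rule pw) auto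
    moreover have "moment n G \<kappa> U = of_bool (clique G U) * (100 ^ 6 * \<kappa> ^ 4 + 100 ^ 10 * \<kappa> ^ 5 * y)"
      unfolding moment_def s True by simp
    moreover have "0 \<le> of_bool c * (a + z) \<and> of_bool c * (a + z) \<le> 1" if "\<bar>z\<bar> \<le> a" "a \<le> 1 / 2" for a z :: real and c
      using that by (cases c) auto
    ultimately show ?thesis by (simp only:)
  next
    case False
    then have m: "moment n G \<kappa> U = of_bool (clique G U) * ?b" by (simp add: moment_def)
    have "card U = 0 \<or> card U = 1 \<or> card U = 2 \<or> card U = 3" using False U(2) by linarith
    then have "?b \<le> 1"
    proof (elim disjE)
      assume "card U = 0" then show ?thesis by simp
    next
      assume c: "card U = 1" then show ?thesis using pw[of 1 0] by simp
    next
      assume c: "card U = 2" then show ?thesis using pw[of 2 1] by simp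
    next
      assume c: "card U = 3" then show ?thesis using pw[of 3 3] by simp
    qed
    moreover have "0 \<le> ?b" using \<kappa>0 by simp
    ultimately show ?thesis unfolding m by (cases "clique G U") simp_all
  qed
  then show "0 \<le> moment n G \<kappa> U" "moment n G \<kappa> U \<le> 1" by blast+
qed

text \<open>Every singleton has moment \<kappa>, so the objective equals n \<kappa>.\<close>

theorem sdpval_ge_of_pseudorandom:
  assumes pr: "pseudorandom n \<Lambda> G" and "n \<ge> 1" "\<Lambda> \<ge> 1"
  shows "sdpval n G \<ge> sqrt n / (\<Lambda> * 10 ^ 20)"
proof -
  define \<kappa> where "\<kappa> = 1 / (sqrt n * \<Lambda> * 10 ^ 20)"
  define X where "X = (\<lambda>S T. moment n G \<kappa> (S \<union> T))"
  have Un: "S \<union> T \<subseteq> {1..n}" "card (S \<union> T) \<le> 4" if "S \<in> subsets_le2 n" "T \<in> subsets_le2 n" for S T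
    using that card_Un_le[of S T] by (auto simp: subsets_le2_def)
  have "sos4_feasible n G X"
    unfolding sos4_feasible_def
  proof (intro conjI ballI impI)
    show "X S T \<in> {0..1}" if "S \<in> subsets_le2 n" "T \<in> subsets_le2 n" for S T
      unfolding X_def using moment_bounds[OF assms \<kappa>_def Un[OF that]] by simp
    show "X S T = 0" if "\<not> clique G (S \<union> T)" for S T
      using that by (simp add: X_def moment_def)
    show "X {} {} = 1" by (simp add: X_def moment_empty)
    show "pos_semidef_on (subsets_le2 n) X"
      unfolding X_def by (rule pos_semidef_moment[OF assms \<kappa>_def])
  qed (simp add: X_def)
  then have "(\<Sum>i\<in>{1..n}. X {i} {i}) \<le> sdpval n G"
    unfolding sdpval_def by (intro cSup_upper sos4_objective_bdd_above) auto
  moreover have "(\<Sum>i\<in>{1..n}. X {i} {i}) = real n * \<kappa>"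
    by (simp add: X_def moment_single)
  moreover have "real n * \<kappa> = sqrt n / (\<Lambda> * 10 ^ 20)"
  proof -
    have "w * w * (1 / (w * \<Lambda> * 10 ^ 20)) = w / (\<Lambda> * 10 ^ 20)" if "w \<noteq> 0" for w :: real
      using that by simp
    from this[of "sqrt n"] show ?thesis using assms(2) by (simp add: \<kappa>_def)
  qed
  ultimately show ?thesis by simp
qed

section \<open>From counting to probability\<close>

lemma erdos_renyi_half: "erdos_renyi n (1 / 2) = pmf_of_set (Pow (vertex_pairs n))"
  unfolding erdos_renyi_def by (rule pmf_of_set_Pow_conv_bernoulli) simp

lemma prob_pseudorandom:
  assumes n: "n \<ge> 1" "real n \<le> 2 ^ (2 * q)" and q: "2 * q = 2 ^ Suc m"
  shows "measure_pmf.prob (erdos_renyi n (1 / 2)) {G. pseudorandom n (2 ^ 18 * real (Suc (2 * q)) ^ 4) G} \<ge> 1 - 4 / real n ^ 4"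
proof -
  let ?\<Omega> = "Pow (vertex_pairs n)" and ?A = "{G. pseudorandom n (2 ^ 18 * real (Suc (2 * q)) ^ 4) G}"
  have f: "finite ?\<Omega>" by simp
  have c: "real (card ?\<Omega>) = 2 ^ card (vertex_pairs n)" by (simp add: card_Pow)
  have "measure_pmf.prob (pmf_of_set ?\<Omega>) (- ?A) = real (card (?\<Omega> \<inter> - ?A)) / real (card ?\<Omega>)"
    by (rule measure_pmf_of_set) auto
  also have "?\<Omega> \<inter> - ?A = {G\<in>?\<Omega>. \<not> pseudorandom n (2 ^ 18 * real (Suc (2 * q)) ^ 4) G}"
    by auto
  also have "real (card \<dots>) / real (card ?\<Omega>) \<le> (4 * (2 ^ card (vertex_pairs n) / real n ^ 4)) / real (card ?\<Omega>)"
    by (intro divide_right_mono card_not_pseudorandom[OF assms]) simp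
  also have "\<dots> = 4 / real n ^ 4" unfolding c by simp
  finally have "measure_pmf.prob (pmf_of_set ?\<Omega>) (- ?A) \<le> 4 / real n ^ 4" .
  moreover have "measure_pmf.prob (pmf_of_set ?\<Omega>) (- ?A) = 1 - measure_pmf.prob (pmf_of_set ?\<Omega>) ?A"
    using measure_pmf.prob_compl[of ?A "pmf_of_set ?\<Omega>"] by (simp add: Compl_eq_Diff_UNIV)
  ultimately show ?thesis unfolding erdos_renyi_half by simp
qed

text \<open>The least admissible m is taken; failure at its predecessor bounds half the walk length
  by a multiple of ln n.\<close>

lemma dyadic_walk_length:
  assumes "n \<ge> 3"
  obtains m where "real n \<le> 2 ^ (2 * 2 ^ m)" "real (2 * 2 ^ m) \<le> 4 * ln (real n)"
proof -
  define Q where "Q m \<longleftrightarrow> real n \<le> 2 ^ (2 * 2 ^ m)" for m :: nat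
  have "real n \<le> 2 ^ (2 * 2 ^ n)"
  proof -
    have "n \<le> 2 ^ n" by (rule less_imp_le[OF less_exp])
    also have "\<dots> \<le> 2 ^ (2 * 2 ^ n)"
      by (intro power_increasing) (use less_exp[of n] in linarith)+
    finally show ?thesis using of_nat_mono by fastforce
  qed
  then have ex: "Q n" by (simp add: Q_def)
  define m where "m = (LEAST m. Q m)"
  have Qm: "Q m" unfolding m_def by (rule LeastI[of Q, OF ex])
  \<comment> \<open>Used for m = 0, where the walk length is 2 and there is no predecessor.\<close>
  have ln3: "1 \<le> ln (real n)"
  proof -
    have "exp 1 \<le> (3::real)" by (rule exp_le)
    then have "exp 1 \<le> real n" using assms by linarith
    then show ?thesis using ln_ge_iff[of "real n" 1] assms by simp
  qed
  have "real (2 * 2 ^ m) \<le> 4 * ln (real n)"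
  proof (cases m)
    case 0
    then show ?thesis using ln3 by simp
  next
    case (Suc m')
    then have "\<not> Q m'" using not_less_Least[of m' Q] by (simp add: m_def)
    then have "2 ^ (2 * 2 ^ m') < real n" by (simp add: Q_def)
    then have "ln ((2::real) ^ (2 * 2 ^ m')) < ln (real n)" by (subst ln_less_cancel_iff) auto
    then have "real (2 * 2 ^ m') * ln 2 < ln (real n)" by (simp only: ln_realpow zero_less_numeral)
    moreover have "real (2 * 2 ^ m') * (1 / 2) \<le> real (2 * 2 ^ m') * ln 2"
      using ln2_ge_two_thirds by (intro mult_left_mono) auto
    ultimately have "real (2 * 2 ^ m') \<le> 2 * ln (real n)" by linarith
    then show ?thesis by (simp add: Suc)
  qed
  then show ?thesis using that Qm by (simp add: Q_def)
qed

theorem theorem2p1: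
  shows "\<exists>c::nat. \<exists>err :: nat \<Rightarrow> real.
           err \<in> O(\<lambda>n. 1 / real n ^ 4) \<and>
           (\<forall>n\<ge>2. measure_pmf.prob (erdos_renyi n (1/2))
                      {G. sdpval n G \<ge> sqrt (real n) / ln (real n) ^ c} \<ge> 1 - err n)"
proof -
  \<comment> \<open>As \<Lambda> is of order (ln n)^4, one more logarithm absorbs all constants;
    hence c = 5.\<close>
  have "eventually (\<lambda>n. 2 ^ 18 * (4 * ln (real n) + 1) ^ 4 * 10 ^ 20 \<le> ln (real n) ^ 5) at_top"
    by real_asymp
  then obtain n0 where n0: "2 ^ 18 * (4 * ln (real n) + 1) ^ 4 * 10 ^ 20 \<le> ln (real n) ^ 5" if "n \<ge> n0" for n :: nat
    unfolding eventually_at_top_linorder by blast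
  \<comment> \<open>Below the threshold the error is 1, which makes the claim trivial there.\<close>
  define err :: "nat \<Rightarrow> real" where "err n = (if n \<ge> max n0 3 then 4 / real n ^ 4 else 1)" for n
  have "err \<in> O(\<lambda>n. 1 / real n ^ 4)"
  proof (rule bigoI[where c = 4])
    show "eventually (\<lambda>n. norm (err n) \<le> 4 * norm (1 / real n ^ 4)) at_top"
      unfolding eventually_at_top_linorder by (rule exI[of _ "max n0 3"]) (simp add: err_def)
  qed
  moreover have "measure_pmf.prob (erdos_renyi n (1/2)) {G. sdpval n G \<ge> sqrt (real n) / ln (real n) ^ 5} \<ge> 1 - err n" for n
  proof (cases "n \<ge> max n0 3")
    case False
    show ?thesis unfolding err_def if_not_P[OF False] by simp
  next
    case True
    then have n: "n \<ge> 3" "n \<ge> n0" by auto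
    obtain m where m: "real n \<le> 2 ^ (2 * 2 ^ m)" "real (2 * 2 ^ m) \<le> 4 * ln (real n)"
      using dyadic_walk_length[OF n(1)] .
    define \<Lambda> where "\<Lambda> = 2 ^ 18 * real (Suc (2 * 2 ^ m)) ^ 4"
    have \<Lambda>1: "\<Lambda> \<ge> 1"
    proof -
      have "1 \<le> real (Suc (2 * 2 ^ m)) ^ 4" by (rule one_le_power) simp
      then have "1 * 1 \<le> 2 ^ 18 * real (Suc (2 * 2 ^ m)) ^ 4" by (intro mult_mono) auto
      then show ?thesis unfolding \<Lambda>_def by simp
    qed
    have ln0: "ln (real n) > 0" using n(1) by simp
    have "real (Suc (2 * 2 ^ m)) ^ 4 \<le> (4 * ln (real n) + 1) ^ 4"
      using m(2) by (intro power_mono) auto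
    then have "\<Lambda> * 10 ^ 20 \<le> 2 ^ 18 * (4 * ln (real n) + 1) ^ 4 * 10 ^ 20"
      unfolding \<Lambda>_def by (intro mult_right_mono mult_left_mono) auto
    also have "\<dots> \<le> ln (real n) ^ 5" by (rule n0[OF n(2)])
    finally have \<Lambda>: "\<Lambda> * 10 ^ 20 \<le> ln (real n) ^ 5" .
    have "sdpval n G \<ge> sqrt (real n) / ln (real n) ^ 5" if "pseudorandom n \<Lambda> G" for G
    proof -
      have "sqrt (real n) / ln (real n) ^ 5 \<le> sqrt (real n) / (\<Lambda> * 10 ^ 20)"
        using \<Lambda> \<Lambda>1 ln0 by (intro divide_left_mono mult_pos_pos) auto
      also have "\<dots> \<le> sdpval n G"
        using sdpval_ge_of_pseudorandom[OF that _ \<Lambda>1] n(1) by simp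
      finally show ?thesis .
    qed
    then have "measure_pmf.prob (erdos_renyi n (1/2)) {G. pseudorandom n \<Lambda> G}
        \<le> measure_pmf.prob (erdos_renyi n (1/2)) {G. sdpval n G \<ge> sqrt (real n) / ln (real n) ^ 5}"
      by (intro measure_pmf.finite_measure_mono) auto
    moreover have "measure_pmf.prob (erdos_renyi n (1/2)) {G. pseudorandom n \<Lambda> G} \<ge> 1 - 4 / real n ^ 4"
      unfolding \<Lambda>_def using n(1) m(1) by (intro prob_pseudorandom) auto
    ultimately show ?thesis using True by (simp add: err_def)
  qed
  ultimately show ?thesis by blast
qed

end
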